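(* Let $\Omega\subset\mathbb{R}^n$ be open and bounded, and let $E\subset\mathbb{R}^n$ be measurable with ${\rm Per}^\kappa_{s_0}(E,\Omega)<\infty$ for some $s_0\in(0,1/2)$. Suppose $\Xi^\kappa_E$ exists, i.e. the limit $\lim_{s\to0^+}s\Lambda^\kappa_E(x,r,s)$ exists for some pair $(x,r)\in\mathbb{R}^n\times(0,\infty)$. Then $\lim_{s\to0^+}s\,{\rm Per}^\kappa_s(E,\Omega)$ exists and $$\lim_{s\to0^+}s\,{\rm Per}^\kappa_s(E,\Omega)=2\Xi^\kappa_{E^c}\mu_\kappa(E\cap\Omega)+2\Xi^\kappa_E\mu_\kappa(E^c\cap\Omega)=2\big[(1-\Xi^\kappa_E)\mu_\kappa(E\cap\Omega)+\Xi^\kappa_E\mu_\kappa(E^c\cap\Omega)\big].$$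
   Context: Dunkl setting on $\mathbb{R}^n$: root system $\mathcal{R}$ (finite nonempty subset of $\mathbb{R}^n\setminus\{0\}$ with $\mathcal{R}\cap\alpha\mathbb{R}=\{\pm\alpha\}$, $r_\alpha(\mathcal{R})=\mathcal{R}$, $|\alpha|=\sqrt2$, where $r_\alpha x=x-2\frac{\langle\alpha,x\rangle}{|\alpha|^2}\alpha$), finite reflection group $G$ generated by the $r_\alpha$, positive subsystem $\mathcal{R}_+$, $G$-invariant multiplicity $\kappa:\mathcal{R}\to[0,\infty)$. Dunkl Laplacian $\Delta_\kappa f(x)=\Delta f(x)+2\sum_{\alpha\in\mathcal{R}_+}\kappa(\alpha)\big(\frac{\langle\alpha,\nabla f(x)\rangle}{\langle\alpha,x\rangle}-\frac{f(x)-f(r_\alpha x)}{\langle\alpha,x\rangle^2}\big)$; $\mu_\kappa=w_\kappa\,dx$ with $w_\kappa(x)=\prod_{\alpha\in\mathcal{R}_+}|\langle\alpha,x\rangle|^{2\kappa(\alpha)}$; $(P_t^\kappa)$ the Dunkl heat semigroup generated by $\Delta_\kappa$ with heat kernel $p_t^\kappa$ w.r.t. $\mu_\kappa$, $P_t^\kappa f(x)=\int f(y)p_t^\kappa(x,y)\mu_\kappa(dy)$. Pseudo-metric $d(x,y)=\min_{g\in G}|x-gy|$, $B_d(x,r)=\{y:d(x,y)<r\}$. For $s>0$ and disjoint measurable $A,B$: $L^\kappa_s(A,B)=\int_0^\infty t^{-(1+s)}\int_A P_t^\kappa\mathbf{1}_B(x)\,\mu_\kappa(dx)\,dt$. For open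 $\Omega$, $s\in(0,1/2)$, measurable $E$ (with $E^c=\mathbb{R}^n\setminus E$): ${\rm Per}^\kappa_s(E,\Omega)=2[L^\kappa_s(E\cap\Omega,E^c\cap\Omega)+L^\kappa_s(E\cap\Omega,E^c\cap\Omega^c)+L^\kappa_s(E\cap\Omega^c,E^c\cap\Omega)]$. For measurable $E$, $\Lambda^\kappa_E(x,r,s)=\int_1^\infty P_t^\kappa(\mathbf{1}_{E\cap B_d(x,r)^c})(x)\,t^{-(1+s)}dt$. The paper shows that if $\lim_{s\to0^+}s\Lambda^\kappa_E(x,r,s)$ exists for one pair $(x,r)$ then it exists for all pairs, is independent of $(x,r)$ and lies in $[0,1]$; this common value is denoted $\Xi^\kappa_E$, and then $\Xi^\kappa_{E^c}$ also exists and equals $1-\Xi^\kappa_E$. *)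

theory Defs
  imports "HOL-Analysis.Analysis"
begin

definition dunkl_refl :: "'a::euclidean_space \<Rightarrow> 'a \<Rightarrow> 'a" where
  "dunkl_refl \<alpha> x = x - (2 * (\<alpha> \<bullet> x) / (\<alpha> \<bullet> \<alpha>)) *\<^sub>R \<alpha>"

definition root_system :: "'a::euclidean_space set \<Rightarrow> bool" where
  "root_system R \<longleftrightarrow> finite R \<and> R \<noteq> {} \<and> 0 \<notin> R
     \<and> (\<forall>\<alpha>\<in>R. R \<inter> {c *\<^sub>R \<alpha> | c. True} = {\<alpha>, -\<alpha>})
     \<and> (\<forall>\<alpha>\<in>R. dunkl_refl \<alpha> ` R = R)
     \<and> (\<forall>\<alpha>\<in>R. norm \<alpha> = sqrt 2)"

definition positive_subsystem :: "'a::euclidean_space set \<Rightarrow> 'a set \<Rightarrow> bool" where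
  "positive_subsystem R Rp \<longleftrightarrow>
     (\<exists>\<beta>. (\<forall>\<alpha>\<in>R. \<alpha> \<bullet> \<beta> \<noteq> 0) \<and> Rp = {\<alpha>\<in>R. \<alpha> \<bullet> \<beta> > 0})"

inductive_set refl_group :: "'a::euclidean_space set \<Rightarrow> ('a \<Rightarrow> 'a) set" for R where
  id_in: "id \<in> refl_group R"
| step: "g \<in> refl_group R \<Longrightarrow> \<alpha> \<in> R \<Longrightarrow> dunkl_refl \<alpha> \<circ> g \<in> refl_group R"

definition multiplicity :: "'a::euclidean_space set \<Rightarrow> ('a \<Rightarrow> real) \<Rightarrow> bool" where
  "multiplicity R \<kappa> \<longleftrightarrow> (\<forall>\<alpha>\<in>R. 0 \<le> \<kappa> \<alpha>)
     \<and> (\<forall>g\<in>refl_group R. \<forall>\<alpha>\<in>R. \<kappa> (g \<alpha>) = \<kappa> \<alpha>)"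

definition dunkl_weight :: "'a::euclidean_space set \<Rightarrow> ('a \<Rightarrow> real) \<Rightarrow> 'a \<Rightarrow> real" where
  "dunkl_weight Rp \<kappa> x = (\<Prod>\<alpha>\<in>Rp. \<bar>\<alpha> \<bullet> x\<bar> powr (2 * \<kappa> \<alpha>))"

definition dunkl_measure :: "'a::euclidean_space set \<Rightarrow> ('a \<Rightarrow> real) \<Rightarrow> 'a measure" where
  "dunkl_measure Rp \<kappa> = density lebesgue (\<lambda>x. ennreal (dunkl_weight Rp \<kappa> x))"

definition dunkl_op :: "'a::euclidean_space set \<Rightarrow> ('a \<Rightarrow> real) \<Rightarrow> ('a \<Rightarrow> real) \<Rightarrow> 'a \<Rightarrow> 'a \<Rightarrow> real" where
  "dunkl_op Rp \<kappa> f \<xi> x = frechet_derivative f (at x) \<xi>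
      + (\<Sum>\<alpha>\<in>Rp. \<kappa> \<alpha> * (\<alpha> \<bullet> \<xi>) * (f x - f (dunkl_refl \<alpha> x)) / (\<alpha> \<bullet> x))"

definition dunkl_kernel :: "'a::euclidean_space set \<Rightarrow> ('a \<Rightarrow> real) \<Rightarrow> 'a \<Rightarrow> 'a \<Rightarrow> real" where
  "dunkl_kernel Rp \<kappa> x y = (THE f. (\<forall>z. f differentiable (at z)) \<and> f 0 = 1 \<and>
       (\<forall>\<xi> z. (\<forall>\<alpha>\<in>Rp. \<alpha> \<bullet> z \<noteq> 0) \<longrightarrow> dunkl_op Rp \<kappa> f \<xi> z = (\<xi> \<bullet> y) * f z)) x"

definition dunkl_const :: "'a::euclidean_space set \<Rightarrow> ('a \<Rightarrow> real) \<Rightarrow> real" where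
  "dunkl_const Rp \<kappa> = integral\<^sup>L lebesgue (\<lambda>x. exp (- (norm x)\<^sup>2 / 2) * dunkl_weight Rp \<kappa> x)"

text \<open>Dunkl heat kernel (Roesler), w.r.t. the measure mu_kappa.\<close>
definition dunkl_heat_kernel :: "'a::euclidean_space set \<Rightarrow> ('a \<Rightarrow> real) \<Rightarrow> real \<Rightarrow> 'a \<Rightarrow> 'a \<Rightarrow> real" where
  "dunkl_heat_kernel Rp \<kappa> t x y =
     exp (- ((norm x)\<^sup>2 + (norm y)\<^sup>2) / (4 * t))
     * dunkl_kernel Rp \<kappa> (x /\<^sub>R sqrt (2 * t)) (y /\<^sub>R sqrt (2 * t))
     / ((2 * t) powr ((\<Sum>\<alpha>\<in>Rp. \<kappa> \<alpha>) + real DIM('a) / 2) * dunkl_const Rp \<kappa>)"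

definition heat_ind :: "'a::euclidean_space set \<Rightarrow> ('a \<Rightarrow> real) \<Rightarrow> real \<Rightarrow> 'a set \<Rightarrow> 'a \<Rightarrow> ennreal" where
  "heat_ind Rp \<kappa> t B x = (\<integral>\<^sup>+ y\<in>B. ennreal (dunkl_heat_kernel Rp \<kappa> t x y) \<partial>dunkl_measure Rp \<kappa>)"

definition L_s :: "'a::euclidean_space set \<Rightarrow> ('a \<Rightarrow> real) \<Rightarrow> real \<Rightarrow> 'a set \<Rightarrow> 'a set \<Rightarrow> ennreal" where
  "L_s Rp \<kappa> s A B = (\<integral>\<^sup>+ t\<in>{0<..}. ennreal (t powr (-(1 + s)))
        * (\<integral>\<^sup>+ x\<in>A. heat_ind Rp \<kappa> t B x \<partial>dunkl_measure Rp \<kappa>) \<partial>lborel)"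

definition Per_s :: "'a::euclidean_space set \<Rightarrow> ('a \<Rightarrow> real) \<Rightarrow> real \<Rightarrow> 'a set \<Rightarrow> 'a set \<Rightarrow> ennreal" where
  "Per_s Rp \<kappa> s E \<Omega> = 2 * (L_s Rp \<kappa> s (E \<inter> \<Omega>) (- E \<inter> \<Omega>)
        + L_s Rp \<kappa> s (E \<inter> \<Omega>) (- E \<inter> - \<Omega>) + L_s Rp \<kappa> s (E \<inter> - \<Omega>) (- E \<inter> \<Omega>))"

definition dist_G :: "'a::euclidean_space set \<Rightarrow> 'a \<Rightarrow> 'a \<Rightarrow> real" where
  "dist_G R x y = Inf ((\<lambda>g. norm (x - g y)) ` refl_group R)"

definition ball_G :: "'a::euclidean_space set \<Rightarrow> 'a \<Rightarrow> real \<Rightarrow> 'a set" where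
  "ball_G R x r = {y. dist_G R x y < r}"

definition Lambda :: "'a::euclidean_space set \<Rightarrow> 'a set \<Rightarrow> ('a \<Rightarrow> real) \<Rightarrow> 'a set \<Rightarrow> 'a \<Rightarrow> real \<Rightarrow> real \<Rightarrow> ennreal" where
  "Lambda R Rp \<kappa> E x r s = (\<integral>\<^sup>+ t\<in>{1..}. heat_ind Rp \<kappa> t (E \<inter> - ball_G R x r) x
        * ennreal (t powr (-(1 + s))) \<partial>lborel)"

definition Xi_exists :: "'a::euclidean_space set \<Rightarrow> 'a set \<Rightarrow> ('a \<Rightarrow> real) \<Rightarrow> 'a set \<Rightarrow> bool" where
  "Xi_exists R Rp \<kappa> E \<longleftrightarrow> (\<exists>x r L. 0 < r \<and>
       ((\<lambda>s. ennreal s * Lambda R Rp \<kappa> E x r s) \<longlongrightarrow> L) (at_right 0))"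

text \<open>The common value of the limit (the paper shows it does not depend on (x,r)).\<close>
definition Xi :: "'a::euclidean_space set \<Rightarrow> 'a set \<Rightarrow> ('a \<Rightarrow> real) \<Rightarrow> 'a set \<Rightarrow> real" where
  "Xi R Rp \<kappa> E = enn2real (SOME L. \<exists>x r. 0 < r \<and>
       ((\<lambda>s. ennreal s * Lambda R Rp \<kappa> E x r s) \<longlongrightarrow> L) (at_right 0))"

end

theory Submission
  imports Defs
begin

text \<open>The Dunkl kernel \<open>E\<close> is only used through three facts: it exists and is unique as a joint
  eigenfunction, it is jointly Borel measurable, and \<open>|E(x,y) - 1| \<le> exp(|x||y|) - 1\<close>. They come
  from the series \<open>E = \<Sum> E\<^sub>n\<close> of homogeneous polynomials determined by
  \<open>(n + \<Sum> \<kappa>(\<alpha>)(1 - r\<^sub>\<alpha>)) E\<^sub>n = \<langle>x,y\<rangle> E\<^sub>n\<^sub>-\<^sub>1\<close>, where the resolvent is averaging over the reflection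
  group; commutativity of the Dunkl operators makes \<open>E\<close> an eigenfunction.

  By the estimate and scaling, for \<open>t \<ge> 1\<close> and \<open>x\<close> in a bounded set the heat kernels \<open>p\<^sub>t(x,\<sqdot>)\<close> and
  \<open>p\<^sub>t(\<sqdot>,x)\<close> are within \<open>O(t\<^sup>-\<^sup>1\<^sup>/\<^sup>2)\<close> in \<open>L\<^sup>1(\<mu>\<^sub>\<kappa>)\<close> of the probability density \<open>p\<^sub>t(0,\<sqdot>)\<close>. Hence
  \<open>s \<Lambda>\<^sub>E(x,r,s)\<close> and the average \<open>\<Phi>\<^sub>E(s) = s \<integral>\<^sub>1\<^sup>\<infinity> t\<^sup>-\<^sup>1\<^sup>-\<^sup>s \<integral>\<^sub>E p\<^sub>t(0,y) \<mu>\<^sub>\<kappa>(dy) dt\<close> differ by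
  \<open>O(s)\<close>, and so do \<open>s L\<^sub>s(A,B)\<close> and \<open>\<mu>\<^sub>\<kappa>(A) \<Phi>\<^sub>B(s)\<close> for bounded \<open>A\<close>. Bounded sets have \<open>\<Phi> = O(s)\<close>,
  and \<open>\<Phi>\<^sub>E + \<Phi>\<^sub>E\<^sub>c = 1\<close>.\<close>

text \<open>\<open>dunkl_kernel\<close> is a definite description over functions that are
  differentiable everywhere and satisfy the eigenfunction equations off the hyperplanes, so nothing
  can be said about the heat kernel before existence and uniqueness hold in exactly that class. The
  recursion for E_n is forced: put \<xi> = x in T_\<xi> E_n = <\<xi>,y> E_(n-1); Euler's identity
  then cancels all denominators. This settles the radial direction only. For the other directions,
  the defect T_\<xi> E_n - <\<xi>,y> E_(n-1) is shown to satisfy a homogeneous equation that a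
  maximum principle on group orbits forces to be trivial. The averaging has nonnegative coefficients
  of total mass 1/n; this is where the factorials, and hence the exponential in the estimate of E,
  come from. The estimate sees only |x||y|, so both slots of p_t can be compared with the same
  Gaussian. The rate t^(-1/2) is integrable against dt/t at infinity, so the error contributes a
  bounded amount to the time integral, and the factor s turns it into O(s).\<close>

section \<open>Reflections and the group they generate\<close>

lemma linear_dunkl_refl: "linear (dunkl_refl \<alpha>)"
  unfolding dunkl_refl_def
  by (intro linearI) (simp_all add: inner_add_right add_divide_distrib algebra_simps)

lemma bounded_linear_dunkl_refl: "bounded_linear (dunkl_refl \<alpha>)"
  by (simp add: linear_dunkl_refl linear_conv_bounded_linear[symmetric])

lemma inner_dunkl_refl_left: "dunkl_refl \<alpha> x \<bullet> y = x \<bullet> dunkl_refl \<alpha> y"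
  unfolding dunkl_refl_def by (simp add: inner_diff_left inner_diff_right inner_commute)

lemma dunkl_refl_involution [simp]: "dunkl_refl \<alpha> (dunkl_refl \<alpha> x) = x"
proof (cases "\<alpha> = 0")
  case False
  then show ?thesis
    unfolding dunkl_refl_def by (simp add: inner_diff_right algebra_simps)
qed (simp add: dunkl_refl_def)

lemma norm_dunkl_refl [simp]: "norm (dunkl_refl \<alpha> x) = norm x"
  by (simp add: norm_eq_sqrt_inner inner_dunkl_refl_left)

lemma dunkl_refl_comp_self [simp]: "dunkl_refl \<alpha> \<circ> dunkl_refl \<alpha> = id"
  by auto

lemma refl_group_linear: "g \<in> refl_group R \<Longrightarrow> linear g"
proof (induction rule: refl_group.induct)
  case id_in
  then show ?case by (rule linear_id)
next
  case (step g \<alpha>)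
  then show ?case by (blast intro: linear_compose linear_dunkl_refl)
qed

lemma refl_group_norm: "g \<in> refl_group R \<Longrightarrow> norm (g x) = norm x"
  by (induction rule: refl_group.induct) auto

text \<open>\<open>refl_group\<close> is generated by composing on the left, but sums over the group
  are also reindexed by composition on the right.\<close>

lemma refl_group_comp_refl:
  "g \<in> refl_group R \<Longrightarrow> \<alpha> \<in> R \<Longrightarrow> g \<circ> dunkl_refl \<alpha> \<in> refl_group R"
proof (induction rule: refl_group.induct)
  case id_in
  then show ?case using refl_group.step[OF refl_group.id_in, of \<alpha> R] by simp
next
  case (step g \<beta>)
  then show ?case using refl_group.step[of "g \<circ> dunkl_refl \<alpha>" R \<beta>] by (metis comp_assoc)
qed

lemma dunkl_refl_fix: "\<alpha> \<bullet> x = 0 \<Longrightarrow> dunkl_refl \<alpha> x = x"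
  by (simp add: dunkl_refl_def)

section \<open>Frechet derivatives and polynomial functions\<close>

lemma frechet_derivative_add:
  assumes "f differentiable at x" "g differentiable at x"
  shows "frechet_derivative (\<lambda>x. f x + g x) (at x) \<xi>
    = frechet_derivative f (at x) \<xi> + frechet_derivative g (at x) \<xi>"
  using frechet_derivative_at[OF has_derivative_add[OF assms[unfolded frechet_derivative_works]]]
  by metis

lemma frechet_derivative_mult:
  fixes f g :: "'a::real_normed_vector \<Rightarrow> real"
  assumes "f differentiable at x" "g differentiable at x"
  shows "frechet_derivative (\<lambda>x. f x * g x) (at x) \<xi>
    = f x * frechet_derivative g (at x) \<xi> + frechet_derivative f (at x) \<xi> * g x"
  using frechet_derivative_at[OF has_derivative_mult[OF assms[unfolded frechet_derivative_works]]]
  by metis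

lemma frechet_derivative_linear: "bounded_linear f \<Longrightarrow> frechet_derivative f (at x) = f"
  using frechet_derivative_at[OF bounded_linear_imp_has_derivative] by metis

lemma frechet_derivative_chain_linear:
  fixes f :: "'a::real_normed_vector \<Rightarrow> real"
  assumes "f differentiable at (h x)" "bounded_linear h"
  shows "frechet_derivative (\<lambda>x. f (h x)) (at x) \<xi> = frechet_derivative f (at (h x)) (h \<xi>)"
proof -
  have "((\<lambda>x. f (h x)) has_derivative (\<lambda>\<xi>. frechet_derivative f (at (h x)) (h \<xi>))) (at x)"
    using diff_chain_at[OF bounded_linear_imp_has_derivative[OF assms(2)] assms(1)[unfolded frechet_derivative_works]]
    by (simp add: o_def)
  then show ?thesis using frechet_derivative_at by metis
qed

abbreviation polyfun :: "('a::real_normed_vector \<Rightarrow> real) \<Rightarrow> bool" where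
  "polyfun \<equiv> real_polynomial_function"

lemmas polyfun_linear = real_polynomial_function.intros(1)
lemmas polyfun_const = real_polynomial_function.intros(2)
lemmas polyfun_add = real_polynomial_function.intros(3)
lemmas polyfun_mult = real_polynomial_function.intros(4)

lemma polyfun_differentiable: "polyfun f \<Longrightarrow> f differentiable at x"
  by (rule differentiable_at_real_polynomial_function)

lemma polyfun_linear_comp: "polyfun f \<Longrightarrow> bounded_linear h \<Longrightarrow> polyfun (\<lambda>x. f (h x))"
  for f :: "'a::real_normed_vector \<Rightarrow> real" and h :: "'a \<Rightarrow> 'a"
  using real_polynomial_function_compose[of h f] polynomial_function_bounded_linear[of h]
  by (simp add: o_def)

lemma polyfun_refl: "polyfun f \<Longrightarrow> polyfun (\<lambda>x. f (dunkl_refl \<alpha> x))" for f :: "'a::euclidean_space \<Rightarrow> real"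
  by (rule polyfun_linear_comp[OF _ bounded_linear_dunkl_refl])

lemma polyfun_inner: "polyfun (\<lambda>x. x \<bullet> \<zeta>)" for \<zeta> :: "'a::euclidean_space"
  by (intro polyfun_linear bounded_linear_inner_left)

lemma polyfun_frechet_derivative: "polyfun f \<Longrightarrow> polyfun (\<lambda>x. frechet_derivative f (at x) \<xi>)"
  for f :: "'a::real_normed_vector \<Rightarrow> real"
proof (induction rule: real_polynomial_function.induct)
  case (linear f)
  then show ?case by (simp add: frechet_derivative_linear polyfun_const)
next
  case (const c)
  then show ?case by (simp add: polyfun_const)
next
  case (add f g)
  then show ?case by (simp add: frechet_derivative_add polyfun_differentiable polyfun_add)
next
  case (mult f g)
  then show ?case
    by (simp add: frechet_derivative_mult polyfun_differentiable polyfun_add polyfun_mult)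
qed

text \<open>Euler's identity: the map c -> f(c x) is differentiated at c = 1 in two ways.
  Homogeneity is assumed for c > 0 only, which is an open set around 1.\<close>

lemma frechet_derivative_homogeneous:
  fixes f :: "'a::real_normed_vector \<Rightarrow> real"
  assumes "f differentiable at x" "\<And>c. c > 0 \<Longrightarrow> f (c *\<^sub>R x) = c ^ n * f x"
  shows "frechet_derivative f (at x) x = real n * f x"
proof -
  have "((\<lambda>c. f (c *\<^sub>R x)) has_derivative (\<lambda>h. frechet_derivative f (at x) (h *\<^sub>R x))) (at 1)"
  proof (rule has_derivative_compose[of "\<lambda>c. c *\<^sub>R x"])
    show "((\<lambda>c. c *\<^sub>R x) has_derivative (\<lambda>h. h *\<^sub>R x)) (at 1)"
      by (intro derivative_eq_intros) auto
    show "(f has_derivative frechet_derivative f (at x)) (at (1 *\<^sub>R x))"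
      using assms(1) by (simp add: frechet_derivative_works)
  qed
  then have "((\<lambda>c. c ^ n * f x) has_derivative (\<lambda>h. frechet_derivative f (at x) (h *\<^sub>R x))) (at 1)"
    by (rule has_derivative_transform_within_open[of _ _ _ _ "{0<..}"]) (auto simp: assms(2))
  moreover have "((\<lambda>c::real. c ^ n * f x) has_derivative (\<lambda>h. h * (real n * f x))) (at 1)"
    by (auto intro!: derivative_eq_intros)
  ultimately have "(\<lambda>h. frechet_derivative f (at x) (h *\<^sub>R x)) = (\<lambda>h. h * (real n * f x))"
    by (rule has_derivative_unique)
  from fun_cong[OF this, of 1] show ?thesis by simp
qed

lemma exp_sums: "(\<lambda>n. q ^ n / fact n) sums exp q" for q :: real
  using exp_converges[of q] by (simp add: field_simps)

section \<open>Root systems with a multiplicity: finiteness of the group and reindexing of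
  sums\<close>

locale root_multiplicity =
  fixes R :: "'a::euclidean_space set" and k :: "'a \<Rightarrow> real"
  assumes finite_R: "finite R"
    and root_inner_self: "\<alpha> \<in> R \<Longrightarrow> \<alpha> \<bullet> \<alpha> = 2"
    and refl_root: "\<alpha> \<in> R \<Longrightarrow> \<beta> \<in> R \<Longrightarrow> dunkl_refl \<alpha> \<beta> \<in> R"
    and k_nonneg: "\<alpha> \<in> R \<Longrightarrow> 0 \<le> k \<alpha>"
    and k_refl: "\<alpha> \<in> R \<Longrightarrow> \<beta> \<in> R \<Longrightarrow> k (dunkl_refl \<alpha> \<beta>) = k \<beta>"
begin

lemma dunkl_refl_root_eq: "\<alpha> \<in> R \<Longrightarrow> dunkl_refl \<alpha> x = x - (\<alpha> \<bullet> x) *\<^sub>R \<alpha>"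
  by (simp add: dunkl_refl_def root_inner_self)

lemma refl_group_root: "g \<in> refl_group R \<Longrightarrow> \<alpha> \<in> R \<Longrightarrow> g \<alpha> \<in> R"
  by (induction rule: refl_group.induct) (auto simp: refl_root)

text \<open>An element is determined by its values on the roots: a reflection fixes every vector
  orthogonal to its root, so the group fixes the orthogonal complement of \<open>span R\<close>
  pointwise. Hence it embeds into the finite set of maps from \<open>R\<close> to
  \<open>R\<close>.\<close>

lemma finite_refl_group: "finite (refl_group R)"
proof (rule inj_on_finite[where f="\<lambda>g. restrict g R" and B="R \<rightarrow>\<^sub>E R"])
  show "inj_on (\<lambda>g. restrict g R) (refl_group R)"
  proof (rule inj_onI)
    fix g h assume g: "g \<in> refl_group R" and h: "h \<in> refl_group R"
      and eq: "restrict g R = restrict h R"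
    have eqR: "g \<alpha> = h \<alpha>" if "\<alpha> \<in> R" for \<alpha>
      using fun_cong[OF eq, of \<alpha>] that by simp
    have orth: "f z = z" if "f \<in> refl_group R" "\<forall>\<alpha>\<in>R. \<alpha> \<bullet> z = 0" for f z
      using that by (induction rule: refl_group.induct) (auto simp: dunkl_refl_root_eq)
    show "g = h"
    proof
      fix x
      obtain y z where yz: "y \<in> span R" "\<And>w. w \<in> span R \<Longrightarrow> orthogonal z w" "x = y + z"
        using orthogonal_subspace_decomp_exists[of R x] by blast
      have "\<forall>\<alpha>\<in>R. \<alpha> \<bullet> z = 0"
        using yz(2) span_base unfolding orthogonal_def by (metis inner_commute)
      then have "g z = z" "h z = z" using orth g h by auto
      moreover have "g y = h y"
        using linear_eq_on[OF refl_group_linear[OF g] refl_group_linear[OF h] yz(1)] eqR by blast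
      ultimately show "g x = h x"
        using yz(3) linear_add[OF refl_group_linear[OF g]] linear_add[OF refl_group_linear[OF h]] by simp
    qed
  qed
  show "(\<lambda>g. restrict g R) ` refl_group R \<subseteq> R \<rightarrow>\<^sub>E R"
    using refl_group_root by (auto simp: Pi_iff)
  show "finite (R \<rightarrow>\<^sub>E R)" using finite_R by (simp add: finite_PiE)
qed

lemma sum_refl_group_comp:
  assumes "\<alpha> \<in> R"
  shows "(\<Sum>g\<in>refl_group R. F (g \<circ> dunkl_refl \<alpha>)) = sum F (refl_group R)"
  by (rule sum.reindex_bij_witness[where i="\<lambda>g. g \<circ> dunkl_refl \<alpha>" and j="\<lambda>g. g \<circ> dunkl_refl \<alpha>"])
     (auto simp: refl_group_comp_refl assms comp_assoc)

lemma sum_refl_group_step: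
  assumes "\<alpha> \<in> R"
  shows "(\<Sum>g\<in>refl_group R. F (dunkl_refl \<alpha> \<circ> g)) = sum F (refl_group R)"
  by (rule sum.reindex_bij_witness[where i="\<lambda>g. dunkl_refl \<alpha> \<circ> g" and j="\<lambda>g. dunkl_refl \<alpha> \<circ> g"])
     (auto simp: refl_group.step assms comp_assoc[symmetric])

lemma sum_roots_refl:
  assumes "\<beta> \<in> R"
  shows "(\<Sum>\<alpha>\<in>R. F (dunkl_refl \<beta> \<alpha>)) = sum F R"
  by (rule sum.reindex_bij_witness[where i="dunkl_refl \<beta>" and j="dunkl_refl \<beta>"])
     (auto simp: refl_root assms)

subsection \<open>Dunkl operators on polynomials\<close>

text \<open>On the hyperplane the quotient is replaced by its limit, so that it maps polynomials to polynomials.\<close>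

definition divdiff :: "'a \<Rightarrow> ('a \<Rightarrow> real) \<Rightarrow> 'a \<Rightarrow> real" where
  "divdiff \<alpha> f x = (if \<alpha> \<bullet> x = 0 then frechet_derivative f (at x) \<alpha>
     else (f x - f (dunkl_refl \<alpha> x)) / (\<alpha> \<bullet> x))"

definition dunklT :: "'a \<Rightarrow> ('a \<Rightarrow> real) \<Rightarrow> 'a \<Rightarrow> real" where
  "dunklT \<xi> f x = frechet_derivative f (at x) \<xi> + (\<Sum>\<alpha>\<in>R. k \<alpha> * (\<alpha> \<bullet> \<xi>) * divdiff \<alpha> f x)"

lemma divdiff_add:
  assumes "f differentiable at x" "g differentiable at x"
  shows "divdiff \<alpha> (\<lambda>x. f x + g x) x = divdiff \<alpha> f x + divdiff \<alpha> g x"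
  by (simp add: divdiff_def frechet_derivative_add assms add_divide_distrib diff_divide_distrib)

text \<open>A skew Leibniz rule, from adding and subtracting f(x) g(r_\<alpha> x). On the hyperplane
  r_\<alpha> x = x, and it is the ordinary product rule.\<close>

lemma divdiff_mult:
  assumes "f differentiable at x" "g differentiable at x"
  shows "divdiff \<alpha> (\<lambda>x. f x * g x) x = f x * divdiff \<alpha> g x + g (dunkl_refl \<alpha> x) * divdiff \<alpha> f x"
  by (simp add: divdiff_def frechet_derivative_mult assms dunkl_refl_fix field_simps)

lemma divdiff_const: "divdiff \<alpha> (\<lambda>x. c) x = 0"
  by (simp add: divdiff_def)

lemma divdiff_linear:
  assumes "bounded_linear f" "\<alpha> \<in> R"
  shows "divdiff \<alpha> f x = f \<alpha>"
proof -
  interpret bounded_linear f by fact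
  show ?thesis
    by (simp add: divdiff_def frechet_derivative_linear assms dunkl_refl_root_eq diff scaleR)
qed

text \<open>Multiplied out, the equation holds on the hyperplane too, where both sides
  vanish.\<close>

lemma divdiff_eq: "\<alpha> \<in> R \<Longrightarrow> (\<alpha> \<bullet> x) * divdiff \<alpha> f x = f x - f (dunkl_refl \<alpha> x)"
  by (simp add: divdiff_def dunkl_refl_fix)

text \<open>The reflection in r_\<beta> \<alpha> is r_\<beta> r_\<alpha> r_\<beta>, and r_\<beta>
  preserves inner products.\<close>

lemma divdiff_refl_comp:
  assumes "f differentiable at (dunkl_refl \<beta> x)" "\<alpha> \<in> R" "\<beta> \<in> R"
  shows "divdiff \<alpha> (\<lambda>x. f (dunkl_refl \<beta> x)) x = divdiff (dunkl_refl \<beta> \<alpha>) f (dunkl_refl \<beta> x)"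
proof -
  have 1: "dunkl_refl \<beta> \<alpha> \<bullet> dunkl_refl \<beta> x = \<alpha> \<bullet> x"
    by (simp add: inner_dunkl_refl_left)
  have 2: "dunkl_refl (dunkl_refl \<beta> \<alpha>) (dunkl_refl \<beta> x) = dunkl_refl \<beta> (dunkl_refl \<alpha> x)"
    using 1 assms by (simp add: dunkl_refl_root_eq[of "dunkl_refl \<beta> \<alpha>"] refl_root dunkl_refl_root_eq[of \<alpha>]
        linear_diff[OF linear_dunkl_refl] linear_scale[OF linear_dunkl_refl])
  show ?thesis
    unfolding divdiff_def 1 2 by (simp add: frechet_derivative_chain_linear assms bounded_linear_dunkl_refl)
qed

text \<open>The skew Leibniz rule reduces divisibility by \<alpha> \<bullet> x to the case of linear
  functions and constants, so no division of polynomials is carried out.\<close>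

lemma polyfun_divdiff:
  assumes "\<alpha> \<in> R"
  shows "polyfun f \<Longrightarrow> polyfun (divdiff \<alpha> f)"
proof (induction rule: real_polynomial_function.induct)
  case (linear f)
  then show ?case using divdiff_linear[OF linear assms]
    by (metis (no_types, lifting) ext polyfun_const)
next
  case (const c)
  then show ?case using divdiff_const polyfun_const by (metis ext)
next
  case (add f g)
  have "divdiff \<alpha> (\<lambda>x. f x + g x) = (\<lambda>x. divdiff \<alpha> f x + divdiff \<alpha> g x)"
    using add by (intro ext divdiff_add polyfun_differentiable)
  then show ?case using add by (simp add: polyfun_add)
next
  case (mult f g)
  have "divdiff \<alpha> (\<lambda>x. f x * g x)
    = (\<lambda>x. f x * divdiff \<alpha> g x + g (dunkl_refl \<alpha> x) * divdiff \<alpha> f x)"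
    using mult by (intro ext divdiff_mult polyfun_differentiable)
  then show ?case using mult
    by (simp add: polyfun_add polyfun_mult polyfun_refl)
qed

lemma polyfun_dunklT: "polyfun f \<Longrightarrow> polyfun (dunklT \<xi> f)"
  unfolding dunklT_def[abs_def]
  by (intro polyfun_add polyfun_frechet_derivative real_polynomial_function_sum finite_R
      polyfun_mult polyfun_const polyfun_divdiff)

lemma dunklT_add:
  assumes "polyfun f" "polyfun g"
  shows "dunklT \<xi> (\<lambda>x. f x + g x) = (\<lambda>x. dunklT \<xi> f x + dunklT \<xi> g x)"
  using assms
  by (intro ext) (simp add: dunklT_def frechet_derivative_add divdiff_add polyfun_differentiable sum.distrib distrib_left)

lemma dunklT_const: "dunklT \<xi> (\<lambda>x. c) = (\<lambda>x. 0)"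
  by (intro ext) (simp add: dunklT_def divdiff_const)

lemma dunklT_cmult:
  assumes "polyfun f"
  shows "dunklT \<xi> (\<lambda>x. c * f x) = (\<lambda>x. c * dunklT \<xi> f x)"
proof -
  have "f differentiable at x" for x using assms polyfun_differentiable by blast
  then show ?thesis
    by (intro ext) (simp add: dunklT_def frechet_derivative_mult divdiff_mult divdiff_const distrib_left
        sum_distrib_left mult_ac)
qed

lemma dunklT_sum:
  assumes "finite I" "\<And>i. i \<in> I \<Longrightarrow> polyfun (f i)"
  shows "dunklT \<xi> (\<lambda>x. \<Sum>i\<in>I. f i x) = (\<lambda>x. \<Sum>i\<in>I. dunklT \<xi> (f i) x)"
  using assms
proof (induction I rule: finite_induct)
  case empty
  then show ?case by (simp add: dunklT_const)
next
  case (insert i I)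
  have "polyfun (\<lambda>x. \<Sum>i\<in>I. f i x)"
    using insert by (intro real_polynomial_function_sum) auto
  then show ?case using insert by (simp add: dunklT_add)
qed

lemma linear_dunklT:
  assumes "polyfun f"
  shows "linear (\<lambda>\<xi>. dunklT \<xi> f x)"
proof -
  interpret linear "frechet_derivative f (at x)"
    by (rule linear_frechet_derivative[OF polyfun_differentiable[OF assms]])
  show ?thesis
    by (intro linearI) (simp_all add: dunklT_def add scale inner_add_right sum.distrib sum_distrib_left algebra_simps)
qed

text \<open>The cross relation of the rational Cherednik algebra: the commutator of T_\<xi> with
  multiplication by x \<bullet> \<zeta> is a combination of the identity and the
  reflections.\<close>

lemma dunklT_coord:
  assumes "polyfun f"
  shows "dunklT \<xi> (\<lambda>x. (x \<bullet> \<zeta>) * f x) x = (x \<bullet> \<zeta>) * dunklT \<xi> f x + (\<xi> \<bullet> \<zeta>) * f x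
    + (\<Sum>\<alpha>\<in>R. k \<alpha> * (\<alpha> \<bullet> \<xi>) * (\<alpha> \<bullet> \<zeta>) * f (dunkl_refl \<alpha> x))"
proof -
  have bl: "bounded_linear (\<lambda>x. x \<bullet> \<zeta>)" by (rule bounded_linear_inner_left)
  have d: "(\<lambda>x. x \<bullet> \<zeta>) differentiable at x"
    using bl by (simp add: bounded_linear_imp_differentiable)
  have "divdiff \<alpha> (\<lambda>x. (x \<bullet> \<zeta>) * f x) x = (x \<bullet> \<zeta>) * divdiff \<alpha> f x + (\<alpha> \<bullet> \<zeta>) * f (dunkl_refl \<alpha> x)"
    if "\<alpha> \<in> R" for \<alpha>
    using divdiff_mult[OF d polyfun_differentiable[OF assms], of \<alpha>] divdiff_linear[OF bl that] by simp
  then show ?thesis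
    using frechet_derivative_mult[OF d polyfun_differentiable[OF assms], of \<xi>] frechet_derivative_linear[OF bl]
    by (simp add: dunklT_def algebra_simps sum.distrib sum_distrib_left)
qed

lemma dunklT_refl:
  assumes "polyfun f" "\<beta> \<in> R"
  shows "dunklT \<xi> (\<lambda>x. f (dunkl_refl \<beta> x)) x = dunklT (dunkl_refl \<beta> \<xi>) f (dunkl_refl \<beta> x)"
proof -
  have "(\<Sum>\<alpha>\<in>R. k \<alpha> * (\<alpha> \<bullet> \<xi>) * divdiff \<alpha> (\<lambda>x. f (dunkl_refl \<beta> x)) x)
    = (\<Sum>\<alpha>\<in>R. k (dunkl_refl \<beta> \<alpha>) * (dunkl_refl \<beta> \<alpha> \<bullet> dunkl_refl \<beta> \<xi>)
        * divdiff (dunkl_refl \<beta> \<alpha>) f (dunkl_refl \<beta> x))"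
    using assms
    by (intro sum.cong) (simp_all add: divdiff_refl_comp polyfun_differentiable k_refl inner_dunkl_refl_left)
  also have "\<dots> = (\<Sum>\<alpha>\<in>R. k \<alpha> * (\<alpha> \<bullet> dunkl_refl \<beta> \<xi>) * divdiff \<alpha> f (dunkl_refl \<beta> x))"
    using sum_roots_refl[OF assms(2), where F="\<lambda>\<alpha>. k \<alpha> * (\<alpha> \<bullet> dunkl_refl \<beta> \<xi>) * divdiff \<alpha> f (dunkl_refl \<beta> x)"]
    by simp
  finally show ?thesis
    using assms by (simp add: dunklT_def frechet_derivative_chain_linear polyfun_differentiable bounded_linear_dunkl_refl)
qed

lemma dunklT_refl_expand:
  assumes "polyfun f" "\<alpha> \<in> R"
  shows "dunklT \<xi> (\<lambda>x. f (dunkl_refl \<alpha> x)) x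
    = dunklT \<xi> f (dunkl_refl \<alpha> x) - (\<alpha> \<bullet> \<xi>) * dunklT \<alpha> f (dunkl_refl \<alpha> x)"
  using assms by (simp add: dunklT_refl dunkl_refl_root_eq[of \<alpha> \<xi>] linear_diff[OF linear_dunklT] linear_scale[OF linear_dunklT])

section \<open>Commutativity of the Dunkl operators\<close>

definition dunklT_bracket :: "'a \<Rightarrow> 'a \<Rightarrow> ('a \<Rightarrow> real) \<Rightarrow> 'a \<Rightarrow> real" where
  "dunklT_bracket \<xi> \<eta> f x = dunklT \<xi> (dunklT \<eta> f) x - dunklT \<eta> (dunklT \<xi> f) x"

text \<open>The point of this expansion is that everything after the first summand is symmetric in
  \<xi> and \<eta> and so cancels in the commutator.\<close>

lemma dunklT_dunklT_coord:
  assumes f: "polyfun f"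
  shows "dunklT \<xi> (dunklT \<eta> (\<lambda>x. (x \<bullet> \<zeta>) * f x)) x
    = (x \<bullet> \<zeta>) * dunklT \<xi> (dunklT \<eta> f) x + (\<xi> \<bullet> \<zeta>) * dunklT \<eta> f x + (\<eta> \<bullet> \<zeta>) * dunklT \<xi> f x
     + (\<Sum>\<alpha>\<in>R. k \<alpha> * (\<alpha> \<bullet> \<zeta>) * ((\<alpha> \<bullet> \<xi>) * dunklT \<eta> f (dunkl_refl \<alpha> x)
          + (\<alpha> \<bullet> \<eta>) * dunklT \<xi> f (dunkl_refl \<alpha> x) - (\<alpha> \<bullet> \<eta>) * (\<alpha> \<bullet> \<xi>) * dunklT \<alpha> f (dunkl_refl \<alpha> x)))"
proof -
  have lin: "polyfun (\<lambda>x. x \<bullet> \<zeta>)"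
    by (intro polyfun_linear bounded_linear_inner_left)
  note pt = polyfun_mult[OF lin polyfun_dunklT[OF f]]
  have pc: "polyfun (\<lambda>x. c * f x)" for c using f by (intro polyfun_mult polyfun_const)
  have pr: "polyfun (\<lambda>x. c * f (dunkl_refl \<alpha> x))" for c \<alpha>
    using f by (intro polyfun_mult polyfun_const polyfun_refl)
  have ps: "polyfun (\<lambda>x. \<Sum>\<alpha>\<in>R. k \<alpha> * (\<alpha> \<bullet> \<eta>) * (\<alpha> \<bullet> \<zeta>) * f (dunkl_refl \<alpha> x))"
    by (intro real_polynomial_function_sum finite_R pr)
  have "dunklT \<eta> (\<lambda>x. (x \<bullet> \<zeta>) * f x) = (\<lambda>x. ((x \<bullet> \<zeta>) * dunklT \<eta> f x + (\<eta> \<bullet> \<zeta>) * f x)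
    + (\<Sum>\<alpha>\<in>R. k \<alpha> * (\<alpha> \<bullet> \<eta>) * (\<alpha> \<bullet> \<zeta>) * f (dunkl_refl \<alpha> x)))"
    using dunklT_coord[OF f] by auto
  then have "dunklT \<xi> (dunklT \<eta> (\<lambda>x. (x \<bullet> \<zeta>) * f x)) x =
     dunklT \<xi> (\<lambda>x. (x \<bullet> \<zeta>) * dunklT \<eta> f x) x + (\<eta> \<bullet> \<zeta>) * dunklT \<xi> f x
     + (\<Sum>\<alpha>\<in>R. k \<alpha> * (\<alpha> \<bullet> \<eta>) * (\<alpha> \<bullet> \<zeta>) * dunklT \<xi> (\<lambda>x. f (dunkl_refl \<alpha> x)) x)"
    using ps pt pc f
    by (simp add: dunklT_add polyfun_add dunklT_sum finite_R pr dunklT_cmult polyfun_refl)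
  then show ?thesis
    using f by (simp add: dunklT_coord polyfun_dunklT dunklT_refl_expand sum.distrib algebra_simps sum_subtractf)
qed

text \<open>Commuting with all coordinate multiplications forces the commutator to vanish, since it
  kills constants; no case analysis over rank-two subsystems is needed.\<close>

lemma dunklT_bracket_coord:
  assumes f: "polyfun f"
  shows "dunklT_bracket \<xi> \<eta> (\<lambda>x. (x \<bullet> \<zeta>) * f x) x = (x \<bullet> \<zeta>) * dunklT_bracket \<xi> \<eta> f x"
  unfolding dunklT_bracket_def dunklT_dunklT_coord[OF f]
  by (simp add: algebra_simps sum.distrib sum_subtractf)

lemma dunklT_bracket_add:
  assumes "polyfun f" "polyfun g"
  shows "dunklT_bracket \<xi> \<eta> (\<lambda>x. f x + g x) x = dunklT_bracket \<xi> \<eta> f x + dunklT_bracket \<xi> \<eta> g x"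
  using assms by (simp add: dunklT_bracket_def dunklT_add polyfun_dunklT)

lemma dunklT_bracket_cmult:
  assumes "polyfun f"
  shows "dunklT_bracket \<xi> \<eta> (\<lambda>x. c * f x) x = c * dunklT_bracket \<xi> \<eta> f x"
  using assms by (simp add: dunklT_bracket_def dunklT_cmult polyfun_dunklT algebra_simps)

text \<open>\<open>f\<close> stays arbitrary in the induction on \<open>p\<close>, because for a
  product one factor is absorbed into \<open>f\<close>.\<close>

lemma dunklT_bracket_mult:
  fixes p :: "'a \<Rightarrow> real"
  shows "polyfun p \<Longrightarrow> polyfun f \<Longrightarrow> dunklT_bracket \<xi> \<eta> (\<lambda>x. p x * f x) x = p x * dunklT_bracket \<xi> \<eta> f x"
proof (induction arbitrary: f rule: real_polynomial_function.induct)
  case (linear p)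
  \<comment> \<open>\<open>adjoint p 1\<close> is the Riesz vector of the linear functional
    \<open>p\<close>.\<close>
  have "p = (\<lambda>x. x \<bullet> adjoint p 1)"
    using adjoint_works[OF bounded_linear.linear[OF linear(1)], of _ 1] by (simp add: fun_eq_iff)
  then obtain \<zeta> where "p = (\<lambda>x. x \<bullet> \<zeta>)" ..
  then show ?case using dunklT_bracket_coord[OF linear.prems] by simp
next
  case (const c)
  then show ?case by (simp add: dunklT_bracket_cmult)
next
  case (add p q)
  have "polyfun (\<lambda>x. p x * f x)" "polyfun (\<lambda>x. q x * f x)"
    using add by (auto intro: polyfun_mult)
  then show ?case using add by (simp add: distrib_right dunklT_bracket_add)
next
  case (mult p q)
  then show ?case using polyfun_mult[OF mult.hyps(2) mult.prems]
    by (simp add: mult.assoc)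
qed

lemma dunklT_commute:
  assumes "polyfun f"
  shows "dunklT \<xi> (dunklT \<eta> f) x = dunklT \<eta> (dunklT \<xi> f) x"
proof -
  have "dunklT_bracket \<xi> \<eta> (\<lambda>x. f x * 1) x = f x * dunklT_bracket \<xi> \<eta> (\<lambda>x. 1) x"
    by (rule dunklT_bracket_mult[OF assms polyfun_const])
  then show ?thesis by (simp add: dunklT_bracket_def dunklT_const)
qed

subsection \<open>The Dunkl kernel as a power series\<close>

definition total_mult :: real where "total_mult = (\<Sum>\<alpha>\<in>R. k \<alpha>)"

lemma total_mult_nonneg: "0 \<le> total_mult"
  unfolding total_mult_def by (intro sum_nonneg k_nonneg)

text \<open>\<open>resolvent n\<close> is the resolvent \<open>1 / (n + total_mult - S)\<close> of \<open>S = (\<Sum>\<alpha>\<in>R. k \<alpha> * r\<^sub>\<alpha>)\<close> in the group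
  algebra, expanded as a Neumann series.\<close>

primrec walk :: "nat \<Rightarrow> ('a \<Rightarrow> 'a) \<Rightarrow> real" where
  "walk 0 g = (if g = id then 1 else 0)"
| "walk (Suc j) g = (\<Sum>\<alpha>\<in>R. k \<alpha> * walk j (g \<circ> dunkl_refl \<alpha>))"

definition resolvent :: "nat \<Rightarrow> ('a \<Rightarrow> 'a) \<Rightarrow> real" where
  "resolvent n g = (\<Sum>j. walk j g / (real n + total_mult) ^ Suc j)"

lemma walk_nonneg: "0 \<le> walk j g"
  by (induction j arbitrary: g) (auto intro!: sum_nonneg k_nonneg mult_nonneg_nonneg)

lemma walk_le: "walk j g \<le> total_mult ^ j"
proof (induction j arbitrary: g)
  case (Suc j)
  have "walk (Suc j) g \<le> (\<Sum>\<alpha>\<in>R. k \<alpha> * total_mult ^ j)"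
    using Suc by (auto intro!: sum_mono mult_left_mono k_nonneg)
  then show ?case by (simp add: total_mult_def sum_distrib_right)
qed simp

lemma summable_walk:
  assumes "n > 0"
  shows "summable (\<lambda>j. walk j g / (real n + total_mult) ^ Suc j)"
proof (rule summable_comparison_test')
  show "summable (\<lambda>j. (1 / (real n + total_mult)) * (total_mult / (real n + total_mult)) ^ j)"
    using assms total_mult_nonneg by (intro summable_mult summable_geometric) (auto simp: field_simps)
  fix j
  show "norm (walk j g / (real n + total_mult) ^ Suc j) \<le> (1 / (real n + total_mult)) * (total_mult / (real n + total_mult)) ^ j"
    using walk_nonneg[of j g] walk_le[of j g] total_mult_nonneg assms
    by (simp add: power_divide divide_right_mono)
qed

lemma resolvent_nonneg: "n > 0 \<Longrightarrow> 0 \<le> resolvent n g"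
  unfolding resolvent_def using walk_nonneg total_mult_nonneg
  by (intro suminf_nonneg summable_walk) (auto intro!: divide_nonneg_nonneg)

text \<open>Shifting the Neumann series by one index trades a factor n + \<open>total_mult\<close>
  for one application of S; the leftover term j = 0 is the indicator of \<open>id\<close>.\<close>

lemma resolvent_eq:
  assumes "n > 0"
  shows "(real n + total_mult) * resolvent n g = (if g = id then 1 else 0) + (\<Sum>\<alpha>\<in>R. k \<alpha> * resolvent n (g \<circ> dunkl_refl \<alpha>))"
proof -
  let ?c = "real n + total_mult"
  have c: "?c > 0" using assms total_mult_nonneg by simp
  let ?f = "\<lambda>j. walk j g / ?c ^ Suc j"
  have S: "summable ?f" by (rule summable_walk[OF assms])
  have "(\<lambda>j. \<Sum>\<alpha>\<in>R. k \<alpha> * (walk j (g \<circ> dunkl_refl \<alpha>) / ?c ^ Suc j))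
      sums (\<Sum>\<alpha>\<in>R. k \<alpha> * resolvent n (g \<circ> dunkl_refl \<alpha>))"
    unfolding resolvent_def by (intro sums_sum sums_mult summable_sums summable_walk assms)
  moreover have "(\<Sum>\<alpha>\<in>R. k \<alpha> * (walk j (g \<circ> dunkl_refl \<alpha>) / ?c ^ Suc j)) = ?c * ?f (Suc j)" for j
    using c by (simp add: sum_divide_distrib sum_distrib_left)
  ultimately have "(\<lambda>j. ?c * ?f (Suc j)) sums (\<Sum>\<alpha>\<in>R. k \<alpha> * resolvent n (g \<circ> dunkl_refl \<alpha>))" by simp
  moreover have "(\<lambda>j. ?c * ?f (Suc j)) sums (?c * (suminf ?f - ?f 0))"
  proof (rule sums_mult)
    show "(\<lambda>j. ?f (Suc j)) sums (suminf ?f - ?f 0)"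
      using S by (subst sums_Suc_iff) (simp add: summable_sums)
  qed
  ultimately have "?c * (suminf ?f - ?f 0) = (\<Sum>\<alpha>\<in>R. k \<alpha> * resolvent n (g \<circ> dunkl_refl \<alpha>))"
    by (rule sums_unique2[symmetric])
  then show ?thesis
    using c by (simp add: resolvent_def right_diff_distrib split: if_splits)
qed

text \<open>Summing coefficients is a character of the group algebra that sends S to
  \<open>total_mult\<close>, hence the resolvent to 1 / n. Together with
  \<open>resolvent_nonneg\<close> this makes n * \<open>resolvent n\<close> a probability on the
  group.\<close>

lemma sum_resolvent:
  assumes "n > 0"
  shows "(\<Sum>g\<in>refl_group R. resolvent n g) = 1 / real n"
proof -
  let ?X = "\<Sum>g\<in>refl_group R. resolvent n g"
  have "(real n + total_mult) * ?X
    = (\<Sum>g\<in>refl_group R. (if g = id then 1 else 0) + (\<Sum>\<alpha>\<in>R. k \<alpha> * resolvent n (g \<circ> dunkl_refl \<alpha>)))"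
    by (simp add: sum_distrib_left resolvent_eq assms)
  also have "\<dots> = 1 + (\<Sum>g\<in>refl_group R. \<Sum>\<alpha>\<in>R. k \<alpha> * resolvent n (g \<circ> dunkl_refl \<alpha>))"
    by (simp add: sum.distrib finite_refl_group refl_group.id_in)
  also have "(\<Sum>g\<in>refl_group R. \<Sum>\<alpha>\<in>R. k \<alpha> * resolvent n (g \<circ> dunkl_refl \<alpha>)) = (\<Sum>\<alpha>\<in>R. k \<alpha> * ?X)"
    by (subst sum.swap) (simp add: sum_distrib_left[symmetric] sum_refl_group_comp)
  also have "\<dots> = total_mult * ?X" by (simp add: total_mult_def sum_distrib_right)
  finally show ?thesis using assms by (simp add: field_simps)
qed

text \<open>With the resolvent written out, homogeneity, continuity and size of the terms are plain
  inductions. The operator form of the recursion is recovered in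
  \<open>kernel_term_eq\<close>.\<close>

primrec kernel_term :: "'a \<Rightarrow> nat \<Rightarrow> 'a \<Rightarrow> real" where
  "kernel_term y 0 x = 1"
| "kernel_term y (Suc n) x = (\<Sum>g\<in>refl_group R. resolvent (Suc n) g * ((g x \<bullet> y) * kernel_term y n (g x)))"

lemma polyfun_group_comp: "polyfun f \<Longrightarrow> g \<in> refl_group R \<Longrightarrow> polyfun (\<lambda>x. f (g x))" for f :: "'a \<Rightarrow> real"
  using polyfun_linear_comp refl_group_linear by (auto simp: linear_conv_bounded_linear)

lemma polyfun_kernel_term: "polyfun (kernel_term y n)"
proof (induction n)
  case 0
  have "kernel_term y 0 = (\<lambda>x. 1)" by auto
  then show ?case by (simp add: polyfun_const)
next
  case (Suc n)
  have "polyfun (\<lambda>x. resolvent (Suc n) g * ((g x \<bullet> y) * kernel_term y n (g x)))" if "g \<in> refl_group R" for g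
    by (rule polyfun_mult[OF polyfun_const polyfun_group_comp[OF polyfun_mult[OF polyfun_inner[of y] Suc] that]])
  then have "polyfun (\<lambda>x. \<Sum>g\<in>refl_group R. resolvent (Suc n) g * ((g x \<bullet> y) * kernel_term y n (g x)))"
    by (intro real_polynomial_function_sum finite_refl_group)
  then show ?case by (metis (no_types, lifting) kernel_term.simps(2) ext)
qed

lemma kernel_term_homog: "kernel_term y n (c *\<^sub>R x) = c ^ n * kernel_term y n x"
proof (induction n arbitrary: x)
  case (Suc n)
  show ?case
    by (auto simp: Suc linear_scale[OF refl_group_linear] sum_distrib_left mult_ac intro!: sum.cong)
qed simp

text \<open>\<open>resolvent_eq\<close> transported to functions: the composition with r_\<alpha> in
  the coefficient moves to the argument x by reindexing the group.\<close>

lemma kernel_term_eq: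
  "(real (Suc n) + total_mult) * kernel_term y (Suc n) x
     = (x \<bullet> y) * kernel_term y n x + (\<Sum>\<alpha>\<in>R. k \<alpha> * kernel_term y (Suc n) (dunkl_refl \<alpha> x))"
proof -
  define u where "u = (\<lambda>x. (x \<bullet> y) * kernel_term y n x)"
  have E: "kernel_term y (Suc n) z = (\<Sum>g\<in>refl_group R. resolvent (Suc n) g * u (g z))" for z
    by (simp add: u_def)
  have "(real (Suc n) + total_mult) * kernel_term y (Suc n) x
    = (\<Sum>g\<in>refl_group R. ((real (Suc n) + total_mult) * resolvent (Suc n) g) * u (g x))"
    unfolding E by (simp only: sum_distrib_left mult.assoc)
  also have "\<dots> = (\<Sum>g\<in>refl_group R. (if g = id then u x else 0)
      + (\<Sum>\<alpha>\<in>R. k \<alpha> * (resolvent (Suc n) (g \<circ> dunkl_refl \<alpha>) * u (g x))))"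
    by (intro sum.cong refl, subst resolvent_eq)
       (auto simp: distrib_right distrib_left sum_distrib_right sum_distrib_left mult_ac)
  also have "\<dots> = u x + (\<Sum>\<alpha>\<in>R. k \<alpha> * (\<Sum>g\<in>refl_group R. resolvent (Suc n) (g \<circ> dunkl_refl \<alpha>) * u (g x)))"
    by (simp add: sum.distrib finite_refl_group refl_group.id_in sum_distrib_left)
       (rule sum.swap)
  also have "(\<Sum>\<alpha>\<in>R. k \<alpha> * (\<Sum>g\<in>refl_group R. resolvent (Suc n) (g \<circ> dunkl_refl \<alpha>) * u (g x)))
     = (\<Sum>\<alpha>\<in>R. k \<alpha> * kernel_term y (Suc n) (dunkl_refl \<alpha> x))"
  proof (intro sum.cong refl arg_cong2[where f="(*)"])
    fix \<alpha> assume "\<alpha> \<in> R"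
    from sum_refl_group_comp[OF this, where F="\<lambda>g. resolvent (Suc n) g * u (g (dunkl_refl \<alpha> x))"]
    show "(\<Sum>g\<in>refl_group R. resolvent (Suc n) (g \<circ> dunkl_refl \<alpha>) * u (g x)) = kernel_term y (Suc n) (dunkl_refl \<alpha> x)"
      unfolding E by simp
  qed
  finally show ?thesis by (simp only: u_def)
qed

text \<open>The group acts by isometries, so each step costs one factor
  \<open>norm x * norm y\<close> by Cauchy-Schwarz and gains 1 / (n + 1) from
  \<open>sum_resolvent\<close>; these gains build up the factorial.\<close>

lemma kernel_term_bound: "\<bar>kernel_term y n x\<bar> \<le> (norm x * norm y) ^ n / fact n"
proof (induction n arbitrary: x)
  case (Suc n)
  let ?q = "norm x * norm y"
  have "\<bar>kernel_term y (Suc n) x\<bar> \<le> (\<Sum>g\<in>refl_group R. resolvent (Suc n) g * (?q * (?q ^ n / fact n)))"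
    unfolding kernel_term.simps
  proof (rule order_trans[OF sum_abs], rule sum_mono)
    fix g assume g: "g \<in> refl_group R"
    have "\<bar>g x \<bullet> y\<bar> * \<bar>kernel_term y n (g x)\<bar> \<le> ?q * (?q ^ n / fact n)"
      using Suc[of "g x"] Cauchy_Schwarz_ineq2[of "g x" y] refl_group_norm[OF g, of x]
      by (intro mult_mono) auto
    then have "resolvent (Suc n) g * \<bar>(g x \<bullet> y) * kernel_term y n (g x)\<bar> \<le> resolvent (Suc n) g * (?q * (?q ^ n / fact n))"
      unfolding abs_mult by (intro mult_left_mono resolvent_nonneg) auto
    then show "\<bar>resolvent (Suc n) g * ((g x \<bullet> y) * kernel_term y n (g x))\<bar> \<le> resolvent (Suc n) g * (?q * (?q ^ n / fact n))"
      by (simp add: abs_mult resolvent_nonneg)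
  qed
  also have "\<dots> = ?q ^ Suc n / fact (Suc n)"
    by (simp add: sum_distrib_right[symmetric] sum_divide_distrib[symmetric] sum_resolvent)
  finally show ?case .
qed simp

section \<open>The terms satisfy the eigenfunction equations\<close>

text \<open>In the radial direction the factor \<alpha> \<bullet> x cancels the denominator of the
  divided difference.\<close>

lemma dunklT_euler:
  assumes "polyfun f" "\<And>c x. c > 0 \<Longrightarrow> f (c *\<^sub>R x) = c ^ n * f x"
  shows "dunklT x f x = real n * f x + (\<Sum>\<alpha>\<in>R. k \<alpha> * (f x - f (dunkl_refl \<alpha> x)))"
proof -
  have "frechet_derivative f (at x) x = real n * f x"
    using assms by (intro frechet_derivative_homogeneous polyfun_differentiable)
  then show ?thesis
    by (simp add: dunklT_def divdiff_eq mult.assoc)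
qed

lemma dunklT_homog:
  assumes f: "polyfun f" and h: "\<And>c x. c > 0 \<Longrightarrow> f (c *\<^sub>R x) = c ^ Suc n * f x" and c: "c > 0"
  shows "dunklT \<xi> f (c *\<^sub>R x) = c ^ n * dunklT \<xi> f x"
proof -
  have fd: "frechet_derivative f (at (c *\<^sub>R x)) \<xi> = c ^ n * frechet_derivative f (at x) \<xi>" for \<xi>
  proof -
    have "c * frechet_derivative f (at (c *\<^sub>R x)) \<xi> = frechet_derivative (\<lambda>x. f (c *\<^sub>R x)) (at x) \<xi>"
      using frechet_derivative_chain_linear[OF polyfun_differentiable[OF f] bounded_linear_scaleR_right, of c x \<xi>]
        linear_scale[OF linear_frechet_derivative[OF polyfun_differentiable[OF f]]] by simp
    also have "\<dots> = c ^ Suc n * frechet_derivative f (at x) \<xi>"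
      using frechet_derivative_mult[OF _ polyfun_differentiable[OF f, of x], of "\<lambda>x. c ^ Suc n" \<xi>] c by (simp add: h)
    finally show ?thesis using c by simp
  qed
  have "divdiff \<alpha> f (c *\<^sub>R x) = c ^ n * divdiff \<alpha> f x" for \<alpha>
  proof (cases "\<alpha> \<bullet> x = 0")
    case True
    then show ?thesis by (simp add: divdiff_def fd)
  next
    case False
    then show ?thesis using c
      by (simp add: divdiff_def h linear_scale[OF linear_dunkl_refl] field_simps)
  qed
  then show ?thesis by (simp add: dunklT_def fd algebra_simps sum_distrib_left)
qed

lemma dunklT_basis:
  assumes "polyfun f"
  shows "(\<Sum>b\<in>Basis. (\<xi> \<bullet> b) * dunklT b f x) = dunklT \<xi> f x"
proof -
  have "dunklT \<xi> f x = dunklT (\<Sum>b\<in>Basis. (\<xi> \<bullet> b) *\<^sub>R b) f x"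
    by (simp add: euclidean_representation)
  also have "\<dots> = (\<Sum>b\<in>Basis. (\<xi> \<bullet> b) * dunklT b f x)"
    by (simp add: linear_sum[OF linear_dunklT[OF assms]] linear_scale[OF linear_dunklT[OF assms]])
  finally show ?thesis ..
qed

text \<open>On the left the inner direction varies with the point, and the last two terms come from
  differentiating it. This is where commutativity of the Dunkl operators enters the construction of
  the kernel.\<close>

lemma dunklT_radial:
  assumes f: "polyfun f"
  shows "dunklT \<xi> (\<lambda>x. dunklT x f x) x
    = dunklT x (dunklT \<xi> f) x + dunklT \<xi> f x + (\<Sum>\<alpha>\<in>R. k \<alpha> * (\<alpha> \<bullet> \<xi>) * dunklT \<alpha> f (dunkl_refl \<alpha> x))"
proof -
  have "(\<lambda>x. dunklT x f x) = (\<lambda>x. \<Sum>b\<in>Basis. (x \<bullet> b) * dunklT b f x)"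
    using dunklT_basis[OF f] by simp
  then have "dunklT \<xi> (\<lambda>x. dunklT x f x) x = (\<Sum>b\<in>Basis. dunklT \<xi> (\<lambda>x. (x \<bullet> b) * dunklT b f x) x)"
    using f by (simp add: dunklT_sum polyfun_mult polyfun_inner polyfun_dunklT)
  also have "\<dots> = (\<Sum>b\<in>Basis. (x \<bullet> b) * dunklT b (dunklT \<xi> f) x + (\<xi> \<bullet> b) * dunklT b f x
    + (\<Sum>\<alpha>\<in>R. k \<alpha> * (\<alpha> \<bullet> \<xi>) * (\<alpha> \<bullet> b) * dunklT b f (dunkl_refl \<alpha> x)))"
    using f by (simp add: dunklT_coord polyfun_dunklT dunklT_commute[of f \<xi>])
  also have "\<dots> = dunklT x (dunklT \<xi> f) x + dunklT \<xi> f x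
    + (\<Sum>b\<in>Basis. \<Sum>\<alpha>\<in>R. k \<alpha> * (\<alpha> \<bullet> \<xi>) * (\<alpha> \<bullet> b) * dunklT b f (dunkl_refl \<alpha> x))"
    using f by (simp add: sum.distrib dunklT_basis polyfun_dunklT)
  also have "(\<Sum>b\<in>Basis. \<Sum>\<alpha>\<in>R. k \<alpha> * (\<alpha> \<bullet> \<xi>) * (\<alpha> \<bullet> b) * dunklT b f (dunkl_refl \<alpha> x))
    = (\<Sum>\<alpha>\<in>R. k \<alpha> * (\<alpha> \<bullet> \<xi>) * dunklT \<alpha> f (dunkl_refl \<alpha> x))"
    by (subst sum.swap) (simp add: mult.assoc sum_distrib_left[symmetric] dunklT_basis[OF f])
  finally show ?thesis .
qed

text \<open>Maximum principle on a finite orbit: at a pair (g \<xi>, g x) where |u| is largest, the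
  right side is at most \<open>total_mult\<close> times that maximum, so N > 0 forces the maximum to
  be 0.\<close>

lemma twisted_injective:
  fixes u :: "'a \<Rightarrow> 'a \<Rightarrow> real"
  assumes "N > 0" and u: "\<And>\<xi> x. (N + total_mult) * u \<xi> x = (\<Sum>\<alpha>\<in>R. k \<alpha> * u (dunkl_refl \<alpha> \<xi>) (dunkl_refl \<alpha> x))"
  shows "u \<xi> x = 0"
proof -
  let ?S = "(\<lambda>g. \<bar>u (g \<xi>) (g x)\<bar>) ` refl_group R"
  define M where "M = Max ?S"
  have fin: "finite ?S" using finite_refl_group by simp
  have le: "\<bar>u (g \<xi>) (g x)\<bar> \<le> M" if "g \<in> refl_group R" for g
    unfolding M_def using fin that by (intro Max_ge) auto
  have "?S \<noteq> {}" using refl_group.id_in by blast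
  then have "M \<in> ?S" unfolding M_def using fin by (rule Max_in[rotated])
  then obtain g where g: "g \<in> refl_group R" and M: "M = \<bar>u (g \<xi>) (g x)\<bar>" by auto
  have "(N + total_mult) * M = \<bar>\<Sum>\<alpha>\<in>R. k \<alpha> * u (dunkl_refl \<alpha> (g \<xi>)) (dunkl_refl \<alpha> (g x))\<bar>"
    using u[of "g \<xi>" "g x"] assms(1) total_mult_nonneg unfolding M by (metis abs_mult abs_of_nonneg add_nonneg_nonneg less_imp_le)
  also have "\<dots> \<le> (\<Sum>\<alpha>\<in>R. k \<alpha> * M)"
    using le[OF refl_group.step[OF g]]
    by (intro order_trans[OF sum_abs] sum_mono) (auto simp: abs_mult k_nonneg intro!: mult_left_mono)
  also have "\<dots> = total_mult * M" by (simp add: total_mult_def sum_distrib_right)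
  finally have "N * M \<le> 0" by (simp add: algebra_simps)
  then have "M \<le> 0" using assms(1) by (simp add: mult_le_0_iff)
  moreover have "\<bar>u \<xi> x\<bar> \<le> M" using le[OF refl_group.id_in] by simp
  ultimately show ?thesis by simp
qed

lemma dunklT_radial_kernel_term: "dunklT x (kernel_term y (Suc n)) x = (x \<bullet> y) * kernel_term y n x"
  using dunklT_euler[OF polyfun_kernel_term kernel_term_homog, of x y "Suc n"] kernel_term_eq[of n y x]
  by (simp add: right_diff_distrib sum_subtractf sum_distrib_right[symmetric] total_mult_def[symmetric] algebra_simps
      del: kernel_term.simps)

lemma dunklT_kernel_term_0: "dunklT \<xi> (kernel_term y 0) x = 0"
  using dunklT_const[of \<xi> 1] by (metis (no_types, lifting) kernel_term.simps(1) ext)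

text \<open>Applying T_\<xi> to the radial identity and commuting it inward shows that the defect
  \<open>u\<close> satisfies the equation of \<open>twisted_injective\<close> with N = n + 1. The
  hypothesis is phrased through n = Suc m so that n = 0 is covered by the same statement.\<close>

lemma dunklT_kernel_term_step:
  assumes IH: "\<And>m \<xi> x. n = Suc m \<Longrightarrow> dunklT \<xi> (kernel_term y (Suc m)) x = (\<xi> \<bullet> y) * kernel_term y m x"
  shows "dunklT \<xi> (kernel_term y (Suc n)) x = (\<xi> \<bullet> y) * kernel_term y n x"
proof -
  \<comment> \<open>For n = Suc m the hypothesis is multiplied by x \<bullet> y, and (x \<bullet> y)
    E_m is replaced through the radial identity and Euler's identity. For n = 0 both sides
    vanish.\<close>
  have X: "(x \<bullet> y) * dunklT \<xi> (kernel_term y n) x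
    = (\<xi> \<bullet> y) * (real n * kernel_term y n x + (\<Sum>\<alpha>\<in>R. k \<alpha> * (kernel_term y n x - kernel_term y n (dunkl_refl \<alpha> x))))" for \<xi> x
  proof (cases n)
    case 0
    then show ?thesis by (simp add: dunklT_kernel_term_0 del: kernel_term.simps) (simp)
  next
    case (Suc m)
    then show ?thesis
      using IH[OF Suc] dunklT_radial_kernel_term[of x y m] dunklT_euler[OF polyfun_kernel_term kernel_term_homog, of x y "Suc m"]
      by (simp del: kernel_term.simps)
  qed
  define f where "f = kernel_term y (Suc n)"
  have f: "polyfun f" and hom: "\<And>c x. f (c *\<^sub>R x) = c ^ Suc n * f x"
    unfolding f_def by (rule polyfun_kernel_term, rule kernel_term_homog)
  define u where "u = (\<lambda>\<xi> x. dunklT \<xi> f x - (\<xi> \<bullet> y) * kernel_term y n x)"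
  \<comment> \<open>The terms in direction \<alpha> produced by \<open>dunklT_radial\<close> and
    \<open>dunklT_coord\<close> are exactly what reflecting the direction \<xi> changes in the
    defect.\<close>
  have lin: "u (dunkl_refl \<alpha> \<xi>) z = u \<xi> z - (\<alpha> \<bullet> \<xi>) * u \<alpha> z" if "\<alpha> \<in> R" for \<alpha> \<xi> z
    unfolding u_def using that
    by (simp add: dunkl_refl_root_eq linear_diff[OF linear_dunklT[OF f]] linear_scale[OF linear_dunklT[OF f]]
        inner_diff_left algebra_simps)
  have "u \<xi> x = 0"
  proof (rule twisted_injective[of "real (Suc n)"])
    fix \<xi> x
    have eul: "dunklT x (dunklT \<xi> f) x
      = real n * dunklT \<xi> f x + (\<Sum>\<alpha>\<in>R. k \<alpha> * (dunklT \<xi> f x - dunklT \<xi> f (dunkl_refl \<alpha> x)))"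
      by (rule dunklT_euler[OF polyfun_dunklT[OF f] dunklT_homog[OF f hom]])
    have "dunklT \<xi> (\<lambda>x. dunklT x f x) x = dunklT \<xi> (\<lambda>x. (x \<bullet> y) * kernel_term y n x) x"
      unfolding f_def dunklT_radial_kernel_term ..
    then have "real n * dunklT \<xi> f x + (\<Sum>\<alpha>\<in>R. k \<alpha> * (dunklT \<xi> f x - dunklT \<xi> f (dunkl_refl \<alpha> x)))
        + dunklT \<xi> f x + (\<Sum>\<alpha>\<in>R. k \<alpha> * (\<alpha> \<bullet> \<xi>) * dunklT \<alpha> f (dunkl_refl \<alpha> x))
      = (x \<bullet> y) * dunklT \<xi> (kernel_term y n) x + (\<xi> \<bullet> y) * kernel_term y n x
        + (\<Sum>\<alpha>\<in>R. k \<alpha> * (\<alpha> \<bullet> \<xi>) * (\<alpha> \<bullet> y) * kernel_term y n (dunkl_refl \<alpha> x))"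
      using dunklT_radial[OF f] dunklT_coord[OF polyfun_kernel_term] eul by simp
    then have "real n * dunklT \<xi> f x + (total_mult * dunklT \<xi> f x - (\<Sum>\<alpha>\<in>R. k \<alpha> * dunklT \<xi> f (dunkl_refl \<alpha> x)))
        + dunklT \<xi> f x + (\<Sum>\<alpha>\<in>R. k \<alpha> * (\<alpha> \<bullet> \<xi>) * dunklT \<alpha> f (dunkl_refl \<alpha> x))
      = (\<xi> \<bullet> y) * (real n * kernel_term y n x + (total_mult * kernel_term y n x - (\<Sum>\<alpha>\<in>R. k \<alpha> * kernel_term y n (dunkl_refl \<alpha> x))))
        + (\<xi> \<bullet> y) * kernel_term y n x + (\<Sum>\<alpha>\<in>R. k \<alpha> * (\<alpha> \<bullet> \<xi>) * (\<alpha> \<bullet> y) * kernel_term y n (dunkl_refl \<alpha> x))"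
      unfolding X total_mult_def by (simp add: right_diff_distrib sum_subtractf sum_distrib_right)
    moreover have "(\<Sum>\<alpha>\<in>R. k \<alpha> * u (dunkl_refl \<alpha> \<xi>) (dunkl_refl \<alpha> x))
      = (\<Sum>\<alpha>\<in>R. k \<alpha> * dunklT \<xi> f (dunkl_refl \<alpha> x)) - (\<xi> \<bullet> y) * (\<Sum>\<alpha>\<in>R. k \<alpha> * kernel_term y n (dunkl_refl \<alpha> x))
        - (\<Sum>\<alpha>\<in>R. k \<alpha> * (\<alpha> \<bullet> \<xi>) * dunklT \<alpha> f (dunkl_refl \<alpha> x))
        + (\<Sum>\<alpha>\<in>R. k \<alpha> * (\<alpha> \<bullet> \<xi>) * (\<alpha> \<bullet> y) * kernel_term y n (dunkl_refl \<alpha> x))"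
      by (simp add: lin) (simp add: u_def algebra_simps sum.distrib sum_subtractf sum_distrib_left)
    ultimately show "(real (Suc n) + total_mult) * u \<xi> x = (\<Sum>\<alpha>\<in>R. k \<alpha> * u (dunkl_refl \<alpha> \<xi>) (dunkl_refl \<alpha> x))"
      by (simp add: u_def algebra_simps)
  qed simp
  then show ?thesis
    by (simp add: u_def f_def)
qed

lemma dunklT_kernel_term: "dunklT \<xi> (kernel_term y (Suc n)) x = (\<xi> \<bullet> y) * kernel_term y n x"
proof (induction n arbitrary: \<xi> x)
  case 0
  show ?case by (rule dunklT_kernel_term_step) simp
next
  case (Suc n)
  show ?case by (rule dunklT_kernel_term_step) (metis Suc.IH nat.inject)
qed

section \<open>Summation and termwise differentiation of the kernel series\<close>

definition kernel_series :: "'a \<Rightarrow> 'a \<Rightarrow> real" where "kernel_series x y = (\<Sum>n. kernel_term y n x)"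

lemma summable_kernel_term: "summable (\<lambda>n. kernel_term y n x)"
  by (rule summable_comparison_test'[OF sums_summable[OF exp_sums[of "norm x * norm y"]]])
     (simp add: kernel_term_bound)

lemma kernel_series_sums: "(\<lambda>n. kernel_term y n x) sums kernel_series x y"
  unfolding kernel_series_def by (rule summable_sums[OF summable_kernel_term])

lemma kernel_series_bound: "\<bar>kernel_series x y - 1\<bar> \<le> exp (norm x * norm y) - 1"
proof -
  let ?q = "norm x * norm y"
  have 1: "(\<lambda>n. kernel_term y (Suc n) x) sums (kernel_series x y - 1)"
    using kernel_series_sums[of y x] sums_Suc_iff[of "\<lambda>n. kernel_term y n x" "kernel_series x y - 1"] by simp
  have 2: "(\<lambda>n. ?q ^ Suc n / fact (Suc n)) sums (exp ?q - 1)"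
    using exp_sums[of ?q] sums_Suc_iff[of "\<lambda>n. ?q ^ n / fact n" "exp ?q - 1"] by simp
  have "norm (\<Sum>n. kernel_term y (Suc n) x) \<le> (\<Sum>n. ?q ^ Suc n / fact (Suc n))"
    by (rule norm_suminf_le[OF _ sums_summable[OF 2]])
       (simp only: real_norm_def kernel_term_bound)
  then show ?thesis using sums_unique[OF 1] sums_unique[OF 2] by simp
qed

lemma kernel_series_zero: "kernel_series 0 y = 1"
  using kernel_series_bound[of 0 y] by simp

lemma continuous_on_kernel_term: "continuous_on UNIV (\<lambda>p. kernel_term (snd p) n (fst p))"
proof (induction n)
  case (Suc n)
  have "continuous_on UNIV (\<lambda>p. resolvent (Suc n) g * ((g (fst p) \<bullet> snd p) * kernel_term (snd p) n (g (fst p))))"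
    if g: "g \<in> refl_group R" for g
  proof -
    have "bounded_linear g"
      using refl_group_linear[OF g] by (simp add: linear_conv_bounded_linear)
    note c = bounded_linear.continuous_on[OF this continuous_on_fst[OF continuous_on_id]]
    have "continuous_on UNIV (\<lambda>p::'a \<times> 'a. (g (fst p), snd p))"
      by (intro continuous_intros c)
    from continuous_on_compose2[OF Suc this]
    have "continuous_on UNIV (\<lambda>p. kernel_term (snd p) n (g (fst p)))" by simp
    then show ?thesis by (intro continuous_intros c)
  qed
  then have "continuous_on UNIV
     (\<lambda>p. \<Sum>g\<in>refl_group R. resolvent (Suc n) g * ((g (fst p) \<bullet> snd p) * kernel_term (snd p) n (g (fst p))))"
    by (intro continuous_on_sum)
  then show ?case by simp
qed simp

lemma kernel_series_measurable [measurable]: "(\<lambda>p. kernel_series (fst p) (snd p)) \<in> borel_measurable borel"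
  unfolding kernel_series_def
  by (intro borel_measurable_suminf borel_measurable_continuous_onI continuous_on_kernel_term)

text \<open>An explicit recursion for the derivative, so that it can be bounded by an induction
  parallel to that of \<open>kernel_term_bound\<close>.\<close>

primrec kernel_term_deriv :: "'a \<Rightarrow> nat \<Rightarrow> 'a \<Rightarrow> 'a \<Rightarrow> real" where
  "kernel_term_deriv y 0 x h = 0"
| "kernel_term_deriv y (Suc n) x h = (\<Sum>g\<in>refl_group R. resolvent (Suc n) g *
     ((g x \<bullet> y) * kernel_term_deriv y n (g x) (g h) + (g h \<bullet> y) * kernel_term y n (g x)))"

lemma kernel_term_has_derivative: "(kernel_term y n has_derivative kernel_term_deriv y n x) (at x)"
proof (induction n arbitrary: x)
  case 0
  have "kernel_term y 0 = (\<lambda>x. 1)" "kernel_term_deriv y 0 x = (\<lambda>h. 0)" by auto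
  then show ?case by simp
next
  case (Suc n)
  have "((\<lambda>x. resolvent (Suc n) g * ((g x \<bullet> y) * kernel_term y n (g x))) has_derivative
      (\<lambda>h. resolvent (Suc n) g * ((g x \<bullet> y) * kernel_term_deriv y n (g x) (g h) + (g h \<bullet> y) * kernel_term y n (g x)))) (at x)"
    if g: "g \<in> refl_group R" for g
  proof -
    have bl: "bounded_linear g"
      using refl_group_linear[OF g] by (simp add: linear_conv_bounded_linear)
    have d: "(g has_derivative g) (at x)"
      by (rule bounded_linear_imp_has_derivative[OF bl])
    have 1: "((\<lambda>x. kernel_term y n (g x)) has_derivative (\<lambda>h. kernel_term_deriv y n (g x) (g h))) (at x)"
      by (rule has_derivative_compose[OF d Suc])
    have 2: "((\<lambda>x. g x \<bullet> y) has_derivative (\<lambda>h. g h \<bullet> y)) (at x)"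
      by (rule has_derivative_inner_left[OF d])
    show ?thesis by (intro has_derivative_mult_right has_derivative_mult[OF 2 1])
  qed
  then have "((\<lambda>x. \<Sum>g\<in>refl_group R. resolvent (Suc n) g * ((g x \<bullet> y) * kernel_term y n (g x))) has_derivative
      (\<lambda>h. \<Sum>g\<in>refl_group R. resolvent (Suc n) g *
         ((g x \<bullet> y) * kernel_term_deriv y n (g x) (g h) + (g h \<bullet> y) * kernel_term y n (g x)))) (at x)"
    by (rule has_derivative_sum)
  moreover have "kernel_term y (Suc n) = (\<lambda>x. \<Sum>g\<in>refl_group R. resolvent (Suc n) g * ((g x \<bullet> y) * kernel_term y n (g x)))"
    "kernel_term_deriv y (Suc n) x = (\<lambda>h. \<Sum>g\<in>refl_group R. resolvent (Suc n) g *
         ((g x \<bullet> y) * kernel_term_deriv y n (g x) (g h) + (g h \<bullet> y) * kernel_term y n (g x)))" by auto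
  ultimately show ?case by simp
qed

lemma kernel_term_deriv_bound:
  "\<bar>kernel_term_deriv y (Suc n) x h\<bar> \<le> norm h * (norm y * ((norm x * norm y) ^ n / fact n))"
proof (induction n arbitrary: x h)
  case (0 x h)
  have "\<bar>kernel_term_deriv y (Suc 0) x h\<bar> \<le> (\<Sum>g\<in>refl_group R. resolvent (Suc 0) g * (norm h * norm y))"
    unfolding kernel_term_deriv.simps kernel_term.simps
  proof (rule order_trans[OF sum_abs], rule sum_mono)
    fix g assume g: "g \<in> refl_group R"
    have "\<bar>g h \<bullet> y\<bar> \<le> norm h * norm y"
      using Cauchy_Schwarz_ineq2[of "g h" y] refl_group_norm[OF g, of h] by simp
    then show "\<bar>resolvent (Suc 0) g * ((g x \<bullet> y) * 0 + (g h \<bullet> y) * 1)\<bar> \<le> resolvent (Suc 0) g * (norm h * norm y)"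
      by (simp add: abs_mult resolvent_nonneg mult_left_mono)
  qed
  then show ?case by (simp only: sum_distrib_right[symmetric] sum_resolvent) simp
next
  case (Suc n x h)
  let ?q = "norm x * norm y"
  \<comment> \<open>\<open>B\<close> is the claimed bound times n + 2, the factor that
    \<open>sum_resolvent\<close> divides out. It splits as (n + 1) + 1, one share for each term of
    the product rule.\<close>
  define B where "B = norm h * (norm y * (?q ^ Suc n / fact (Suc n))) * real (Suc (Suc n))"
  have B: "B = ?q * (norm h * (norm y * (?q ^ n / fact n))) + norm h * norm y * (?q ^ Suc n / fact (Suc n))"
  proof -
    have "q ^ Suc n / fact (Suc n) * real (Suc n) = q * (q ^ n / fact n)" for q :: real
      by (simp del: of_nat_Suc)
    then have "norm h * norm y * (?q ^ Suc n / fact (Suc n) * real (Suc n)) = norm h * norm y * (?q * (?q ^ n / fact n))"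
      by presburger
    then show ?thesis unfolding B_def of_nat_Suc[of "Suc n"] by (simp only: algebra_simps)
  qed
  have "\<bar>kernel_term_deriv y (Suc (Suc n)) x h\<bar> \<le> (\<Sum>g\<in>refl_group R. resolvent (Suc (Suc n)) g * B)"
    unfolding kernel_term_deriv.simps(2)[of y "Suc n"]
  proof (rule order_trans[OF sum_abs], rule sum_mono)
    fix g assume g: "g \<in> refl_group R"
    have "\<bar>(g x \<bullet> y) * kernel_term_deriv y (Suc n) (g x) (g h)\<bar> \<le> ?q * (norm h * (norm y * (?q ^ n / fact n)))"
      unfolding abs_mult using Suc[of "g x" "g h"] Cauchy_Schwarz_ineq2[of "g x" y]
        refl_group_norm[OF g, of x] refl_group_norm[OF g, of h]
      by (intro mult_mono) auto
    moreover have "\<bar>(g h \<bullet> y) * kernel_term y (Suc n) (g x)\<bar> \<le> norm h * norm y * (?q ^ Suc n / fact (Suc n))"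
      unfolding abs_mult using kernel_term_bound[of y "Suc n" "g x"] Cauchy_Schwarz_ineq2[of "g h" y]
        refl_group_norm[OF g, of x] refl_group_norm[OF g, of h]
      by (intro mult_mono) auto
    ultimately have "\<bar>(g x \<bullet> y) * kernel_term_deriv y (Suc n) (g x) (g h) + (g h \<bullet> y) * kernel_term y (Suc n) (g x)\<bar> \<le> B"
      unfolding B by linarith
    then have "resolvent (Suc (Suc n)) g * \<bar>(g x \<bullet> y) * kernel_term_deriv y (Suc n) (g x) (g h) + (g h \<bullet> y) * kernel_term y (Suc n) (g x)\<bar>
        \<le> resolvent (Suc (Suc n)) g * B"
      by (intro mult_left_mono resolvent_nonneg) auto
    then show "\<bar>resolvent (Suc (Suc n)) g * ((g x \<bullet> y) * kernel_term_deriv y (Suc n) (g x) (g h) + (g h \<bullet> y) * kernel_term y (Suc n) (g x))\<bar>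
        \<le> resolvent (Suc (Suc n)) g * B"
      by (simp only: abs_mult abs_of_nonneg resolvent_nonneg zero_less_Suc)
  qed
  also have "\<dots> = B / real (Suc (Suc n))"
    by (simp only: sum_distrib_right[symmetric] sum_resolvent zero_less_Suc) simp
  also have "\<dots> = norm h * (norm y * (?q ^ Suc n / fact (Suc n)))"
    by (simp add: B_def)
  finally show ?case .
qed

text \<open>\<open>M\<close> is a Weierstrass majorant for the derivatives, uniform on the ball of
  radius \<open>norm x + 1\<close> about the origin. Its index is shifted because the constant term
  has derivative 0 and the degree n + 1 term is controlled by the n-th exponential
  coefficient.\<close>

lemma kernel_series_has_derivative:
  "((\<lambda>x. kernel_series x y) has_derivative (\<lambda>h. \<Sum>n. kernel_term_deriv y n x h)) (at x)"
  "summable (\<lambda>n. kernel_term_deriv y n x h)"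
proof -
  define r where "r = norm x + 1"
  define M where "M n = (case n of 0 \<Rightarrow> 0 | Suc n \<Rightarrow> norm y * ((r * norm y) ^ n / fact n))" for n
  have M0: "M n \<ge> 0" for n by (auto simp: M_def r_def split: nat.split)
  have "summable (\<lambda>n. norm y * ((r * norm y) ^ n / fact n))"
    by (intro summable_mult sums_summable[OF exp_sums])
  then have "summable (\<lambda>n. M (Suc n))" by (simp add: M_def)
  then have sM: "summable M" by (simp add: summable_Suc_iff)
  have DM: "\<bar>kernel_term_deriv y n z h\<bar> \<le> norm h * M n" if "norm z \<le> r" for n z h
  proof (cases n)
    case (Suc m)
    have "(norm z * norm y) ^ m \<le> (r * norm y) ^ m"
      using that by (intro power_mono mult_right_mono) auto
    then have "norm h * (norm y * ((norm z * norm y) ^ m / fact m)) \<le> norm h * M n"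
      unfolding M_def Suc by (auto intro!: mult_left_mono divide_right_mono)
    then show ?thesis using kernel_term_deriv_bound[of y m z h] unfolding Suc by linarith
  qed (simp add: M_def)
  have sD: "summable (\<lambda>n. kernel_term_deriv y n z h)" if "norm z \<le> r" for z h
    by (rule summable_comparison_test'[OF summable_mult[OF sM, of "norm h"]])
       (simp add: DM that)
  show "summable (\<lambda>n. kernel_term_deriv y n x h)" by (rule sD) (simp add: r_def)
  let ?S = "ball 0 r :: 'a set"
  have "\<exists>g. \<forall>z\<in>?S. (\<lambda>n. kernel_term y n z) sums (g z) \<and>
      (g has_derivative (\<lambda>h. \<Sum>n. kernel_term_deriv y n z h)) (at z within ?S)"
  proof (rule has_derivative_series)
    show "convex ?S" by simp
    show "x \<in> ?S" by (simp add: r_def)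
    show "(\<lambda>n. kernel_term y n x) sums kernel_series x y" by (rule kernel_series_sums)
    show "(kernel_term y n has_derivative kernel_term_deriv y n z) (at z within ?S)" for n z
      using kernel_term_has_derivative has_derivative_at_withinI by blast
    fix e :: real assume "e > 0"
    obtain N where N: "\<And>n. n \<ge> N \<Longrightarrow> norm (\<Sum>i. M (i + n)) < e"
      using suminf_exist_split[OF \<open>e > 0\<close> sM] by blast
    have "norm ((\<Sum>i<n. kernel_term_deriv y i z h) - (\<Sum>i. kernel_term_deriv y i z h)) \<le> e * norm h"
      if "n \<ge> N" "z \<in> ?S" for n z h
    proof -
      have z: "norm z \<le> r" using that by simp
      have "(\<Sum>i<n. kernel_term_deriv y i z h) - (\<Sum>i. kernel_term_deriv y i z h) = - (\<Sum>i. kernel_term_deriv y (i + n) z h)"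
        using suminf_split_initial_segment[OF sD[OF z], of h n] by simp
      then have "norm ((\<Sum>i<n. kernel_term_deriv y i z h) - (\<Sum>i. kernel_term_deriv y i z h)) = norm (\<Sum>i. kernel_term_deriv y (i + n) z h)"
        by simp
      also have "\<dots> \<le> (\<Sum>i. norm h * M (i + n))"
        by (rule norm_suminf_le) (use z DM sM in \<open>auto intro!: summable_mult simp: summable_iff_shift\<close>)
      also have "\<dots> = norm h * (\<Sum>i. M (i + n))"
        using sM by (simp add: suminf_mult summable_iff_shift)
      also have "\<dots> \<le> norm h * e"
        using N[OF that(1)] by (intro mult_left_mono) auto
      finally show ?thesis by (simp add: mult.commute)
    qed
    then show "\<forall>\<^sub>F n in sequentially. \<forall>z\<in>?S. \<forall>h. norm ((\<Sum>i<n. kernel_term_deriv y i z h) - (\<Sum>i. kernel_term_deriv y i z h)) \<le> e * norm h"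
      unfolding eventually_sequentially by blast
  qed
  then obtain g where g: "\<And>z. z \<in> ?S \<Longrightarrow> (\<lambda>n. kernel_term y n z) sums (g z)"
      "\<And>z. z \<in> ?S \<Longrightarrow> (g has_derivative (\<lambda>h. \<Sum>n. kernel_term_deriv y n z h)) (at z within ?S)" by blast
  have eq: "g z = kernel_series z y" if "z \<in> ?S" for z
    using sums_unique2[OF g(1)[OF that] kernel_series_sums] .
  have x: "x \<in> ?S" by (simp add: r_def)
  have "(g has_derivative (\<lambda>h. \<Sum>n. kernel_term_deriv y n x h)) (at x)"
    using g(2)[OF x] at_within_open[OF x] by simp
  then show "((\<lambda>x. kernel_series x y) has_derivative (\<lambda>h. \<Sum>n. kernel_term_deriv y n x h)) (at x)"
    by (rule has_derivative_transform_within_open[OF _ open_ball x]) (simp add: eq)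
qed

lemma kernel_series_differentiable: "(\<lambda>x. kernel_series x y) differentiable at x"
  using kernel_series_has_derivative(1) differentiableI by blast

text \<open>At regular points the divided differences are plain quotients, so the operator passes
  through the sum. These are the points at which the definition of the kernel demands the
  equation.\<close>

lemma dunklT_kernel_series:
  assumes reg: "\<forall>\<alpha>\<in>R. \<alpha> \<bullet> x \<noteq> 0"
  shows "dunklT \<xi> (\<lambda>x. kernel_series x y) x = (\<xi> \<bullet> y) * kernel_series x y"
proof -
  have "(\<lambda>n. kernel_term_deriv y n x \<xi> + (\<Sum>\<alpha>\<in>R. k \<alpha> * (\<alpha> \<bullet> \<xi>) * ((kernel_term y n x - kernel_term y n (dunkl_refl \<alpha> x)) / (\<alpha> \<bullet> x))))
    sums ((\<Sum>n. kernel_term_deriv y n x \<xi>) + (\<Sum>\<alpha>\<in>R. k \<alpha> * (\<alpha> \<bullet> \<xi>) * ((kernel_series x y - kernel_series (dunkl_refl \<alpha> x) y) / (\<alpha> \<bullet> x))))"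
    by (intro sums_add sums_sum sums_mult sums_divide sums_diff kernel_series_sums summable_sums kernel_series_has_derivative(2))
  moreover have "(\<Sum>n. kernel_term_deriv y n x \<xi>) = frechet_derivative (\<lambda>x. kernel_series x y) (at x) \<xi>"
    using frechet_derivative_at[OF kernel_series_has_derivative(1)[of y x]] by metis
  moreover have "kernel_term_deriv y n x \<xi> = frechet_derivative (kernel_term y n) (at x) \<xi>" for n
    using frechet_derivative_at[OF kernel_term_has_derivative[of y n x]] by metis
  ultimately have "(\<lambda>n. dunklT \<xi> (kernel_term y n) x) sums dunklT \<xi> (\<lambda>x. kernel_series x y) x"
    using reg by (simp add: dunklT_def divdiff_def)
  \<comment> \<open>T_\<xi> kills the degree 0 term. The series started at degree 1 is then
    <\<xi>,y> times the unshifted kernel series.\<close>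
  then have "(\<lambda>n. dunklT \<xi> (kernel_term y (Suc n)) x) sums dunklT \<xi> (\<lambda>x. kernel_series x y) x"
    using sums_Suc_iff[of "\<lambda>n. dunklT \<xi> (kernel_term y n) x"] dunklT_kernel_term_0 by simp
  then have "(\<lambda>n. (\<xi> \<bullet> y) * kernel_term y n x) sums dunklT \<xi> (\<lambda>x. kernel_series x y) x"
    unfolding dunklT_kernel_term .
  moreover have "(\<lambda>n. (\<xi> \<bullet> y) * kernel_term y n x) sums ((\<xi> \<bullet> y) * kernel_series x y)"
    by (intro sums_mult kernel_series_sums)
  ultimately show ?thesis by (rule sums_unique2)
qed

subsection \<open>Uniqueness of the joint eigenfunction\<close>

text \<open>Since g -> r_\<alpha> g permutes the group, twice the sum equals the sum of the squared
  differences, a discrete Dirichlet form.\<close>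

lemma sum_refl_energy_nonneg:
  fixes a :: "('a \<Rightarrow> 'a) \<Rightarrow> real"
  assumes "\<alpha> \<in> R"
  shows "0 \<le> (\<Sum>g\<in>refl_group R. a g * (a g - a (dunkl_refl \<alpha> \<circ> g)))"
proof -
  have "(\<Sum>g\<in>refl_group R. (a (dunkl_refl \<alpha> \<circ> g))\<^sup>2) = (\<Sum>g\<in>refl_group R. (a g)\<^sup>2)"
    by (rule sum_refl_group_step[OF assms, where F="\<lambda>g. (a g)\<^sup>2"])
  then have "2 * (\<Sum>g\<in>refl_group R. a g * (a g - a (dunkl_refl \<alpha> \<circ> g)))
    = (\<Sum>g\<in>refl_group R. (a g - a (dunkl_refl \<alpha> \<circ> g))\<^sup>2)"
    by (simp add: power2_diff sum.distrib sum_subtractf algebra_simps power2_eq_square sum_distrib_left)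
  then show ?thesis using sum_nonneg[of "refl_group R" "\<lambda>g. (a g - a (dunkl_refl \<alpha> \<circ> g))\<^sup>2"] by simp
qed

text \<open>The orbit energy \<open>\<phi>(s) = (\<Sum>g. h(s g z)\<^sup>2)\<close> satisfies \<open>\<phi>' \<le> 2 |z| |y| \<phi>\<close>, because the
  reflection terms contribute a nonpositive Dirichlet form.\<close>

lemma eigenfunction_zero_regular:
  fixes h :: "'a \<Rightarrow> real"
  assumes diff: "\<And>z. h differentiable at z" and h0: "h 0 = 0"
    and eig: "\<And>\<xi> z. \<forall>\<alpha>\<in>R. \<alpha> \<bullet> z \<noteq> 0 \<Longrightarrow> dunklT \<xi> h z = (\<xi> \<bullet> y) * h z"
    and reg: "\<forall>\<alpha>\<in>R. \<alpha> \<bullet> z \<noteq> 0"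
  shows "h z = 0"
proof -
  let ?G = "refl_group R"
  define D where "D s g = frechet_derivative h (at (s *\<^sub>R g z)) (g z)" for s g
  define \<phi> where "\<phi> s = (\<Sum>g\<in>?G. (h (s *\<^sub>R g z))\<^sup>2)" for s
  define C where "C = 2 * (norm z * norm y)"
  have dh: "((\<lambda>s. h (s *\<^sub>R g z)) has_real_derivative D s g) (at s)" for s g
  proof -
    have "((\<lambda>s. h (s *\<^sub>R g z)) has_derivative (\<lambda>t. frechet_derivative h (at (s *\<^sub>R g z)) (t *\<^sub>R g z))) (at s)"
      by (rule has_derivative_compose[of "\<lambda>s. s *\<^sub>R g z"])
         (auto intro!: derivative_eq_intros simp: diff frechet_derivative_works[symmetric])
    moreover have "(\<lambda>t. frechet_derivative h (at (s *\<^sub>R g z)) (t *\<^sub>R g z)) = (*) (D s g)"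
      by (auto simp: D_def linear_scale[OF linear_frechet_derivative[OF diff]] mult.commute)
    ultimately show ?thesis
      unfolding has_field_derivative_def by simp
  qed
  have d\<phi>: "(\<phi> has_real_derivative (\<Sum>g\<in>?G. 2 * (h (s *\<^sub>R g z) * D s g))) (at s)" for s
    unfolding \<phi>_def[abs_def]
    by (auto intro!: derivative_eq_intros dh simp: mult_ac)
  have le: "(\<Sum>g\<in>?G. 2 * (h (s *\<^sub>R g z) * D s g)) \<le> C * \<phi> s" if s: "s > 0" for s
  proof -
    define a where "a g = h (s *\<^sub>R g z)" for g
    have eq: "s * D s g = s * ((g z \<bullet> y) * a g) - (\<Sum>\<alpha>\<in>R. k \<alpha> * (a g - a (dunkl_refl \<alpha> \<circ> g)))"
      if g: "g \<in> ?G" for g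
    proof -
      \<comment> \<open>The group permutes the roots, so g z pairs with a root as z pairs with
        another one: the whole orbit of a regular point is regular.\<close>
      have rg: "\<alpha> \<bullet> g z \<noteq> 0" if "\<alpha> \<in> R" for \<alpha>
      proof -
        have "\<exists>\<beta>\<in>R. \<alpha> \<bullet> g z = \<beta> \<bullet> z" using g that
        proof (induction arbitrary: \<alpha> rule: refl_group.induct)
          case (step g \<gamma>)
          then show ?case by (metis comp_apply inner_dunkl_refl_left refl_root)
        qed auto
        then show ?thesis using reg by auto
      qed
      have "dunklT (g z) h (s *\<^sub>R g z) = (g z \<bullet> y) * a g"
        unfolding a_def using rg s by (intro eig) auto
      moreover have "dunklT (g z) h (s *\<^sub>R g z)
        = D s g + (\<Sum>\<alpha>\<in>R. k \<alpha> * (a g - a (dunkl_refl \<alpha> \<circ> g))) / s"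
        unfolding dunklT_def D_def sum_divide_distrib using rg s
        by (auto simp: divdiff_def a_def linear_scale[OF linear_dunkl_refl] intro!: sum.cong)
      ultimately show ?thesis using s by (simp add: field_simps)
    qed
    have "s * (\<Sum>g\<in>?G. a g * D s g) = (\<Sum>g\<in>?G. a g * (s * D s g))"
      by (simp add: sum_distrib_left mult_ac)
    also have "\<dots> = s * (\<Sum>g\<in>?G. (g z \<bullet> y) * (a g)\<^sup>2) - (\<Sum>g\<in>?G. \<Sum>\<alpha>\<in>R. k \<alpha> * (a g * (a g - a (dunkl_refl \<alpha> \<circ> g))))"
      by (simp add: eq right_diff_distrib sum_subtractf sum_distrib_left power2_eq_square mult_ac)
    also have "(\<Sum>g\<in>?G. \<Sum>\<alpha>\<in>R. k \<alpha> * (a g * (a g - a (dunkl_refl \<alpha> \<circ> g))))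
      = (\<Sum>\<alpha>\<in>R. k \<alpha> * (\<Sum>g\<in>?G. a g * (a g - a (dunkl_refl \<alpha> \<circ> g))))"
      by (subst sum.swap) (simp add: sum_distrib_left)
    also have "s * (\<Sum>g\<in>?G. (g z \<bullet> y) * (a g)\<^sup>2) - \<dots> \<le> s * (\<Sum>g\<in>?G. (g z \<bullet> y) * (a g)\<^sup>2)"
      using sum_nonneg[of R "\<lambda>\<alpha>. k \<alpha> * (\<Sum>g\<in>?G. a g * (a g - a (dunkl_refl \<alpha> \<circ> g)))"]
        k_nonneg sum_refl_energy_nonneg by simp
    also have "\<dots> \<le> s * (\<Sum>g\<in>?G. (norm z * norm y) * (a g)\<^sup>2)"
    proof (intro mult_left_mono sum_mono mult_right_mono)
      show "g z \<bullet> y \<le> norm z * norm y" if "g \<in> ?G" for g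
        using norm_cauchy_schwarz[of "g z" y] refl_group_norm[OF that, of z] by simp
    qed (use s in auto)
    finally have "(\<Sum>g\<in>?G. a g * D s g) \<le> (\<Sum>g\<in>?G. (norm z * norm y) * (a g)\<^sup>2)"
      using s by simp
    then show ?thesis
      unfolding \<phi>_def C_def a_def by (simp add: sum_distrib_left[symmetric])
  qed
  \<comment> \<open>Gronwall's argument with an integrating factor. The differential inequality is
    available only for s > 0, since at s = 0 the ray meets every hyperplane; hence the open-interval
    form of monotonicity.\<close>
  have "\<phi> 1 * exp (- C * 1) \<le> \<phi> 0 * exp (- C * 0)"
  proof (rule DERIV_nonpos_imp_decreasing_open[where f="\<lambda>s. \<phi> s * exp (- C * s)"])
    fix s :: real assume s: "0 < s" "s < 1"
    have "((\<lambda>s. \<phi> s * exp (- C * s)) has_real_derivative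
        ((\<Sum>g\<in>?G. 2 * (h (s *\<^sub>R g z) * D s g)) - C * \<phi> s) * exp (- C * s)) (at s)"
      by (auto intro!: derivative_eq_intros d\<phi> simp: algebra_simps)
    moreover have "((\<Sum>g\<in>?G. 2 * (h (s *\<^sub>R g z) * D s g)) - C * \<phi> s) * exp (- C * s) \<le> 0"
      using le[OF s(1)] by (simp add: mult_le_0_iff)
    ultimately show "\<exists>y. ((\<lambda>s. \<phi> s * exp (- C * s)) has_real_derivative y) (at s) \<and> y \<le> 0" by blast
  next
    show "continuous_on {0..1} (\<lambda>s. \<phi> s * exp (- C * s))"
      by (intro continuous_intros DERIV_continuous_on[OF has_field_derivative_at_within[OF d\<phi>]])
  qed simp
  moreover have "\<phi> 0 = 0" by (simp add: \<phi>_def h0)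
  ultimately have "\<phi> 1 \<le> 0" by (simp add: mult_le_0_iff)
  moreover have "(h z)\<^sup>2 \<le> \<phi> 1"
    using member_le_sum[OF refl_group.id_in, where f="\<lambda>g. (h (1 *\<^sub>R g z))\<^sup>2"]
    by (simp add: \<phi>_def finite_refl_group)
  ultimately have "(h z)\<^sup>2 \<le> 0" by (rule order_trans[rotated])
  then show ?thesis by simp
qed

text \<open>The open set where h is nonzero lies in finitely many hyperplanes, a negligible set, and
  is therefore empty.\<close>

lemma eigenfunction_zero:
  fixes h :: "'a \<Rightarrow> real"
  assumes diff: "\<And>z. h differentiable at z" and h0: "h 0 = 0"
    and eig: "\<And>\<xi> z. \<forall>\<alpha>\<in>R. \<alpha> \<bullet> z \<noteq> 0 \<Longrightarrow> dunklT \<xi> h z = (\<xi> \<bullet> y) * h z"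
  shows "h x = 0"
proof (rule ccontr)
  assume "h x \<noteq> 0"
  have "continuous_on UNIV h"
    using diff by (meson differentiable_imp_continuous_on differentiable_on_def differentiable_at_withinI)
  then have "open {x. h x \<noteq> 0}"
    by (simp add: open_Collect_neq)
  moreover have "negligible {x. h x \<noteq> 0}"
  proof (rule negligible_subset)
    have "negligible {x. \<alpha> \<bullet> x = 0}" if "\<alpha> \<in> R" for \<alpha>
      using root_inner_self[OF that] by (intro negligible_hyperplane) auto
    then show "negligible (\<Union>\<alpha>\<in>R. {x. \<alpha> \<bullet> x = 0})"
      using finite_R by (intro negligible_Union) auto
    show "{x. h x \<noteq> 0} \<subseteq> (\<Union>\<alpha>\<in>R. {x. \<alpha> \<bullet> x = 0})"
      using eigenfunction_zero_regular[OF diff h0 eig] by blast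
  qed
  ultimately show False
    using open_not_negligible \<open>h x \<noteq> 0\<close> by blast
qed

lemma kernel_series_unique:
  assumes f: "\<And>z. f differentiable at z" "f 0 = 1"
    and eig: "\<And>\<xi> z. \<forall>\<alpha>\<in>R. \<alpha> \<bullet> z \<noteq> 0 \<Longrightarrow> dunklT \<xi> f z = (\<xi> \<bullet> y) * f z"
  shows "f = (\<lambda>x. kernel_series x y)"
proof
  fix x
  have "f x - kernel_series x y = 0"
  proof (rule eigenfunction_zero[where h="\<lambda>x. f x - kernel_series x y" and y=y])
    show "(\<lambda>x. f x - kernel_series x y) differentiable at z" for z
      by (intro differentiable_diff f kernel_series_differentiable)
    show "f 0 - kernel_series 0 y = 0" by (simp add: f kernel_series_zero)
    fix \<xi> z assume reg: "\<forall>\<alpha>\<in>R. \<alpha> \<bullet> z \<noteq> 0"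
    have "frechet_derivative (\<lambda>x. f x - kernel_series x y) (at z) \<xi>
        = frechet_derivative f (at z) \<xi> - frechet_derivative (\<lambda>x. kernel_series x y) (at z) \<xi>"
      using frechet_derivative_at[OF has_derivative_diff[OF f(1)[unfolded frechet_derivative_works]
            kernel_series_differentiable[unfolded frechet_derivative_works]]] by metis
    moreover have "divdiff \<alpha> (\<lambda>x. f x - kernel_series x y) z = divdiff \<alpha> f z - divdiff \<alpha> (\<lambda>x. kernel_series x y) z"
      if "\<alpha> \<in> R" for \<alpha>
      using reg that by (simp add: divdiff_def diff_divide_distrib)
    ultimately have "dunklT \<xi> (\<lambda>x. f x - kernel_series x y) z = dunklT \<xi> f z - dunklT \<xi> (\<lambda>x. kernel_series x y) z"
      by (simp add: dunklT_def sum_subtractf right_diff_distrib)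
    then show "dunklT \<xi> (\<lambda>x. f x - kernel_series x y) z = (\<xi> \<bullet> y) * (f z - kernel_series z y)"
      using reg by (simp add: eig dunklT_kernel_series right_diff_distrib)
  qed
  then show "f x = kernel_series x y" by simp
qed

end

subsection \<open>Identification of the Dunkl kernel\<close>

locale dunkl_setting =
  fixes R Rp :: "'a::euclidean_space set" and \<kappa> :: "'a \<Rightarrow> real"
  assumes roots: "root_system R" and pos: "positive_subsystem R Rp" and mult: "multiplicity R \<kappa>"
begin

text \<open>Halving \<open>\<kappa>\<close> lets all sums run over \<open>R\<close>, which the reflections permute, instead of over \<open>Rp\<close>.\<close>

sublocale root_multiplicity R "\<lambda>\<alpha>. \<kappa> \<alpha> / 2"
proof
  show "finite R" using roots by (simp add: root_system_def)
  fix \<alpha> assume \<alpha>: "\<alpha> \<in> R"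
  then have "norm \<alpha> = sqrt 2" using roots by (simp add: root_system_def)
  then show "\<alpha> \<bullet> \<alpha> = 2" by (simp add: norm_eq_sqrt_inner)
  show "0 \<le> \<kappa> \<alpha> / 2" using mult \<alpha> by (simp add: multiplicity_def)
  fix \<beta> assume \<beta>: "\<beta> \<in> R"
  show "dunkl_refl \<alpha> \<beta> \<in> R" using roots \<alpha> \<beta> by (auto simp: root_system_def)
  have "dunkl_refl \<alpha> \<circ> id \<in> refl_group R"
    by (rule refl_group.step[OF refl_group.id_in \<alpha>])
  then show "\<kappa> (dunkl_refl \<alpha> \<beta>) / 2 = \<kappa> \<beta> / 2" using mult \<beta> by (auto simp: multiplicity_def)
qed

lemma Rp_subset: "Rp \<subseteq> R" and finite_Rp: "finite Rp"
  using pos finite_R by (auto simp: positive_subsystem_def)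

lemma uminus_root: "\<alpha> \<in> R \<Longrightarrow> - \<alpha> \<in> R"
  using roots unfolding root_system_def by blast

lemma roots_eq: "R = Rp \<union> uminus ` Rp" and roots_disjoint: "Rp \<inter> uminus ` Rp = {}"
proof -
  obtain \<beta> where \<beta>: "\<forall>\<alpha>\<in>R. \<alpha> \<bullet> \<beta> \<noteq> 0" "Rp = {\<alpha>\<in>R. \<alpha> \<bullet> \<beta> > 0}"
    using pos by (auto simp: positive_subsystem_def)
  have "\<alpha> \<in> uminus ` Rp" if "\<alpha> \<in> R" "\<alpha> \<notin> Rp" for \<alpha>
    using that \<beta> uminus_root[OF that(1)] by (intro image_eqI[where x="-\<alpha>"]) force+
  then show "R = Rp \<union> uminus ` Rp" using Rp_subset uminus_root by blast
  show "Rp \<inter> uminus ` Rp = {}" using \<beta> by force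
qed

lemma sum_roots_even:
  fixes F :: "'a \<Rightarrow> real"
  assumes "\<And>\<alpha>. \<alpha> \<in> R \<Longrightarrow> F (-\<alpha>) = F \<alpha>"
  shows "sum F R = 2 * sum F Rp"
proof -
  have "sum F R = sum F Rp + sum F (uminus ` Rp)"
    by (subst roots_eq, rule sum.union_disjoint) (auto simp: finite_Rp roots_disjoint)
  also have "sum F (uminus ` Rp) = (\<Sum>\<alpha>\<in>Rp. F (-\<alpha>))"
    by (subst sum.reindex) (auto simp: inj_on_def)
  also have "\<dots> = sum F Rp" using assms Rp_subset by (intro sum.cong) auto
  finally show ?thesis by simp
qed

lemma \<kappa>_uminus:
  assumes "\<alpha> \<in> R"
  shows "\<kappa> (-\<alpha>) = \<kappa> \<alpha>"
proof -
  have "dunkl_refl \<alpha> \<alpha> = - \<alpha>"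
    using dunkl_refl_root_eq[OF assms, of \<alpha>] root_inner_self[OF assms] by (simp add: scaleR_2)
  then show ?thesis using k_refl[OF assms assms] by simp
qed

lemma \<kappa>_nonneg: "\<alpha> \<in> Rp \<Longrightarrow> 0 \<le> \<kappa> \<alpha>"
  using k_nonneg Rp_subset by force

lemma regular_iff: "(\<forall>\<alpha>\<in>Rp. \<alpha> \<bullet> z \<noteq> 0) \<longleftrightarrow> (\<forall>\<alpha>\<in>R. \<alpha> \<bullet> z \<noteq> 0)"
proof
  assume Rp: "\<forall>\<alpha>\<in>Rp. \<alpha> \<bullet> z \<noteq> 0"
  show "\<forall>\<alpha>\<in>R. \<alpha> \<bullet> z \<noteq> 0"
  proof
    fix \<alpha> assume "\<alpha> \<in> R"
    then have "\<alpha> \<in> Rp \<union> uminus ` Rp" using roots_eq by simp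
    then show "\<alpha> \<bullet> z \<noteq> 0" using Rp by auto
  qed
qed (use Rp_subset in auto)

lemma dunkl_op_eq:
  assumes "\<forall>\<alpha>\<in>R. \<alpha> \<bullet> z \<noteq> 0"
  shows "dunkl_op Rp \<kappa> f \<xi> z = dunklT \<xi> f z"
proof -
  have "(\<Sum>\<alpha>\<in>R. \<kappa> \<alpha> / 2 * (\<alpha> \<bullet> \<xi>) * divdiff \<alpha> f z)
    = 2 * (\<Sum>\<alpha>\<in>Rp. \<kappa> \<alpha> / 2 * (\<alpha> \<bullet> \<xi>) * divdiff \<alpha> f z)"
  proof (rule sum_roots_even)
    fix \<alpha> assume "\<alpha> \<in> R"
    moreover have "dunkl_refl (-\<alpha>) z = dunkl_refl \<alpha> z" by (simp add: dunkl_refl_def)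
    ultimately show "\<kappa> (-\<alpha>) / 2 * (-\<alpha> \<bullet> \<xi>) * divdiff (-\<alpha>) f z = \<kappa> \<alpha> / 2 * (\<alpha> \<bullet> \<xi>) * divdiff \<alpha> f z"
      using assms by (simp add: \<kappa>_uminus divdiff_def)
  qed
  also have "\<dots> = (\<Sum>\<alpha>\<in>Rp. \<kappa> \<alpha> * (\<alpha> \<bullet> \<xi>) * (f z - f (dunkl_refl \<alpha> z)) / (\<alpha> \<bullet> z))"
    using assms Rp_subset by (auto simp: sum_distrib_left divdiff_def intro!: sum.cong)
  finally show ?thesis by (simp add: dunkl_op_def dunklT_def)
qed

lemma dunkl_kernel_eq: "dunkl_kernel Rp \<kappa> x y = kernel_series x y"
proof -
  let ?P = "\<lambda>f. (\<forall>z. f differentiable (at z)) \<and> f 0 = 1 \<and>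
       (\<forall>\<xi> z. (\<forall>\<alpha>\<in>Rp. \<alpha> \<bullet> z \<noteq> 0) \<longrightarrow> dunkl_op Rp \<kappa> f \<xi> z = (\<xi> \<bullet> y) * f z)"
  have "(THE f. ?P f) = (\<lambda>x. kernel_series x y)"
  proof (rule the_equality)
    show "?P (\<lambda>x. kernel_series x y)"
      by (simp add: kernel_series_differentiable kernel_series_zero regular_iff dunkl_op_eq dunklT_kernel_series)
    fix f assume "?P f"
    then show "f = (\<lambda>x. kernel_series x y)"
      by (intro kernel_series_unique) (auto simp: regular_iff dunkl_op_eq)
  qed
  then show ?thesis by (simp add: dunkl_kernel_def)
qed

subsection \<open>The weighted measure\<close>

lemma weight_measurable [measurable]: "dunkl_weight Rp \<kappa> \<in> borel_measurable borel"
  unfolding dunkl_weight_def[abs_def] by measurable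

lemma weight_nonneg: "0 \<le> dunkl_weight Rp \<kappa> x"
  unfolding dunkl_weight_def by (intro prod_nonneg) auto

text \<open>An exponential bound merges with the factors \<open>exp (B * norm x)\<close> coming from
  the kernel, so one Gaussian integral settles all questions of integrability.\<close>

lemma weight_le: "\<exists>b\<ge>0. \<forall>x. dunkl_weight Rp \<kappa> x \<le> exp (b * norm x)"
proof (intro exI conjI allI)
  let ?b = "\<Sum>\<alpha>\<in>Rp. 2 * \<kappa> \<alpha> * norm \<alpha>"
  show "0 \<le> ?b" by (intro sum_nonneg) (simp add: \<kappa>_nonneg)
  fix x
  have "\<bar>\<alpha> \<bullet> x\<bar> powr (2 * \<kappa> \<alpha>) \<le> exp (2 * \<kappa> \<alpha> * norm \<alpha> * norm x)" if "\<alpha> \<in> Rp" for \<alpha>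
  proof -
    have "\<bar>\<alpha> \<bullet> x\<bar> \<le> exp (norm \<alpha> * norm x)"
      using Cauchy_Schwarz_ineq2[of \<alpha> x] exp_ge_add_one_self[of "norm \<alpha> * norm x"] by linarith
    then have "\<bar>\<alpha> \<bullet> x\<bar> powr (2 * \<kappa> \<alpha>) \<le> exp (norm \<alpha> * norm x) powr (2 * \<kappa> \<alpha>)"
      using \<kappa>_nonneg[OF that] by (intro powr_mono2) auto
    also have "\<dots> = exp (2 * \<kappa> \<alpha> * norm \<alpha> * norm x)" by (simp add: powr_def mult_ac)
    finally show ?thesis .
  qed
  then have "dunkl_weight Rp \<kappa> x \<le> (\<Prod>\<alpha>\<in>Rp. exp (2 * \<kappa> \<alpha> * norm \<alpha> * norm x))"
    unfolding dunkl_weight_def by (intro prod_mono) auto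
  also have "\<dots> = exp (?b * norm x)"
    by (simp add: exp_sum finite_Rp sum_distrib_right)
  finally show "dunkl_weight Rp \<kappa> x \<le> exp (?b * norm x)" .
qed

lemma weight_scale:
  assumes "c > 0"
  shows "dunkl_weight Rp \<kappa> (c *\<^sub>R x) = c powr (2 * (\<Sum>\<alpha>\<in>Rp. \<kappa> \<alpha>)) * dunkl_weight Rp \<kappa> x"
proof -
  have "dunkl_weight Rp \<kappa> (c *\<^sub>R x) = (\<Prod>\<alpha>\<in>Rp. c powr (2 * \<kappa> \<alpha>) * \<bar>\<alpha> \<bullet> x\<bar> powr (2 * \<kappa> \<alpha>))"
    unfolding dunkl_weight_def using assms by (intro prod.cong) (auto simp: abs_mult powr_mult)
  also have "\<dots> = c powr (\<Sum>\<alpha>\<in>Rp. 2 * \<kappa> \<alpha>) * dunkl_weight Rp \<kappa> x"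
    using assms by (simp add: prod.distrib dunkl_weight_def powr_sum finite_Rp)
  finally show ?thesis by (simp add: sum_distrib_left)
qed

lemma sets_dunkl_measure [measurable_cong, simp]: "sets (dunkl_measure Rp \<kappa>) = sets lebesgue"
  and space_dunkl_measure [simp]: "space (dunkl_measure Rp \<kappa>) = UNIV"
  by (simp_all add: dunkl_measure_def)

lemma weight_lebesgue_measurable [measurable]: "dunkl_weight Rp \<kappa> \<in> borel_measurable lebesgue"
  by (intro measurable_completion) simp

lemma nn_integral_dunkl:
  assumes [measurable]: "f \<in> borel_measurable borel"
  shows "(\<integral>\<^sup>+x. f x \<partial>dunkl_measure Rp \<kappa>) = (\<integral>\<^sup>+x. ennreal (dunkl_weight Rp \<kappa> x) * f x \<partial>lborel)"
proof -
  have [measurable]: "f \<in> borel_measurable lebesgue"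
    by (intro measurable_completion) simp
  show ?thesis
    unfolding dunkl_measure_def by (subst nn_integral_density) (simp_all add: nn_integral_completion)
qed

text \<open>Half the homogeneous dimension of the weighted measure: dilation by c multiplies masses
  by \<open>c powr (2 * half_dim)\<close>.\<close>

definition half_dim :: real where "half_dim = (\<Sum>\<alpha>\<in>Rp. \<kappa> \<alpha>) + real DIM('a) / 2"

text \<open>Dimension at least 1 provides the decay rate t^(-1/2) in \<open>gauss_kernel_le\<close>,
  the same rate as in \<open>kernel_error\<close>.\<close>

lemma half_dim_ge: "1 / 2 \<le> half_dim"
proof -
  have "1 \<le> real DIM('a)" using DIM_positive[where 'a='a] by linarith
  moreover have "0 \<le> sum \<kappa> Rp" using \<kappa>_nonneg by (rule sum_nonneg)
  ultimately show ?thesis unfolding half_dim_def by linarith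
qed

lemma nn_integral_dunkl_scale:
  assumes f[measurable]: "f \<in> borel_measurable borel" and c: "c > 0"
  shows "(\<integral>\<^sup>+x. f (x /\<^sub>R c) \<partial>dunkl_measure Rp \<kappa>)
    = ennreal (c powr (2 * half_dim)) * (\<integral>\<^sup>+x. f x \<partial>dunkl_measure Rp \<kappa>)"
proof -
  let ?w = "dunkl_weight Rp \<kappa>"
  have "(\<integral>\<^sup>+x. f (x /\<^sub>R c) \<partial>dunkl_measure Rp \<kappa>) = (\<integral>\<^sup>+x. ennreal (?w x) * f (x /\<^sub>R c) \<partial>lborel)"
    by (rule nn_integral_dunkl) measurable
  also have "\<dots> = (\<integral>\<^sup>+x. ennreal (\<bar>c\<bar> ^ DIM('a)) * (ennreal (?w (c *\<^sub>R x)) * f x) \<partial>lborel)"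
    using c by (subst lborel_affine[of c 0]) (simp_all add: nn_integral_density nn_integral_distr)
  also have "\<dots> = (\<integral>\<^sup>+x. ennreal (c powr (2 * half_dim)) * (ennreal (?w x) * f x) \<partial>lborel)"
  proof (intro nn_integral_cong)
    fix x
    have "\<bar>c\<bar> ^ DIM('a) * ?w (c *\<^sub>R x) = c powr (2 * half_dim) * ?w x"
      using c by (simp add: weight_scale half_dim_def powr_add powr_realpow[symmetric] distrib_left)
    then show "ennreal (\<bar>c\<bar> ^ DIM('a)) * (ennreal (?w (c *\<^sub>R x)) * f x)
      = ennreal (c powr (2 * half_dim)) * (ennreal (?w x) * f x)"
      using c by (simp add: ennreal_mult'[symmetric] mult.assoc[symmetric])
  qed
  also have "\<dots> = ennreal (c powr (2 * half_dim)) * (\<integral>\<^sup>+x. f x \<partial>dunkl_measure Rp \<kappa>)"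
    by (simp add: nn_integral_cmult nn_integral_dunkl)
  finally show ?thesis .
qed

end

section \<open>Two estimates free of the Dunkl structure\<close>

text \<open>X and Y stand for the norms of x and y, K for the kernel at the rescaled points. There
  are two errors: exp q - 1 \<le> q exp q with q of order t^(-1/2), and the factor exp (-X^2 / (4
  t)), which is within r^2 / t of 1. For t \<ge> 1 both are O(t^(-1/2)). Apart from t and Z the
  majorant involves Y only through Y / sqrt (2 t), which prepares the scaling of its
  integral.\<close>

lemma gaussian_perturbation:
  fixes X Y K r t :: real
  assumes t: "t \<ge> 1" and X: "0 \<le> X" "X \<le> r" and Y: "0 \<le> Y" and Z: "Z > 0"
    and K: "\<bar>K - 1\<bar> \<le> exp (X / sqrt (2 * t) * (Y / sqrt (2 * t))) - 1"
  shows "\<bar>exp (- (X\<^sup>2 + Y\<^sup>2) / (4 * t)) * K / Z - exp (- Y\<^sup>2 / (4 * t)) / Z\<bar>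
    \<le> t powr (-1/2) * (exp (- (Y / sqrt (2 * t))\<^sup>2 / 2) * (r * (Y / sqrt (2 * t)) * exp (r * (Y / sqrt (2 * t))) + r\<^sup>2) / Z)"
proof -
  define \<tau> where "\<tau> = t powr (-1/2)"
  define u where "u = Y / sqrt (2 * t)"
  define q where "q = X / sqrt (2 * t) * u"
  define a where "a = exp (- X\<^sup>2 / (4 * t))"
  have \<tau>: "\<tau> = 1 / sqrt t" using t by (simp add: \<tau>_def powr_minus_divide powr_half_sqrt)
  have \<tau>01: "0 < \<tau>" "\<tau> \<le> 1" using t by (auto simp: \<tau>)
  have u: "0 \<le> u" using Y t by (simp add: u_def)
  have q0: "0 \<le> q" using X u t by (simp add: q_def)
  have "X / sqrt (2 * t) \<le> X / sqrt t" using X t by (intro divide_left_mono) auto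
  also have "\<dots> \<le> \<tau> * r" using X t by (simp add: \<tau> divide_right_mono)
  finally have q\<tau>: "q \<le> \<tau> * (r * u)"
    unfolding q_def mult.assoc[symmetric] using u by (rule mult_right_mono)
  also have "\<dots> \<le> r * u" using \<tau>01 X u by (intro mult_left_le_one_le) auto
  finally have qr: "q \<le> r * u" .
  have "1 - q \<le> exp (- q)" using exp_ge_add_one_self[of "- q"] by simp
  then have "(1 - q) * exp q \<le> exp (- q) * exp q" by (intro mult_right_mono) auto
  then have "exp q - 1 \<le> q * exp q" by (simp add: exp_minus algebra_simps)
  also have "\<dots> \<le> \<tau> * (r * u) * exp (r * u)" using q\<tau> qr q0 by (intro mult_mono) auto
  finally have e1: "exp q - 1 \<le> \<tau> * (r * u * exp (r * u))" by (simp add: mult.assoc)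
  have a: "0 < a" "a \<le> 1" using t by (auto simp: a_def)
  have "1 - a \<le> X\<^sup>2 / (4 * t)" using exp_ge_add_one_self[of "- X\<^sup>2 / (4 * t)"] by (simp add: a_def)
  also have "\<dots> \<le> r\<^sup>2 / t" using X t by (intro frac_le power_mono) auto
  also have "\<dots> = \<tau> * (\<tau> * r\<^sup>2)" using t by (simp add: \<tau> real_sqrt_mult[symmetric])
  also have "\<dots> \<le> \<tau> * r\<^sup>2" using \<tau>01 by (intro mult_left_mono mult_left_le_one_le) auto
  finally have e2: "1 - a \<le> \<tau> * r\<^sup>2" .
  have "\<bar>a * K - 1\<bar> = \<bar>a * (K - 1) - (1 - a)\<bar>" by (simp add: algebra_simps)
  also have "\<dots> \<le> a * \<bar>K - 1\<bar> + (1 - a)" using a abs_triangle_ineq4[of "a * (K - 1)" "1 - a"] by (simp add: abs_mult)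
  also have "\<dots> \<le> (exp q - 1) + (1 - a)"
    using K a mult_left_le_one_le[of "\<bar>K - 1\<bar>" a] by (simp add: q_def u_def)
  also have "\<dots> \<le> \<tau> * (r * u * exp (r * u) + r\<^sup>2)" using e1 e2 by (simp add: distrib_left)
  finally have main: "\<bar>a * K - 1\<bar> \<le> \<tau> * (r * u * exp (r * u) + r\<^sup>2)" .
  have E: "exp (- (X\<^sup>2 + Y\<^sup>2) / (4 * t)) = a * exp (- Y\<^sup>2 / (4 * t))"
    by (simp add: a_def exp_add[symmetric] add_divide_distrib diff_divide_distrib)
  have "exp (- (X\<^sup>2 + Y\<^sup>2) / (4 * t)) * K / Z - exp (- Y\<^sup>2 / (4 * t)) / Z
     = exp (- Y\<^sup>2 / (4 * t)) / Z * (a * K - 1)"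
    unfolding E by (simp add: right_diff_distrib left_diff_distrib diff_divide_distrib mult_ac)
  then have "\<bar>exp (- (X\<^sup>2 + Y\<^sup>2) / (4 * t)) * K / Z - exp (- Y\<^sup>2 / (4 * t)) / Z\<bar>
     = exp (- Y\<^sup>2 / (4 * t)) / Z * \<bar>a * K - 1\<bar>" using Z by (simp add: abs_mult)
  also have "\<dots> \<le> exp (- Y\<^sup>2 / (4 * t)) / Z * (\<tau> * (r * u * exp (r * u) + r\<^sup>2))"
    using Z main by (intro mult_left_mono) auto
  also have "\<dots> = exp (- u\<^sup>2 / 2) / Z * (\<tau> * (r * u * exp (r * u) + r\<^sup>2))"
    using t by (simp add: u_def power_divide)
  finally show ?thesis by (simp add: \<tau>_def u_def mult_ac)
qed

text \<open>At x only the ball with index j = floor of \<open>norm x\<close> is needed in the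
  dominating sum; polynomial growth of the volumes loses against exp (-j).\<close>

lemma nn_integral_exp_minus_norm:
  "(\<integral>\<^sup>+x. ennreal (exp (- norm (x::'a::euclidean_space))) \<partial>lborel) < \<infinity>"
proof -
  let ?n = "DIM('a)" and ?V = "measure lborel (ball (0::'a) 1)"
  have "(\<integral>\<^sup>+(x::'a). ennreal (exp (- norm x)) \<partial>lborel)
     \<le> (\<integral>\<^sup>+(x::'a). (\<Sum>j. ennreal (exp (- real j)) * indicator (ball 0 (real j + 1)) x) \<partial>lborel)"
  proof (intro nn_integral_mono)
    fix x :: 'a
    let ?j = "nat \<lfloor>norm x\<rfloor>"
    have j: "real ?j \<le> norm x" "norm x < real ?j + 1" by (auto simp: of_nat_nat)
    have "ennreal (exp (- norm x)) \<le> ennreal (exp (- real ?j)) * indicator (ball 0 (real ?j + 1)) x"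
      using j by (simp add: indicator_def ennreal_leI)
    also have "\<dots> \<le> (\<Sum>j. ennreal (exp (- real j)) * indicator (ball 0 (real j + 1)) x)"
      using sum_le_suminf[of "\<lambda>j. ennreal (exp (- real j)) * indicator (ball 0 (real j + 1)) x" "{?j}"]
      by simp
    finally show "ennreal (exp (- norm x))
      \<le> (\<Sum>j. ennreal (exp (- real j)) * indicator (ball 0 (real j + 1)) x)" .
  qed
  also have "\<dots> = (\<Sum>j. \<integral>\<^sup>+(x::'a). ennreal (exp (- real j)) * indicator (ball 0 (real j + 1)) x \<partial>lborel)"
    by (intro nn_integral_suminf borel_measurable_times_ennreal borel_measurable_indicator) auto
  also have "\<dots> = (\<Sum>j. ennreal (exp (- real j) * ((real j + 1) ^ ?n * ?V)))"
  proof (intro suminf_cong)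
    fix j
    have "emeasure lborel (ball (0::'a) (real j + 1)) = ennreal ((real j + 1) ^ ?n * ?V)"
      using emeasure_lborel_ball_finite[of "0::'a" "real j + 1"] content_ball_conv_unit_ball[of "real j + 1" "0::'a"]
      by (subst emeasure_eq_ennreal_measure) auto
    then show "(\<integral>\<^sup>+(x::'a). ennreal (exp (- real j)) * indicator (ball 0 (real j + 1)) x \<partial>lborel)
      = ennreal (exp (- real j) * ((real j + 1) ^ ?n * ?V))"
      by (simp add: nn_integral_cmult_indicator ennreal_mult')
  qed
  also have "\<dots> < \<infinity>"
  proof -
    \<comment> \<open>From u ^ n / fact n \<le> exp u at u = (j + 1) / 2: the volume growth costs
      half of the exponential decay, and exp (1/2) accounts for the offset in j + 1.\<close>
    let ?C = "2 ^ ?n * fact ?n * exp (1/2) * ?V"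
    have "summable (\<lambda>j. exp (- real j) * ((real j + 1) ^ ?n * ?V))"
    proof (rule summable_comparison_test')
      show "summable (\<lambda>j. ?C * exp (- 1/2) ^ j)"
        by (intro summable_mult summable_geometric) simp
      fix j :: nat
      let ?u = "(real j + 1) / 2"
      have "?u ^ ?n / fact ?n \<le> exp ?u"
      proof -
        have s: "(\<lambda>n. ?u ^ n / fact n) sums exp ?u"
          using exp_converges[of ?u] by (simp add: field_simps)
        show ?thesis
          using sum_le_suminf[OF sums_summable[OF s], of "{?n}"] sums_unique[OF s] by simp
      qed
      then have "(real j + 1) ^ ?n \<le> 2 ^ ?n * fact ?n * exp ?u"
        by (simp add: power_divide field_simps)
      then have "exp (- real j) * ((real j + 1) ^ ?n * ?V) \<le> exp (- real j) * ((2 ^ ?n * fact ?n * exp ?u) * ?V)"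
        by (intro mult_left_mono mult_right_mono) auto
      also have "\<dots> = ?C * (exp (- real j) * exp (real j / 2))"
        by (simp add: add_divide_distrib exp_add mult_ac)
      also have "exp (- real j) * exp (real j / 2) = exp (- 1/2) ^ j"
        by (simp add: exp_of_nat_mult[symmetric] exp_add[symmetric])
      finally show "norm (exp (- real j) * ((real j + 1) ^ ?n * ?V)) \<le> ?C * exp (- 1/2) ^ j"
        by simp
    qed
    then show ?thesis
      by (subst suminf_ennreal2) auto
  qed
  finally show ?thesis .
qed

context dunkl_setting
begin

subsection \<open>Comparison of the heat kernel with the Gaussian\<close>

lemma measurable_dunkl_borel:
  assumes "f \<in> measurable borel N"
  shows "f \<in> measurable (dunkl_measure Rp \<kappa>) N"
proof -
  have "f \<in> measurable lebesgue N" using assms by (intro measurable_completion) simp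
  then show ?thesis using measurable_cong_sets[OF sets_dunkl_measure refl] by blast
qed

lemma nn_integral_gaussian_finite:
  assumes "0 \<le> B"
  shows "(\<integral>\<^sup>+x. ennreal (exp (B * norm x - (norm x)\<^sup>2 / 2)) \<partial>dunkl_measure Rp \<kappa>) < \<infinity>"
proof -
  obtain b where b: "b \<ge> 0" "\<And>x. dunkl_weight Rp \<kappa> x \<le> exp (b * norm x)"
    using weight_le by blast
  \<comment> \<open>This shift completes the square: (norm x - A)^2 \<ge> 0 absorbs the growth b of
    the weight and B of the integrand and still leaves exp (- norm x).\<close>
  let ?A = "b + B + 1"
  have "(\<integral>\<^sup>+x. ennreal (exp (B * norm x - (norm x)\<^sup>2 / 2)) \<partial>dunkl_measure Rp \<kappa>)
    = (\<integral>\<^sup>+x. ennreal (dunkl_weight Rp \<kappa> x) * ennreal (exp (B * norm x - (norm x)\<^sup>2 / 2)) \<partial>lborel)"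
    by (rule nn_integral_dunkl) measurable
  also have "\<dots> \<le> (\<integral>\<^sup>+(x::'a). ennreal (exp (?A\<^sup>2 / 2)) * ennreal (exp (- norm x)) \<partial>lborel)"
  proof (intro nn_integral_mono)
    fix x :: 'a
    have "dunkl_weight Rp \<kappa> x * exp (B * norm x - (norm x)\<^sup>2 / 2)
       \<le> exp (b * norm x) * exp (B * norm x - (norm x)\<^sup>2 / 2)"
      using b by (intro mult_right_mono) auto
    also have "\<dots> \<le> exp (?A\<^sup>2 / 2) * exp (- norm x)"
      using zero_le_power2[of "norm x - ?A"]
      by (simp add: exp_add[symmetric] power2_eq_square algebra_simps)
    finally show "ennreal (dunkl_weight Rp \<kappa> x) * ennreal (exp (B * norm x - (norm x)\<^sup>2 / 2))
        \<le> ennreal (exp (?A\<^sup>2 / 2)) * ennreal (exp (- norm x))"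
      by (simp add: ennreal_mult'[symmetric] weight_nonneg ennreal_leI)
  qed
  also have "\<dots> < \<infinity>"
    using nn_integral_exp_minus_norm[where 'a='a]
    by (simp add: nn_integral_cmult ennreal_mult_less_top)
  finally show ?thesis .
qed

lemma nn_integral_dunkl_lebesgue:
  assumes "f \<in> borel_measurable borel"
  shows "(\<integral>\<^sup>+x. f x \<partial>dunkl_measure Rp \<kappa>) = (\<integral>\<^sup>+x. ennreal (dunkl_weight Rp \<kappa> x) * f x \<partial>lebesgue)"
  unfolding dunkl_measure_def using assms by (intro nn_integral_density measurable_completion) auto

text \<open>\<open>dunkl_const\<close> is a Bochner integral, which would be 0 by convention if it
  diverged; finiteness of the Gaussian integral makes it agree with the nonnegative
  integral.\<close>

lemma dunkl_const_eq:
  "(\<integral>\<^sup>+x. ennreal (exp (- (norm x)\<^sup>2 / 2)) \<partial>dunkl_measure Rp \<kappa>) = ennreal (dunkl_const Rp \<kappa>)"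
proof -
  let ?f = "\<lambda>x::'a. exp (- (norm x)\<^sup>2 / 2)"
  have "dunkl_const Rp \<kappa> = enn2real (\<integral>\<^sup>+x. ennreal (?f x * dunkl_weight Rp \<kappa> x) \<partial>lebesgue)"
    unfolding dunkl_const_def
  proof (rule integral_eq_nn_integral)
    show "(\<lambda>x. ?f x * dunkl_weight Rp \<kappa> x) \<in> borel_measurable lebesgue"
      by (intro measurable_completion) measurable
  qed (simp add: weight_nonneg)
  also have "(\<integral>\<^sup>+x. ennreal (?f x * dunkl_weight Rp \<kappa> x) \<partial>lebesgue)
      = (\<integral>\<^sup>+x. ennreal (?f x) \<partial>dunkl_measure Rp \<kappa>)"
    by (subst nn_integral_dunkl_lebesgue) (simp_all add: ennreal_mult' weight_nonneg mult.commute)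
  finally show ?thesis using nn_integral_gaussian_finite[of 0] by simp
qed

lemma AE_weight_pos: "AE x in lebesgue. dunkl_weight Rp \<kappa> x \<noteq> 0"
proof -
  have "negligible {x. \<alpha> \<bullet> x = 0}" if "\<alpha> \<in> Rp" for \<alpha>
    using root_inner_self[of \<alpha>] that Rp_subset by (intro negligible_hyperplane) auto
  then have "negligible (\<Union>\<alpha>\<in>Rp. {x. \<alpha> \<bullet> x = 0})"
    using finite_Rp by (intro negligible_Union) auto
  then have "(\<Union>\<alpha>\<in>Rp. {x. \<alpha> \<bullet> x = 0}) \<in> null_sets lebesgue"
    by (simp add: negligible_iff_null_sets)
  moreover have "{x. \<not> dunkl_weight Rp \<kappa> x \<noteq> 0} \<subseteq> (\<Union>\<alpha>\<in>Rp. {x. \<alpha> \<bullet> x = 0})"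
    using finite_Rp by (auto simp: dunkl_weight_def)
  ultimately show ?thesis by (auto intro: AE_I')
qed

text \<open>The heat kernel divides by this constant. If it were 0, a function positive off the
  hyperplanes would vanish almost everywhere.\<close>

lemma dunkl_const_pos: "0 < dunkl_const Rp \<kappa>"
proof -
  let ?f = "\<lambda>x::'a. ennreal (exp (- (norm x)\<^sup>2 / 2))"
  have "ennreal (dunkl_const Rp \<kappa>) \<noteq> 0"
  proof
    assume "ennreal (dunkl_const Rp \<kappa>) = 0"
    then have "(\<integral>\<^sup>+x. ennreal (dunkl_weight Rp \<kappa> x) * ?f x \<partial>lebesgue) = 0"
      unfolding dunkl_const_eq[symmetric] by (subst (asm) nn_integral_dunkl_lebesgue) measurable
    moreover have "(\<lambda>x. ennreal (dunkl_weight Rp \<kappa> x) * ?f x) \<in> borel_measurable lebesgue"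
      by (intro measurable_completion) measurable
    ultimately have "AE x in lebesgue. ennreal (dunkl_weight Rp \<kappa> x) * ?f x = 0"
      using nn_integral_0_iff_AE by blast
    with AE_weight_pos have "AE x in lebesgue :: 'a measure. False"
    proof eventually_elim
      case (elim x)
      then show ?case using weight_nonneg[of x] by (simp add: ennreal_eq_0_iff)
    qed
    then have "ae_filter (lebesgue :: 'a measure) = bot"
      by (simp add: trivial_limit_def)
    then show False by (simp add: ae_filter_eq_bot_iff emeasure_lborel_UNIV)
  qed
  then show ?thesis by (simp add: ennreal_eq_0_iff not_le)
qed

definition heat_norm :: "real \<Rightarrow> real" where "heat_norm t = (2 * t) powr half_dim * dunkl_const Rp \<kappa>"

lemma heat_norm_pos: "t > 0 \<Longrightarrow> heat_norm t > 0"
  by (simp add: heat_norm_def dunkl_const_pos)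

text \<open>\<open>gauss_kernel t\<close> is the heat kernel with pole at the origin.\<close>

definition gauss_kernel :: "real \<Rightarrow> 'a \<Rightarrow> real" where
  "gauss_kernel t y = exp (- (norm y)\<^sup>2 / (4 * t)) / heat_norm t"

text \<open>The numerator of the bound in \<open>gaussian_perturbation\<close> at unit scale, in the
  variable z = y / sqrt (2 t).\<close>

definition error_profile :: "real \<Rightarrow> 'a \<Rightarrow> real" where
  "error_profile r z = exp (- (norm z)\<^sup>2 / 2) * (r * norm z * exp (r * norm z) + r\<^sup>2)"

definition kernel_error :: "real \<Rightarrow> real \<Rightarrow> 'a \<Rightarrow> real" where
  "kernel_error r t y = t powr (-1/2) * (error_profile r (y /\<^sub>R sqrt (2 * t)) / heat_norm t)"

lemma error_profile_nonneg: "r \<ge> 0 \<Longrightarrow> 0 \<le> error_profile r z"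
  by (simp add: error_profile_def)

lemma error_profile_measurable [measurable]: "error_profile r \<in> borel_measurable borel"
  unfolding error_profile_def[abs_def] by measurable

lemma kernel_error_nonneg: "r \<ge> 0 \<Longrightarrow> t > 0 \<Longrightarrow> 0 \<le> kernel_error r t y"
  by (simp add: kernel_error_def error_profile_nonneg heat_norm_pos less_imp_le)

text \<open>The Jacobian of y = sqrt (2 t) z is \<open>(2 * t) powr half_dim\<close>, which is the
  t-dependent factor of \<open>heat_norm\<close>. The mass therefore does not depend on t.\<close>

lemma nn_integral_profile:
  assumes F[measurable]: "F \<in> borel_measurable borel" "\<And>z. 0 \<le> F z" and t: "t > 0"
  shows "(\<integral>\<^sup>+y. ennreal (F (y /\<^sub>R sqrt (2 * t)) / heat_norm t) \<partial>dunkl_measure Rp \<kappa>)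
    = ennreal (1 / dunkl_const Rp \<kappa>) * (\<integral>\<^sup>+z. ennreal (F z) \<partial>dunkl_measure Rp \<kappa>)"
proof -
  have [measurable]: "(\<lambda>y. F (y /\<^sub>R sqrt (2 * t))) \<in> borel_measurable lebesgue"
    by (intro measurable_completion) measurable
  have "(\<integral>\<^sup>+y. ennreal (F (y /\<^sub>R sqrt (2 * t)) / heat_norm t) \<partial>dunkl_measure Rp \<kappa>)
    = (\<integral>\<^sup>+y. ennreal (1 / heat_norm t) * ennreal (F (y /\<^sub>R sqrt (2 * t))) \<partial>dunkl_measure Rp \<kappa>)"
    using F(2) heat_norm_pos[OF t] by (intro nn_integral_cong) (simp add: ennreal_mult'[symmetric])
  also have "\<dots> = ennreal (1 / heat_norm t) * (\<integral>\<^sup>+y. ennreal (F (y /\<^sub>R sqrt (2 * t))) \<partial>dunkl_measure Rp \<kappa>)"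
    by (rule nn_integral_cmult) simp
  also have "(\<integral>\<^sup>+y. ennreal (F (y /\<^sub>R sqrt (2 * t))) \<partial>dunkl_measure Rp \<kappa>)
    = ennreal (sqrt (2 * t) powr (2 * half_dim)) * (\<integral>\<^sup>+z. ennreal (F z) \<partial>dunkl_measure Rp \<kappa>)"
    using t by (intro nn_integral_dunkl_scale[where f="\<lambda>z. ennreal (F z)"]) auto
  also have "sqrt (2 * t) powr (2 * half_dim) = (2 * t) powr half_dim"
    using t by (simp add: powr_half_sqrt[symmetric] powr_powr)
  finally show ?thesis
    using heat_norm_pos[OF t] t dunkl_const_pos
    by (simp add: mult.assoc[symmetric] ennreal_mult'[symmetric] heat_norm_def)
qed

lemma gauss_kernel_mass:
  assumes "t > 0"
  shows "(\<integral>\<^sup>+y. ennreal (gauss_kernel t y) \<partial>dunkl_measure Rp \<kappa>) = 1"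
proof -
  have "gauss_kernel t y = exp (- (norm (y /\<^sub>R sqrt (2 * t)))\<^sup>2 / 2) / heat_norm t" for y
    using assms by (simp add: gauss_kernel_def power_mult_distrib power_inverse field_simps)
  then have "(\<integral>\<^sup>+y. ennreal (gauss_kernel t y) \<partial>dunkl_measure Rp \<kappa>)
    = ennreal (1 / dunkl_const Rp \<kappa>) * ennreal (dunkl_const Rp \<kappa>)"
    using nn_integral_profile[of "\<lambda>z. exp (- (norm z)\<^sup>2 / 2)" t] assms unfolding dunkl_const_eq by simp
  then show ?thesis using dunkl_const_pos by (simp add: ennreal_mult'[symmetric])
qed

text \<open>After rescaling, all dependence on t sits in the prefactor, and the profile is dominated
  by a multiple of a Gaussian times \<open>exp ((r + 1) * norm z)\<close>.\<close>

lemma kernel_error_mass: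
  assumes r: "r \<ge> 0"
  shows "\<exists>C\<ge>0. \<forall>t>0. (\<integral>\<^sup>+y. ennreal (kernel_error r t y) \<partial>dunkl_measure Rp \<kappa>) \<le> ennreal (C * t powr (-1/2))"
proof -
  let ?I = "ennreal (1 / dunkl_const Rp \<kappa>) * (\<integral>\<^sup>+z. ennreal (error_profile r z) \<partial>dunkl_measure Rp \<kappa>)"
  have "(\<integral>\<^sup>+z. ennreal (error_profile r z) \<partial>dunkl_measure Rp \<kappa>)
    \<le> (\<integral>\<^sup>+z. ennreal (r + r\<^sup>2) * ennreal (exp ((r + 1) * norm z - (norm z)\<^sup>2 / 2)) \<partial>dunkl_measure Rp \<kappa>)"
  proof (intro nn_integral_mono)
    fix z :: 'a
    have "norm z * exp (r * norm z) \<le> exp (norm z) * exp (r * norm z)"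
      using exp_ge_add_one_self[of "norm z"] by (intro mult_right_mono) (linarith, simp)
    moreover have "1 \<le> exp ((r + 1) * norm z)" using r by simp
    ultimately have "r * (norm z * exp (r * norm z)) + r\<^sup>2 * 1 \<le> r * exp ((r + 1) * norm z) + r\<^sup>2 * exp ((r + 1) * norm z)"
      using r by (intro add_mono mult_left_mono) (auto simp: algebra_simps exp_add)
    then have "error_profile r z \<le> exp (- (norm z)\<^sup>2 / 2) * ((r + r\<^sup>2) * exp ((r + 1) * norm z))"
      unfolding error_profile_def by (intro mult_left_mono) (auto simp: algebra_simps)
    also have "\<dots> = (r + r\<^sup>2) * exp ((r + 1) * norm z - (norm z)\<^sup>2 / 2)"
      by (simp add: exp_add[symmetric] algebra_simps add_divide_distrib diff_divide_distrib)
    finally show "ennreal (error_profile r z) \<le> ennreal (r + r\<^sup>2) * ennreal (exp ((r + 1) * norm z - (norm z)\<^sup>2 / 2))"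
      using r by (subst ennreal_mult'[symmetric]) (simp_all add: ennreal_leI)
  qed
  also have "\<dots> = ennreal (r + r\<^sup>2) * (\<integral>\<^sup>+z. ennreal (exp ((r + 1) * norm z - (norm z)\<^sup>2 / 2)) \<partial>dunkl_measure Rp \<kappa>)"
    by (intro nn_integral_cmult measurable_dunkl_borel) measurable
  also have "\<dots> < \<infinity>"
    using nn_integral_gaussian_finite[of "r + 1"] r by (simp add: ennreal_mult_less_top)
  finally have fin: "?I < \<infinity>" by (simp add: ennreal_mult_less_top)
  show ?thesis
  proof (intro exI conjI allI impI)
    fix t :: real assume t: "t > 0"
    have [measurable]: "(\<lambda>y. error_profile r (y /\<^sub>R sqrt (2 * t))) \<in> borel_measurable lebesgue"
      by (intro measurable_completion) measurable
    have "(\<integral>\<^sup>+y. ennreal (kernel_error r t y) \<partial>dunkl_measure Rp \<kappa>)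
      = (\<integral>\<^sup>+y. ennreal (t powr (-1/2)) * ennreal (error_profile r (y /\<^sub>R sqrt (2 * t)) / heat_norm t) \<partial>dunkl_measure Rp \<kappa>)"
      using heat_norm_pos[OF t] error_profile_nonneg[OF r]
      by (intro nn_integral_cong) (simp add: kernel_error_def ennreal_mult'[symmetric])
    also have "\<dots> = ennreal (t powr (-1/2)) * ?I"
      using t by (subst nn_integral_cmult) (simp_all add: nn_integral_profile error_profile_nonneg[OF r])
    also have "\<dots> = ennreal (enn2real ?I * t powr (-1/2))"
      using fin by (simp add: ennreal_mult' mult.commute)
    finally show "(\<integral>\<^sup>+y. ennreal (kernel_error r t y) \<partial>dunkl_measure Rp \<kappa>) \<le> ennreal (enn2real ?I * t powr (-1/2))"
      by simp
  qed simp
qed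

text \<open>Both slots obey the same estimate because \<open>kernel_series_bound\<close> sees only
  the product of the norms.\<close>

lemma heat_kernel_near:
  assumes t: "t \<ge> 1" and x: "norm x \<le> r"
  shows "\<bar>dunkl_heat_kernel Rp \<kappa> t x y - gauss_kernel t y\<bar> \<le> kernel_error r t y"
    and "\<bar>dunkl_heat_kernel Rp \<kappa> t y x - gauss_kernel t y\<bar> \<le> kernel_error r t y"
proof -
  let ?s = "sqrt (2 * t)"
  have n: "norm (z /\<^sub>R ?s) = norm z / ?s" for z :: 'a using t by (simp add: divide_inverse mult.commute)
  have Z: "heat_norm t > 0" using t by (intro heat_norm_pos) simp
  have "\<bar>kernel_series (x /\<^sub>R ?s) (y /\<^sub>R ?s) - 1\<bar> \<le> exp (norm x / ?s * (norm y / ?s)) - 1"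
    using kernel_series_bound[of "x /\<^sub>R ?s" "y /\<^sub>R ?s"] unfolding n .
  from gaussian_perturbation[OF t norm_ge_zero x norm_ge_zero Z this]
  show "\<bar>dunkl_heat_kernel Rp \<kappa> t x y - gauss_kernel t y\<bar> \<le> kernel_error r t y"
    unfolding dunkl_heat_kernel_def dunkl_kernel_eq gauss_kernel_def kernel_error_def error_profile_def n heat_norm_def half_dim_def
    by (simp only: times_divide_eq_right times_divide_eq_left)
  have "\<bar>kernel_series (y /\<^sub>R ?s) (x /\<^sub>R ?s) - 1\<bar> \<le> exp (norm x / ?s * (norm y / ?s)) - 1"
    using kernel_series_bound[of "y /\<^sub>R ?s" "x /\<^sub>R ?s"] unfolding n by (simp only: mult.commute)
  from gaussian_perturbation[OF t norm_ge_zero x norm_ge_zero Z this]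
  show "\<bar>dunkl_heat_kernel Rp \<kappa> t y x - gauss_kernel t y\<bar> \<le> kernel_error r t y"
    unfolding dunkl_heat_kernel_def dunkl_kernel_eq gauss_kernel_def kernel_error_def error_profile_def n heat_norm_def half_dim_def
    by (simp only: times_divide_eq_right times_divide_eq_left add.commute[of "(norm y)\<^sup>2"])
qed

lemma gauss_kernel_le:
  assumes "t \<ge> 1"
  shows "gauss_kernel t y \<le> t powr (-1/2) / dunkl_const Rp \<kappa>"
proof -
  have "t powr (1/2) \<le> (2 * t) powr (1/2)" using assms by (intro powr_mono2) auto
  also have "\<dots> \<le> (2 * t) powr half_dim" using assms half_dim_ge by (intro powr_mono) auto
  finally have "t powr (1/2) * dunkl_const Rp \<kappa> \<le> heat_norm t"
    unfolding heat_norm_def using dunkl_const_pos by (intro mult_right_mono) auto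
  then have "exp (- (norm y)\<^sup>2 / (4 * t)) / heat_norm t \<le> 1 / (t powr (1/2) * dunkl_const Rp \<kappa>)"
    using assms dunkl_const_pos by (intro frac_le) auto
  then show ?thesis using assms by (simp add: gauss_kernel_def powr_minus_divide)
qed

lemma heat_kernel_measurable:
  "(\<lambda>z. dunkl_heat_kernel Rp \<kappa> (fst z) (fst (snd z)) (snd (snd z))) \<in> borel_measurable borel"
proof -
  have "(\<lambda>z::real \<times> 'a \<times> 'a. kernel_series (fst (snd z) /\<^sub>R sqrt (2 * fst z)) (snd (snd z) /\<^sub>R sqrt (2 * fst z)))
      \<in> borel_measurable borel"
    using measurable_compose[OF _ kernel_series_measurable, of "\<lambda>z. (fst (snd z) /\<^sub>R sqrt (2 * fst z), snd (snd z) /\<^sub>R sqrt (2 * fst z))"]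
    by (simp add: borel_prod[symmetric])
  then show ?thesis
    unfolding dunkl_heat_kernel_def dunkl_kernel_eq by (simp add: borel_prod[symmetric])
qed

end

subsection \<open>Averages over large times\<close>

text \<open>The relation X - Y = O(s) on (0, s0), written as two inequalities because subtraction in
  \<open>ennreal\<close> is truncated.\<close>

definition asymp_eq :: "real \<Rightarrow> (real \<Rightarrow> ennreal) \<Rightarrow> (real \<Rightarrow> ennreal) \<Rightarrow> bool" where
  "asymp_eq s0 X Y \<longleftrightarrow> (\<exists>C\<ge>0. \<forall>s. 0 < s \<and> s < s0 \<longrightarrow>
     X s \<le> Y s + ennreal (C * s) \<and> Y s \<le> X s + ennreal (C * s))"

lemma asymp_eqI:
  assumes "0 \<le> C" "\<And>s. 0 < s \<Longrightarrow> s < s0 \<Longrightarrow> X s \<le> Y s + ennreal (C * s)"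
    "\<And>s. 0 < s \<Longrightarrow> s < s0 \<Longrightarrow> Y s \<le> X s + ennreal (C * s)"
  shows "asymp_eq s0 X Y"
  unfolding asymp_eq_def using assms by blast

lemma asymp_eq_sym: "asymp_eq s0 X Y \<Longrightarrow> asymp_eq s0 Y X"
  unfolding asymp_eq_def by blast

lemma asymp_eq_refl: "(\<And>s. 0 < s \<Longrightarrow> s < s0 \<Longrightarrow> X s = Y s) \<Longrightarrow> asymp_eq s0 X Y"
  by (rule asymp_eqI[of 0]) auto

lemma asymp_eq_trans [trans]:
  assumes "asymp_eq s0 X Y" "asymp_eq s0 Y Z"
  shows "asymp_eq s0 X Z"
proof -
  obtain C D where C: "C \<ge> 0" "\<And>s. 0 < s \<Longrightarrow> s < s0 \<Longrightarrow> X s \<le> Y s + ennreal (C * s) \<and> Y s \<le> X s + ennreal (C * s)"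
    and D: "D \<ge> 0" "\<And>s. 0 < s \<Longrightarrow> s < s0 \<Longrightarrow> Y s \<le> Z s + ennreal (D * s) \<and> Z s \<le> Y s + ennreal (D * s)"
    using assms unfolding asymp_eq_def by meson
  show ?thesis
  proof (rule asymp_eqI)
    show "0 \<le> C + D" using C D by simp
    fix s assume s: "0 < s" "s < s0"
    have eq: "ennreal ((C + D) * s) = ennreal (C * s) + ennreal (D * s)"
      using C(1) D(1) s by (simp add: distrib_right)
    have "X s \<le> (Z s + ennreal (D * s)) + ennreal (C * s)"
      using C(2)[OF s] D(2)[OF s] by (meson add_right_mono order_trans)
    then show "X s \<le> Z s + ennreal ((C + D) * s)" unfolding eq by (simp add: ac_simps)
    have "Z s \<le> (X s + ennreal (C * s)) + ennreal (D * s)"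
      using C(2)[OF s] D(2)[OF s] by (meson add_right_mono order_trans)
    then show "Z s \<le> X s + ennreal ((C + D) * s)" unfolding eq by (simp add: ac_simps)
  qed
qed

lemma asymp_eq_add:
  assumes "asymp_eq s0 X Y" "asymp_eq s0 X' Y'"
  shows "asymp_eq s0 (\<lambda>s. X s + X' s) (\<lambda>s. Y s + Y' s)"
proof -
  obtain C D where C: "C \<ge> 0" "\<And>s. 0 < s \<Longrightarrow> s < s0 \<Longrightarrow> X s \<le> Y s + ennreal (C * s) \<and> Y s \<le> X s + ennreal (C * s)"
    and D: "D \<ge> 0" "\<And>s. 0 < s \<Longrightarrow> s < s0 \<Longrightarrow> X' s \<le> Y' s + ennreal (D * s) \<and> Y' s \<le> X' s + ennreal (D * s)"
    using assms unfolding asymp_eq_def by meson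
  show ?thesis
  proof (rule asymp_eqI)
    show "0 \<le> C + D" using C D by simp
    fix s assume s: "0 < s" "s < s0"
    have eq: "ennreal ((C + D) * s) = ennreal (C * s) + ennreal (D * s)"
      using C(1) D(1) s by (simp add: distrib_right)
    have "X s + X' s \<le> (Y s + ennreal (C * s)) + (Y' s + ennreal (D * s))"
      using C(2)[OF s] D(2)[OF s] by (intro add_mono) auto
    then show "X s + X' s \<le> Y s + Y' s + ennreal ((C + D) * s)" unfolding eq by (simp add: ac_simps)
    have "Y s + Y' s \<le> (X s + ennreal (C * s)) + (X' s + ennreal (D * s))"
      using C(2)[OF s] D(2)[OF s] by (intro add_mono) auto
    then show "Y s + Y' s \<le> X s + X' s + ennreal ((C + D) * s)" unfolding eq by (simp add: ac_simps)
  qed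
qed

lemma asymp_eq_cmult:
  assumes "asymp_eq s0 X Y" "0 \<le> c"
  shows "asymp_eq s0 (\<lambda>s. ennreal c * X s) (\<lambda>s. ennreal c * Y s)"
proof -
  obtain C where C: "C \<ge> 0" "\<And>s. 0 < s \<Longrightarrow> s < s0 \<Longrightarrow> X s \<le> Y s + ennreal (C * s) \<and> Y s \<le> X s + ennreal (C * s)"
    using assms unfolding asymp_eq_def by meson
  show ?thesis
  proof (rule asymp_eqI)
    show "0 \<le> c * C" using C assms by simp
    fix s assume s: "0 < s" "s < s0"
    have eq: "ennreal (c * C * s) = ennreal c * ennreal (C * s)"
      using C(1) assms(2) s by (simp add: ennreal_mult' mult.assoc)
    have "ennreal c * X s \<le> ennreal c * (Y s + ennreal (C * s))"
      "ennreal c * Y s \<le> ennreal c * (X s + ennreal (C * s))"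
      using C(2)[OF s] by (auto intro: mult_left_mono)
    then show "ennreal c * X s \<le> ennreal c * Y s + ennreal (c * C * s)"
      "ennreal c * Y s \<le> ennreal c * X s + ennreal (c * C * s)"
      unfolding eq distrib_left .
  qed
qed

text \<open>The lower bound of the sandwich is a truncated difference, whose limit is taken at a
  finite L; hence the assumption on \<open>top\<close>.\<close>

lemma asymp_eq_tendsto:
  assumes XY: "asymp_eq s0 X Y" and s0: "0 < s0" and Y: "(Y \<longlongrightarrow> L) (at_right 0)" and L: "L \<noteq> top"
  shows "(X \<longlongrightarrow> L) (at_right 0)"
proof -
  obtain C where C: "C \<ge> 0" "\<And>s. 0 < s \<Longrightarrow> s < s0 \<Longrightarrow> X s \<le> Y s + ennreal (C * s) \<and> Y s \<le> X s + ennreal (C * s)"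
    using XY unfolding asymp_eq_def by meson
  have ev: "\<forall>\<^sub>F s in at_right 0. 0 < s \<and> s < s0"
    using eventually_at_right_real[OF s0] by eventually_elim auto
  have "((\<lambda>s. C * s) \<longlongrightarrow> C * 0) (at_right 0)" by (intro tendsto_intros)
  then have z: "((\<lambda>s. ennreal (C * s)) \<longlongrightarrow> 0) (at_right 0)"
    using tendsto_ennrealI by fastforce
  show ?thesis
  proof (rule tendsto_sandwich)
    show "((\<lambda>s. Y s - ennreal (C * s)) \<longlongrightarrow> L) (at_right 0)"
      using tendsto_diff_ennreal[OF Y z L] by simp
    show "((\<lambda>s. Y s + ennreal (C * s)) \<longlongrightarrow> L) (at_right 0)"
      using tendsto_add[OF Y z] by simp
    show "\<forall>\<^sub>F s in at_right 0. X s \<le> Y s + ennreal (C * s)"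
      using ev by eventually_elim (use C in blast)
    show "\<forall>\<^sub>F s in at_right 0. Y s - ennreal (C * s) \<le> X s"
      using ev
    proof eventually_elim
      case (elim s)
      then have "Y s \<le> ennreal (C * s) + X s" using C(2)[of s] by (simp add: add.commute)
      then show ?case by (simp add: ennreal_minus_le_iff)
    qed
  qed
qed

text \<open>The weight \<open>s * t powr (-(1 + s))\<close> has mass 1 on t \<ge> 1 and escapes to
  infinity as s tends to 0.\<close>

definition tail_average :: "real \<Rightarrow> (real \<Rightarrow> ennreal) \<Rightarrow> ennreal" where
  "tail_average s f = ennreal s * (\<integral>\<^sup>+t\<in>{1..}. f t * ennreal (t powr (-(1 + s))) \<partial>lborel)"

lemma tail_average_powr:
  assumes s: "0 < s" and a: "0 \<le> a" and C: "0 \<le> C"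
  shows "tail_average s (\<lambda>t. ennreal (C * t powr (-a))) = ennreal (C * s / (s + a))"
proof -
  have "((\<lambda>t. t powr (-(1 + s + a))) has_integral 1 / (s + a)) {1..}"
  proof -
    have "-(1 + s + a) + 1 = - (s + a)" by simp
    then have "- (1 powr (-(1 + s + a) + 1)) / (-(1 + s + a) + 1) = 1 / (s + a)"
      by (simp only: powr_one_eq_one minus_divide_divide)
    then show ?thesis using has_integral_powr_to_inf[of "-(1 + s + a)" 1] s a by simp
  qed
  then have "((\<lambda>t. C * t powr (-(1 + s + a))) has_integral C * (1 / (s + a))) {1..}"
    by (rule has_integral_mult_right)
  then have "(\<integral>\<^sup>+t. ennreal (C * t powr (-(1 + s + a))) * indicator {1..} t \<partial>lborel) = ennreal (C * (1 / (s + a)))"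
    using C by (intro nn_integral_has_integral_lebesgue') auto
  moreover have "ennreal (C * t powr (-a)) * ennreal (t powr (-(1 + s))) = ennreal (C * t powr (-(1 + s + a)))"
    for t
    using C by (simp add: ennreal_mult'[symmetric] powr_add[symmetric] mult.assoc algebra_simps)
  ultimately show ?thesis
    unfolding tail_average_def using s by (simp add: ennreal_mult'[symmetric] mult.commute)
qed

lemma tail_average_mono:
  assumes "\<And>t. 1 \<le> t \<Longrightarrow> f t \<le> g t"
  shows "tail_average s f \<le> tail_average s g"
  unfolding tail_average_def using assms
  by (intro mult_left_mono nn_integral_mono) (auto simp: indicator_def intro: mult_right_mono)

lemma tail_average_cong:
  assumes "\<And>t. 1 \<le> t \<Longrightarrow> f t = g t"
  shows "tail_average s f = tail_average s g"
  using assms by (intro antisym tail_average_mono) auto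

lemma tail_average_one:
  assumes "0 < s"
  shows "tail_average s (\<lambda>t. 1) = 1"
proof -
  have "tail_average s (\<lambda>t. 1) = tail_average s (\<lambda>t. ennreal (1 * t powr (- 0)))"
    by (rule tail_average_cong) simp
  also have "\<dots> = 1" using assms by (subst tail_average_powr) auto
  finally show ?thesis .
qed

lemma tail_average_add:
  assumes [measurable]: "f \<in> borel_measurable borel" "g \<in> borel_measurable borel"
  shows "tail_average s (\<lambda>t. f t + g t) = tail_average s f + tail_average s g"
  unfolding tail_average_def by (simp add: distrib_right distrib_left nn_integral_add)

lemma tail_average_cmult:
  assumes [measurable]: "f \<in> borel_measurable borel"
  shows "tail_average s (\<lambda>t. c * f t) = c * tail_average s f"
  unfolding tail_average_def
  by (simp add: mult.assoc nn_integral_cmult mult.left_commute[of "ennreal s"])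

text \<open>The average of t^(-1/2) is s / (s + 1/2) \<le> 2 s, whence the constant 2 * C.\<close>

lemma tail_average_asymp:
  assumes [measurable]: "f \<in> borel_measurable borel" "g \<in> borel_measurable borel"
    and C: "0 \<le> C" and fg: "\<And>t. 1 \<le> t \<Longrightarrow> f t \<le> g t + ennreal (C * t powr (-1/2))"
    and gf: "\<And>t. 1 \<le> t \<Longrightarrow> g t \<le> f t + ennreal (C * t powr (-1/2))"
  shows "asymp_eq s0 (\<lambda>s. tail_average s f) (\<lambda>s. tail_average s g)"
proof (rule asymp_eqI)
  show "0 \<le> 2 * C" using C by simp
  fix s :: real assume s: "0 < s"
  have "tail_average s (\<lambda>t. ennreal (C * t powr (-(1/2)))) = ennreal (C * s / (s + 1/2))"
    using s C by (intro tail_average_powr) auto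
  also have "\<dots> \<le> ennreal (2 * C * s)"
  proof (rule ennreal_leI)
    have "C * s / (s + 1/2) \<le> C * s / (1/2)" using s C by (intro divide_left_mono) auto
    then show "C * s / (s + 1/2) \<le> 2 * C * s" by simp
  qed
  finally have e: "tail_average s (\<lambda>t. ennreal (C * t powr (-1/2))) \<le> ennreal (2 * C * s)" by simp
  have "tail_average s f \<le> tail_average s (\<lambda>t. g t + ennreal (C * t powr (-1/2)))"
    by (rule tail_average_mono[OF fg])
  also have "\<dots> \<le> tail_average s g + ennreal (2 * C * s)"
    using e by (simp add: tail_average_add add_left_mono)
  finally show "tail_average s f \<le> tail_average s g + ennreal (2 * C * s)" .
  have "tail_average s g \<le> tail_average s (\<lambda>t. f t + ennreal (C * t powr (-1/2)))"
    by (rule tail_average_mono[OF gf])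
  also have "\<dots> \<le> tail_average s f + ennreal (2 * C * s)"
    using e by (simp add: tail_average_add add_left_mono)
  finally show "tail_average s g \<le> tail_average s f + ennreal (2 * C * s)" .
qed

section \<open>Gaussian averages and nonlocal interactions\<close>

context dunkl_setting
begin

lemma emeasure_dunkl_bounded:
  assumes A: "A \<in> sets lebesgue" "bounded A"
  shows "emeasure (dunkl_measure Rp \<kappa>) A < \<infinity>"
proof -
  obtain r where "\<And>x. x \<in> A \<Longrightarrow> norm x \<le> r" using A(2) unfolding bounded_iff by metis
  then have r: "A \<subseteq> cball 0 r" by auto
  obtain b where b: "b \<ge> 0" "\<And>x. dunkl_weight Rp \<kappa> x \<le> exp (b * norm x)"
    using weight_le by blast
  have "emeasure (dunkl_measure Rp \<kappa>) A = (\<integral>\<^sup>+x. ennreal (dunkl_weight Rp \<kappa> x) * indicator A x \<partial>lebesgue)"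
    unfolding dunkl_measure_def using A by (intro emeasure_density) auto
  also have "\<dots> \<le> (\<integral>\<^sup>+(x::'a). ennreal (exp (b * r)) * indicator (cball 0 r) x \<partial>lebesgue)"
  proof (intro nn_integral_mono)
    fix x :: 'a
    show "ennreal (dunkl_weight Rp \<kappa> x) * indicator A x \<le> ennreal (exp (b * r)) * indicator (cball 0 r) x"
    proof (cases "x \<in> A")
      case True
      then have "norm x \<le> r" using r by auto
      then have "dunkl_weight Rp \<kappa> x \<le> exp (b * r)"
        using b(2)[of x] mult_left_mono[OF _ b(1), of "norm x" r] by (meson exp_le_cancel_iff order_trans)
      then show ?thesis using True r by (auto simp: indicator_def ennreal_leI)
    qed simp
  qed
  also have "\<dots> = ennreal (exp (b * r)) * emeasure lborel (cball (0::'a) r)"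
    by (subst nn_integral_cmult_indicator) auto
  also have "\<dots> < \<infinity>"
    using emeasure_lborel_cball_finite[of "0::'a" r] by (simp add: ennreal_mult_less_top)
  finally show ?thesis .
qed

sublocale mu: sigma_finite_measure "dunkl_measure Rp \<kappa>"
proof
  let ?A = "range (\<lambda>n::nat. ball (0::'a) (real n))"
  have "(\<Union>n. ball (0::'a) (real n)) = UNIV"
    using reals_Archimedean2 by auto
  moreover have "emeasure (dunkl_measure Rp \<kappa>) (ball 0 (real n)) \<noteq> \<infinity>" for n
    using emeasure_dunkl_bounded[of "ball 0 (real n)"] by simp
  ultimately show "\<exists>A. countable A \<and> A \<subseteq> sets (dunkl_measure Rp \<kappa>) \<and> \<Union> A = space (dunkl_measure Rp \<kappa>)
      \<and> (\<forall>a\<in>A. emeasure (dunkl_measure Rp \<kappa>) a \<noteq> \<infinity>)"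
    by (intro exI[of _ ?A]) auto
qed

sublocale mu2: pair_sigma_finite "dunkl_measure Rp \<kappa>" "dunkl_measure Rp \<kappa>" ..

definition gauss_mass :: "'a set \<Rightarrow> real \<Rightarrow> ennreal" where
  "gauss_mass F t = (\<integral>\<^sup>+y\<in>F. ennreal (gauss_kernel t y) \<partial>dunkl_measure Rp \<kappa>)"

text \<open>This is \<Phi>_F(s) of the overview.\<close>

definition gauss_average :: "'a set \<Rightarrow> real \<Rightarrow> ennreal" where
  "gauss_average F s = tail_average s (gauss_mass F)"

text \<open>The kernel is a parameter so that the heat kernel and its transpose share all
  estimates.\<close>

definition interaction :: "(real \<Rightarrow> 'a \<Rightarrow> 'a \<Rightarrow> real) \<Rightarrow> 'a set \<Rightarrow> 'a set \<Rightarrow> real \<Rightarrow> ennreal" where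
  "interaction q A B t = (\<integral>\<^sup>+x\<in>A. (\<integral>\<^sup>+y\<in>B. ennreal (q t x y) \<partial>dunkl_measure Rp \<kappa>) \<partial>dunkl_measure Rp \<kappa>)"

definition kernel_measurable :: "(real \<Rightarrow> 'a \<Rightarrow> 'a \<Rightarrow> real) \<Rightarrow> bool" where
  "kernel_measurable q \<longleftrightarrow> (\<lambda>z. q (fst z) (fst (snd z)) (snd (snd z))) \<in> borel_measurable borel"

lemma measurable_dunkl_ident [measurable]: "(\<lambda>x. x) \<in> measurable (dunkl_measure Rp \<kappa>) borel"
  by (rule measurable_dunkl_borel) simp

lemma kernel_measurable_comp:
  assumes "kernel_measurable q" "f \<in> borel_measurable M" "g \<in> measurable M borel" "h \<in> measurable M borel"
  shows "(\<lambda>z. q (f z) (g z) (h z)) \<in> borel_measurable M"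
  using measurable_compose[OF borel_measurable_Pair[OF assms(2) borel_measurable_Pair[OF assms(3,4)]]
      assms(1)[unfolded kernel_measurable_def]] by simp

lemma gauss_kernel_measurable [measurable (raw)]:
  assumes [measurable]: "f \<in> borel_measurable M" "g \<in> measurable M borel"
  shows "(\<lambda>z. gauss_kernel (f z) (g z)) \<in> borel_measurable M"
  unfolding gauss_kernel_def heat_norm_def by measurable

lemma gauss_mass_measurable [measurable]:
  assumes [measurable]: "F \<in> sets lebesgue"
  shows "gauss_mass F \<in> borel_measurable borel"
  unfolding gauss_mass_def[abs_def] by measurable

lemma inner_measurable:
  assumes q: "kernel_measurable q" and [measurable]: "B \<in> sets lebesgue"
    and [measurable]: "f \<in> borel_measurable M" "g \<in> measurable M borel"
  shows "(\<lambda>z. \<integral>\<^sup>+y\<in>B. ennreal (q (f z) (g z) y) \<partial>dunkl_measure Rp \<kappa>) \<in> borel_measurable M"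
proof -
  have [measurable]: "(\<lambda>(z, y). q (f z) (g z) y) \<in> borel_measurable (M \<Otimes>\<^sub>M dunkl_measure Rp \<kappa>)"
    unfolding case_prod_beta by (rule kernel_measurable_comp[OF q]) measurable
  show ?thesis by measurable
qed

lemma interaction_measurable:
  assumes q: "kernel_measurable q" and [measurable]: "A \<in> sets lebesgue" "B \<in> sets lebesgue"
  shows "interaction q A B \<in> borel_measurable borel"
proof -
  have [measurable]: "(\<lambda>(t, x). \<integral>\<^sup>+y\<in>B. ennreal (q t x y) \<partial>dunkl_measure Rp \<kappa>)
      \<in> borel_measurable (borel \<Otimes>\<^sub>M dunkl_measure Rp \<kappa>)"
    unfolding case_prod_beta by (rule inner_measurable[OF q]) measurable
  show ?thesis unfolding interaction_def[abs_def] by measurable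
qed

text \<open>By Tonelli, a bounded set in the second slot becomes a bounded set in the first slot of
  the transposed kernel, where \<open>tail_average_interaction\<close> applies.\<close>

lemma interaction_swap:
  assumes q: "kernel_measurable q" and [measurable]: "A \<in> sets lebesgue" "B \<in> sets lebesgue"
  shows "interaction q B A t = interaction (\<lambda>t x y. q t y x) A B t"
proof -
  let ?\<mu> = "dunkl_measure Rp \<kappa>"
  have [measurable]: "(\<lambda>(x, y). q t x y) \<in> borel_measurable (?\<mu> \<Otimes>\<^sub>M ?\<mu>)"
    unfolding case_prod_beta by (rule kernel_measurable_comp[OF q]) measurable
  have qx [measurable]: "(\<lambda>y. q t x y) \<in> borel_measurable ?\<mu>" "(\<lambda>y. q t y x) \<in> borel_measurable ?\<mu>" for x
    by (rule kernel_measurable_comp[OF q]; measurable)+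
  have "interaction q B A t = (\<integral>\<^sup>+x. (\<integral>\<^sup>+y. ennreal (q t x y) * indicator A y * indicator B x \<partial>?\<mu>) \<partial>?\<mu>)"
    unfolding interaction_def by (intro nn_integral_cong nn_integral_multc[symmetric]) measurable
  also have "\<dots> = (\<integral>\<^sup>+y. (\<integral>\<^sup>+x. ennreal (q t x y) * indicator A y * indicator B x \<partial>?\<mu>) \<partial>?\<mu>)"
    by (rule mu2.Fubini') measurable
  also have "\<dots> = (\<integral>\<^sup>+y. (\<integral>\<^sup>+x. ennreal (q t x y) * indicator B x * indicator A y \<partial>?\<mu>) \<partial>?\<mu>)"
    by (simp add: mult_ac)
  also have "\<dots> = interaction (\<lambda>t x y. q t y x) A B t"
    unfolding interaction_def by (intro nn_integral_cong nn_integral_multc) measurable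
  finally show ?thesis .
qed

definition gauss_bound :: "real \<Rightarrow> real \<Rightarrow> bool" where
  "gauss_bound r C \<longleftrightarrow> (\<forall>t f F. 1 \<le> t \<longrightarrow> f \<in> borel_measurable borel \<longrightarrow> F \<in> sets lebesgue \<longrightarrow>
      (\<forall>y. \<bar>f y - gauss_kernel t y\<bar> \<le> kernel_error r t y) \<longrightarrow>
      (\<integral>\<^sup>+y\<in>F. ennreal (f y) \<partial>dunkl_measure Rp \<kappa>) \<le> gauss_mass F t + ennreal (C * t powr (-1/2))
       \<and> gauss_mass F t \<le> (\<integral>\<^sup>+y\<in>F. ennreal (f y) \<partial>dunkl_measure Rp \<kappa>) + ennreal (C * t powr (-1/2)))"

lemma gauss_boundD:
  assumes "gauss_bound r C" "1 \<le> t" "f \<in> borel_measurable borel" "F \<in> sets lebesgue"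
    "\<And>y. \<bar>f y - gauss_kernel t y\<bar> \<le> kernel_error r t y"
  shows "(\<integral>\<^sup>+y\<in>F. ennreal (f y) \<partial>dunkl_measure Rp \<kappa>) \<le> gauss_mass F t + ennreal (C * t powr (-1/2))"
    and "gauss_mass F t \<le> (\<integral>\<^sup>+y\<in>F. ennreal (f y) \<partial>dunkl_measure Rp \<kappa>) + ennreal (C * t powr (-1/2))"
  using assms unfolding gauss_bound_def by simp_all

lemma gauss_bound_exists:
  assumes r: "r \<ge> 0"
  shows "\<exists>C\<ge>0. gauss_bound r C"
proof -
  let ?\<mu> = "dunkl_measure Rp \<kappa>"
  obtain C where C: "C \<ge> 0" "\<And>t. t > 0 \<Longrightarrow> (\<integral>\<^sup>+y. ennreal (kernel_error r t y) \<partial>?\<mu>) \<le> ennreal (C * t powr (-1/2))"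
    using kernel_error_mass[OF r] by blast
  show ?thesis unfolding gauss_bound_def
  proof (intro exI[of _ C] conjI[OF C(1)] allI impI)
    fix t :: real and f :: "'a \<Rightarrow> real" and F :: "'a set"
    assume t: "1 \<le> t" and f: "f \<in> borel_measurable borel" and F[measurable]: "F \<in> sets lebesgue"
      and near: "\<forall>y. \<bar>f y - gauss_kernel t y\<bar> \<le> kernel_error r t y"
    have [measurable]: "f \<in> borel_measurable ?\<mu>" "gauss_kernel t \<in> borel_measurable ?\<mu>" "kernel_error r t \<in> borel_measurable ?\<mu>"
      using f by (auto intro!: measurable_dunkl_borel simp: kernel_error_def[abs_def])
    have e0: "0 \<le> kernel_error r t y" for y using r t by (intro kernel_error_nonneg) auto
    have mass: "(\<integral>\<^sup>+y. ennreal (kernel_error r t y) \<partial>?\<mu>) \<le> ennreal (C * t powr (-1/2))" using C(2) t by simp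
    have step: "(\<integral>\<^sup>+y\<in>F. ennreal (u y) \<partial>?\<mu>) \<le> (\<integral>\<^sup>+y\<in>F. ennreal (v y) \<partial>?\<mu>) + ennreal (C * t powr (-1/2))"
      if uv: "\<And>y. u y \<le> v y + kernel_error r t y" and [measurable]: "v \<in> borel_measurable ?\<mu>" for u v
    proof -
      have "(\<integral>\<^sup>+y\<in>F. ennreal (u y) \<partial>?\<mu>) \<le> (\<integral>\<^sup>+y. ennreal (v y) * indicator F y + ennreal (kernel_error r t y) \<partial>?\<mu>)"
      proof (intro nn_integral_mono)
        fix y
        \<comment> \<open>\<open>ennreal\<close> clips negative values. The comparison survives
          because the error is nonnegative: u \<le> v + e implies u \<le> max 0 v + e.\<close>
        have "ennreal (u y) \<le> ennreal (max 0 (v y) + kernel_error r t y)"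
          using uv[of y] by (intro ennreal_leI) linarith
        also have "\<dots> = ennreal (v y) + ennreal (kernel_error r t y)"
          using e0[of y] by (simp add: max_def ennreal_neg)
        finally show "ennreal (u y) * indicator F y \<le> ennreal (v y) * indicator F y + ennreal (kernel_error r t y)"
          by (simp add: indicator_def)
      qed
      also have "\<dots> = (\<integral>\<^sup>+y\<in>F. ennreal (v y) \<partial>?\<mu>) + (\<integral>\<^sup>+y. ennreal (kernel_error r t y) \<partial>?\<mu>)"
        by (intro nn_integral_add) measurable
      finally show ?thesis using mass by (meson add_left_mono order_trans)
    qed
    have "f y \<le> gauss_kernel t y + kernel_error r t y" "gauss_kernel t y \<le> f y + kernel_error r t y" for y
      using near[rule_format, of y] by linarith+
    then show "(\<integral>\<^sup>+y\<in>F. ennreal (f y) \<partial>?\<mu>) \<le> gauss_mass F t + ennreal (C * t powr (-1/2))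
       \<and> gauss_mass F t \<le> (\<integral>\<^sup>+y\<in>F. ennreal (f y) \<partial>?\<mu>) + ennreal (C * t powr (-1/2))"
      unfolding gauss_mass_def by (intro conjI step) measurable
  qed
qed

lemma gauss_mass_Un:
  assumes [measurable]: "F \<in> sets lebesgue" "F' \<in> sets lebesgue" and "F \<inter> F' = {}"
  shows "gauss_mass (F \<union> F') t = gauss_mass F t + gauss_mass F' t"
proof -
  have "gauss_mass (F \<union> F') t = (\<integral>\<^sup>+y. ennreal (gauss_kernel t y) * indicator F y + ennreal (gauss_kernel t y) * indicator F' y \<partial>dunkl_measure Rp \<kappa>)"
    unfolding gauss_mass_def using assms(3) by (intro nn_integral_cong) (auto simp: indicator_def)
  also have "\<dots> = gauss_mass F t + gauss_mass F' t"
    unfolding gauss_mass_def by (intro nn_integral_add) measurable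
  finally show ?thesis .
qed

lemma gauss_average_Un:
  assumes "F \<in> sets lebesgue" "F' \<in> sets lebesgue" "F \<inter> F' = {}"
  shows "gauss_average (F \<union> F') s = gauss_average F s + gauss_average F' s"
proof -
  have "gauss_mass (F \<union> F') = (\<lambda>t. gauss_mass F t + gauss_mass F' t)"
    using assms by (intro ext gauss_mass_Un)
  then show ?thesis using assms by (simp add: gauss_average_def tail_average_add gauss_mass_measurable)
qed

lemma gauss_average_compl:
  assumes "F \<in> sets lebesgue" "0 < s"
  shows "gauss_average F s + gauss_average (- F) s = 1"
proof -
  have "gauss_average F s + gauss_average (- F) s = gauss_average UNIV s"
    using assms gauss_average_Un[of F "-F"] by (simp add: Compl_in_sets_lebesgue)
  also have "\<dots> = tail_average s (\<lambda>t. 1)"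
    unfolding gauss_average_def by (rule tail_average_cong) (simp add: gauss_mass_def gauss_kernel_mass)
  finally show ?thesis using assms by (simp add: tail_average_one)
qed

text \<open>The Gaussian is pointwise O(t^(-1/2)), and a bounded set has finite measure, so its mass
  under the Gaussian decays at that rate.\<close>

lemma gauss_average_bounded:
  assumes F: "F \<in> sets lebesgue" "bounded F"
  shows "asymp_eq s0 (gauss_average F) (\<lambda>s. 0)"
proof -
  let ?m = "measure (dunkl_measure Rp \<kappa>) F"
  have m: "emeasure (dunkl_measure Rp \<kappa>) F = ennreal ?m"
    using emeasure_dunkl_bounded[OF F] by (intro emeasure_eq_ennreal_measure) simp
  have "asymp_eq s0 (\<lambda>s. tail_average s (gauss_mass F)) (\<lambda>s. tail_average s (\<lambda>t. 0))"
  proof (rule tail_average_asymp)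
    show "gauss_mass F \<in> borel_measurable borel" using F by measurable
    show "0 \<le> ?m / dunkl_const Rp \<kappa>" using dunkl_const_pos by simp
    fix t :: real assume t: "1 \<le> t"
    have "gauss_mass F t \<le> (\<integral>\<^sup>+y\<in>F. ennreal (t powr (-1/2) / dunkl_const Rp \<kappa>) \<partial>dunkl_measure Rp \<kappa>)"
      unfolding gauss_mass_def using gauss_kernel_le[OF t]
      by (intro nn_integral_mono mult_right_mono ennreal_leI) auto
    also have "\<dots> = ennreal (t powr (-1/2) / dunkl_const Rp \<kappa>) * ennreal ?m"
      using F by (simp add: nn_integral_cmult_indicator m)
    also have "\<dots> = ennreal (?m / dunkl_const Rp \<kappa> * t powr (-1/2))"
      by (simp add: ennreal_mult'[symmetric] mult.commute)
    finally show "gauss_mass F t \<le> 0 + ennreal (?m / dunkl_const Rp \<kappa> * t powr (-1/2))" by simp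
  qed simp_all
  then show ?thesis by (simp add: gauss_average_def[abs_def] tail_average_def)
qed

text \<open>One radius r serves all x in the bounded set A. Integrating the uniform bound over A
  multiplies both the Gaussian mass and the error by the measure of A.\<close>

lemma tail_average_interaction:
  assumes q: "kernel_measurable q" and A: "A \<in> sets lebesgue" "bounded A" and F: "F \<in> sets lebesgue"
    and near: "\<And>r t x y. 1 \<le> t \<Longrightarrow> norm x \<le> r \<Longrightarrow> \<bar>q t x y - gauss_kernel t y\<bar> \<le> kernel_error r t y"
  shows "asymp_eq s0 (\<lambda>s. tail_average s (interaction q A F))
    (\<lambda>s. ennreal (measure (dunkl_measure Rp \<kappa>) A) * gauss_average F s)"
proof -
  let ?\<mu> = "dunkl_measure Rp \<kappa>"
  let ?m = "measure ?\<mu> A"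
  have m: "emeasure ?\<mu> A = ennreal ?m"
    using emeasure_dunkl_bounded[OF A] by (intro emeasure_eq_ennreal_measure) simp
  obtain r where r: "r > 0" "\<And>x. x \<in> A \<Longrightarrow> norm x \<le> r"
    using A(2) unfolding bounded_pos by metis
  obtain C where C: "C \<ge> 0" "gauss_bound r C"
    using gauss_bound_exists[of r] r(1) by auto
  note [measurable] = A(1) F
  have const: "(\<integral>\<^sup>+x\<in>A. c \<partial>?\<mu>) = c * ennreal ?m" for c
    by (simp add: nn_integral_cmult_indicator m)
  have "asymp_eq s0 (\<lambda>s. tail_average s (interaction q A F)) (\<lambda>s. tail_average s (\<lambda>t. ennreal ?m * gauss_mass F t))"
  proof (rule tail_average_asymp)
    show "interaction q A F \<in> borel_measurable borel" by (rule interaction_measurable[OF q A(1) F])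
    show "(\<lambda>t. ennreal ?m * gauss_mass F t) \<in> borel_measurable borel" by measurable
    show "0 \<le> C * ?m" using C by simp
    fix t :: real assume t: "1 \<le> t"
    have [measurable]: "(\<lambda>x. \<integral>\<^sup>+y\<in>F. ennreal (q t x y) \<partial>?\<mu>) \<in> borel_measurable ?\<mu>"
      by (rule inner_measurable[OF q]) measurable
    have kernel_measurable: "(\<lambda>y. q t x y) \<in> borel_measurable borel" for x
      by (rule kernel_measurable_comp[OF q]) auto
    have n: "(\<integral>\<^sup>+y\<in>F. ennreal (q t x y) \<partial>?\<mu>) \<le> gauss_mass F t + ennreal (C * t powr (-1/2))"
      "gauss_mass F t \<le> (\<integral>\<^sup>+y\<in>F. ennreal (q t x y) \<partial>?\<mu>) + ennreal (C * t powr (-1/2))" if "x \<in> A" for x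
      by (rule gauss_boundD[OF C(2) t kernel_measurable F near[OF t r(2)[OF that]]])+
    have E: "ennreal (C * t powr (-1/2)) * ennreal ?m = ennreal (C * ?m * t powr (-1/2))"
      using C(1) by (simp add: ennreal_mult'[symmetric] mult_ac)
    have "interaction q A F t \<le> (\<integral>\<^sup>+x\<in>A. (gauss_mass F t + ennreal (C * t powr (-1/2))) \<partial>?\<mu>)"
      unfolding interaction_def using n(1) by (intro nn_integral_mono) (auto simp: indicator_def)
    also have "\<dots> = gauss_mass F t * ennreal ?m + ennreal (C * ?m * t powr (-1/2))"
      unfolding const by (simp only: distrib_right E)
    finally show "interaction q A F t \<le> ennreal ?m * gauss_mass F t + ennreal (C * ?m * t powr (-1/2))"
      by (simp only: mult.commute[of "gauss_mass F t"])
    have "(\<integral>\<^sup>+x\<in>A. gauss_mass F t \<partial>?\<mu>)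
      \<le> (\<integral>\<^sup>+x. (\<integral>\<^sup>+y\<in>F. ennreal (q t x y) \<partial>?\<mu>) * indicator A x + ennreal (C * t powr (-1/2)) * indicator A x \<partial>?\<mu>)"
      using n(2) by (intro nn_integral_mono) (auto simp: indicator_def)
    also have "\<dots> = interaction q A F t + (\<integral>\<^sup>+x\<in>A. ennreal (C * t powr (-1/2)) \<partial>?\<mu>)"
      unfolding interaction_def by (intro nn_integral_add) measurable
    finally show "ennreal ?m * gauss_mass F t \<le> interaction q A F t + ennreal (C * ?m * t powr (-1/2))"
      unfolding const E by (simp only: mult.commute[of "gauss_mass F t"])
  qed
  then show ?thesis by (simp add: tail_average_cmult gauss_average_def)
qed

lemma kernel_measurable_heat: "kernel_measurable (dunkl_heat_kernel Rp \<kappa>)"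
  unfolding kernel_measurable_def by (rule heat_kernel_measurable)

lemma kernel_measurable_swap: "kernel_measurable q \<Longrightarrow> kernel_measurable (\<lambda>t x y. q t y x)"
  unfolding kernel_measurable_def
  by (rule kernel_measurable_comp[of q, unfolded kernel_measurable_def]) (simp_all add: borel_prod[symmetric])

text \<open>The finiteness at \<open>s0\<close> makes the contribution of small times negligible.\<close>

lemma L_s_asymp:
  assumes fin: "L_s Rp \<kappa> s0 A B < \<infinity>" and A: "A \<in> sets lebesgue" and B: "B \<in> sets lebesgue"
  shows "asymp_eq s0 (\<lambda>s. ennreal s * L_s Rp \<kappa> s A B) (\<lambda>s. tail_average s (interaction (dunkl_heat_kernel Rp \<kappa>) A B))"
proof -
  let ?J = "interaction (dunkl_heat_kernel Rp \<kappa>) A B"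
  have [measurable]: "?J \<in> borel_measurable borel" by (rule interaction_measurable[OF kernel_measurable_heat A B])
  have L: "L_s Rp \<kappa> s A B = (\<integral>\<^sup>+t\<in>{0<..}. ennreal (t powr (-(1 + s))) * ?J t \<partial>lborel)" for s
    by (simp add: L_s_def interaction_def heat_ind_def)
  have T: "tail_average s ?J = ennreal s * (\<integral>\<^sup>+t\<in>{1..}. ennreal (t powr (-(1 + s))) * ?J t \<partial>lborel)" for s
    by (simp add: tail_average_def mult.commute)
  show ?thesis
  proof (rule asymp_eqI)
    show "0 \<le> enn2real (L_s Rp \<kappa> s0 A B)" by simp
    fix s assume s: "0 < s" "s < s0"
    let ?f = "\<lambda>t. ennreal (t powr (-(1 + s))) * ?J t"
    have "L_s Rp \<kappa> s A B = (\<integral>\<^sup>+t. ?f t * indicator {0<..<1} t + ?f t * indicator {1..} t \<partial>lborel)"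
      unfolding L by (intro nn_integral_cong) (auto simp: indicator_def)
    also have "\<dots> = (\<integral>\<^sup>+t\<in>{0<..<1}. ?f t \<partial>lborel) + (\<integral>\<^sup>+t\<in>{1..}. ?f t \<partial>lborel)"
      by (intro nn_integral_add) measurable
    \<comment> \<open>For 0 < t < 1 and s < s0 the power t^(-(1+s)) is at most t^(-(1+s0)), so the
      small-time part is bounded by the finite value at s0, uniformly in s.\<close>
    also have "(\<integral>\<^sup>+t\<in>{0<..<1}. ?f t \<partial>lborel) \<le> L_s Rp \<kappa> s0 A B"
      unfolding L
    proof (intro nn_integral_mono)
      fix t :: real
      show "?f t * indicator {0<..<1} t \<le> ennreal (t powr (-(1 + s0))) * ?J t * indicator {0<..} t"
        using s by (auto simp: indicator_def intro!: mult_right_mono ennreal_leI powr_mono')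
    qed
    finally have "ennreal s * L_s Rp \<kappa> s A B \<le> ennreal s * (L_s Rp \<kappa> s0 A B + (\<integral>\<^sup>+t\<in>{1..}. ?f t \<partial>lborel))"
      by (simp add: mult_left_mono)
    also have "\<dots> = tail_average s ?J + ennreal (enn2real (L_s Rp \<kappa> s0 A B) * s)"
      using fin s by (simp add: T distrib_left ennreal_mult' add.commute mult.commute)
    finally show "ennreal s * L_s Rp \<kappa> s A B \<le> tail_average s ?J + ennreal (enn2real (L_s Rp \<kappa> s0 A B) * s)" .
    have "(\<integral>\<^sup>+t\<in>{1..}. ?f t \<partial>lborel) \<le> L_s Rp \<kappa> s A B"
      unfolding L by (intro nn_integral_mono) (auto simp: indicator_def)
    then have "tail_average s ?J \<le> ennreal s * L_s Rp \<kappa> s A B"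
      unfolding T by (rule mult_left_mono) simp
    then show "tail_average s ?J \<le> ennreal s * L_s Rp \<kappa> s A B + ennreal (enn2real (L_s Rp \<kappa> s0 A B) * s)"
      by (rule order_trans) simp
  qed
qed

text \<open>The second form serves the part of the perimeter in which only the second set is
  bounded.\<close>

lemma L_s_asymp_gauss_average:
  assumes A: "A \<in> sets lebesgue" "bounded A" and F: "F \<in> sets lebesgue"
  shows "L_s Rp \<kappa> s0 A F < \<infinity> \<Longrightarrow> asymp_eq s0 (\<lambda>s. ennreal s * L_s Rp \<kappa> s A F)
      (\<lambda>s. ennreal (measure (dunkl_measure Rp \<kappa>) A) * gauss_average F s)"
    and "L_s Rp \<kappa> s0 F A < \<infinity> \<Longrightarrow> asymp_eq s0 (\<lambda>s. ennreal s * L_s Rp \<kappa> s F A)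
      (\<lambda>s. ennreal (measure (dunkl_measure Rp \<kappa>) A) * gauss_average F s)"
proof -
  assume "L_s Rp \<kappa> s0 A F < \<infinity>"
  then show "asymp_eq s0 (\<lambda>s. ennreal s * L_s Rp \<kappa> s A F)
      (\<lambda>s. ennreal (measure (dunkl_measure Rp \<kappa>) A) * gauss_average F s)"
    using asymp_eq_trans[OF L_s_asymp[OF _ A(1) F] tail_average_interaction[OF kernel_measurable_heat A F heat_kernel_near(1)]] by blast
next
  assume fin: "L_s Rp \<kappa> s0 F A < \<infinity>"
  have "interaction (dunkl_heat_kernel Rp \<kappa>) F A = interaction (\<lambda>t x y. dunkl_heat_kernel Rp \<kappa> t y x) A F"
    by (intro ext interaction_swap kernel_measurable_heat A F)
  with L_s_asymp[OF fin F A(1)] tail_average_interaction[OF kernel_measurable_swap[OF kernel_measurable_heat] A F heat_kernel_near(2)]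
  show "asymp_eq s0 (\<lambda>s. ennreal s * L_s Rp \<kappa> s F A)
      (\<lambda>s. ennreal (measure (dunkl_measure Rp \<kappa>) A) * gauss_average F s)"
    using asymp_eq_trans by simp
qed

section \<open>Independence of (x, r) and the limit Xi\<close>

lemma ball_G_eq: "ball_G R x r = (\<Union>g\<in>refl_group R. {y. norm (x - g y) < r})"
proof -
  have "bdd_below ((\<lambda>g. norm (x - g y)) ` refl_group R)" for y
    by (rule bdd_belowI[of _ 0]) auto
  moreover have "refl_group R \<noteq> {}" using refl_group.id_in by blast
  ultimately show ?thesis by (auto simp: ball_G_def dist_G_def cINF_less_iff)
qed

lemma ball_G_lebesgue: "ball_G R x r \<in> sets lebesgue"
proof -
  have "open {y. norm (x - g y) < r}" if "g \<in> refl_group R" for g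
    using refl_group_linear[OF that]
    by (intro open_Collect_less continuous_intros linear_continuous_on) (simp_all add: linear_conv_bounded_linear)
  then have "open (ball_G R x r)" unfolding ball_G_eq by blast
  then show ?thesis by simp
qed

lemma bounded_ball_G: "bounded (ball_G R x r)"
proof (rule boundedI)
  fix y assume "y \<in> ball_G R x r"
  then obtain g where g: "g \<in> refl_group R" "norm (x - g y) < r" unfolding ball_G_eq by blast
  have "norm (g y) \<le> norm x + norm (x - g y)" using norm_triangle_ineq4[of x "x - g y"] by simp
  then show "norm y \<le> norm x + r" using g refl_group_norm[OF g(1), of y] by simp
qed

text \<open>Freezing x costs O(s) by \<open>gauss_bound\<close>, and putting the bounded pseudo-ball
  back costs O(s) by \<open>gauss_average_bounded\<close>. As (x, r) is absent from the right side,
  all pairs have the same limiting behaviour.\<close>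

lemma Lambda_asymp:
  assumes E: "E \<in> sets lebesgue"
  shows "asymp_eq s0 (\<lambda>s. ennreal s * Lambda R Rp \<kappa> E x r s) (gauss_average E)"
proof -
  let ?B = "ball_G R x r"
  let ?F = "E \<inter> - ?B"
  have F: "?F \<in> sets lebesgue" and FB: "E \<inter> ?B \<in> sets lebesgue"
    using E ball_G_lebesgue by (auto simp: Compl_in_sets_lebesgue)
  obtain C where C: "C \<ge> 0" "gauss_bound (norm x) C"
    using gauss_bound_exists[of "norm x"] by auto
  have meas: "(\<lambda>y. dunkl_heat_kernel Rp \<kappa> t x y) \<in> borel_measurable borel" for t
    by (rule kernel_measurable_comp[OF kernel_measurable_heat]) auto
  have n: "heat_ind Rp \<kappa> t ?F x \<le> gauss_mass ?F t + ennreal (C * t powr (-1/2))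
     \<and> gauss_mass ?F t \<le> heat_ind Rp \<kappa> t ?F x + ennreal (C * t powr (-1/2))" if t: "1 \<le> t" for t
    unfolding heat_ind_def
    by (intro conjI gauss_boundD[OF C(2) t meas F heat_kernel_near(1)[OF t order_refl]])
  have "asymp_eq s0 (\<lambda>s. tail_average s (\<lambda>t. heat_ind Rp \<kappa> t ?F x)) (\<lambda>s. tail_average s (gauss_mass ?F))"
  proof (rule tail_average_asymp)
    show "(\<lambda>t. heat_ind Rp \<kappa> t ?F x) \<in> borel_measurable borel"
      unfolding heat_ind_def by (rule inner_measurable[OF kernel_measurable_heat F]) auto
  qed (use F C n in auto)
  then have "asymp_eq s0 (\<lambda>s. ennreal s * Lambda R Rp \<kappa> E x r s) (gauss_average ?F)"
    by (simp add: Lambda_def tail_average_def gauss_average_def[abs_def])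
  \<comment> \<open>The summand 0 is a placeholder that \<open>asymp_eq_add\<close> then exchanges
    for the average over the bounded part.\<close>
  also have "asymp_eq s0 (gauss_average ?F) (\<lambda>s. gauss_average ?F s + 0)"
    by (rule asymp_eq_refl) simp
  also have "asymp_eq s0 (\<lambda>s. gauss_average ?F s + 0) (\<lambda>s. gauss_average ?F s + gauss_average (E \<inter> ?B) s)"
    using FB bounded_ball_G by (intro asymp_eq_add asymp_eq_refl asymp_eq_sym[OF gauss_average_bounded]) auto
  also have "asymp_eq s0 (\<lambda>s. gauss_average ?F s + gauss_average (E \<inter> ?B) s) (gauss_average E)"
  proof (rule asymp_eq_refl)
    have "E = ?F \<union> (E \<inter> ?B)" by auto
    then show "gauss_average ?F s + gauss_average (E \<inter> ?B) s = gauss_average E s" for s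
      using gauss_average_Un[OF F FB] by (metis Int_assoc Compl_disjoint2 Int_commute Int_empty_right Int_left_commute)
  qed
  finally show ?thesis .
qed

lemma gauss_average_le_one: "F \<in> sets lebesgue \<Longrightarrow> 0 < s \<Longrightarrow> gauss_average F s \<le> 1"
  using gauss_average_compl[of F s] by (metis le_iff_add)

text \<open>\<open>asymp_eq_tendsto\<close> requires a finite limit, so each direction first derives
  an a priori bound on L from \<Phi>_E \<le> 1.\<close>

lemma Lambda_limit_iff:
  assumes E: "E \<in> sets lebesgue"
  shows "((\<lambda>s. ennreal s * Lambda R Rp \<kappa> E x r s) \<longlongrightarrow> L) (at_right 0) \<longleftrightarrow> (gauss_average E \<longlongrightarrow> L) (at_right 0)"
    and "(gauss_average E \<longlongrightarrow> L) (at_right 0) \<Longrightarrow> L \<le> 1"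
proof -
  have ev: "\<forall>\<^sub>F s in at_right (0::real). 0 < s \<and> s < 1"
    using eventually_at_right_real[OF zero_less_one] by eventually_elim auto
  show le_one: "(gauss_average E \<longlongrightarrow> L) (at_right 0) \<Longrightarrow> L \<le> 1"
  proof (rule tendsto_upperbound)
    show "\<forall>\<^sub>F s in at_right 0. gauss_average E s \<le> 1"
      using ev by eventually_elim (simp add: gauss_average_le_one E)
  qed auto
  show "((\<lambda>s. ennreal s * Lambda R Rp \<kappa> E x r s) \<longlongrightarrow> L) (at_right 0) \<longleftrightarrow> (gauss_average E \<longlongrightarrow> L) (at_right 0)"
  proof
    assume "(gauss_average E \<longlongrightarrow> L) (at_right 0)"
    moreover from le_one[OF this] have "L \<noteq> top" by (auto simp: top_unique)
    ultimately show "((\<lambda>s. ennreal s * Lambda R Rp \<kappa> E x r s) \<longlongrightarrow> L) (at_right 0)"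
      using asymp_eq_tendsto[OF Lambda_asymp[OF E, of 1]] by simp
  next
    assume lim: "((\<lambda>s. ennreal s * Lambda R Rp \<kappa> E x r s) \<longlongrightarrow> L) (at_right 0)"
    obtain C where C: "C \<ge> 0" "\<And>s. 0 < s \<Longrightarrow> s < 1 \<Longrightarrow> ennreal s * Lambda R Rp \<kappa> E x r s \<le> gauss_average E s + ennreal (C * s)"
      using Lambda_asymp[OF E, of 1 x r] unfolding asymp_eq_def by meson
    \<comment> \<open>For 0 < s < 1 the left side is at most \<Phi>_E(s) + C s, hence at most 1 +
      C.\<close>
    have "L \<le> ennreal (1 + C)"
    proof (rule tendsto_upperbound[OF lim])
      show "\<forall>\<^sub>F s in at_right 0. ennreal s * Lambda R Rp \<kappa> E x r s \<le> ennreal (1 + C)"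
        using ev
      proof eventually_elim
        case (elim s)
        have "ennreal (C * s) \<le> ennreal C" using elim C by (intro ennreal_leI mult_left_le) auto
        then have "gauss_average E s + ennreal (C * s) \<le> 1 + ennreal C"
          using gauss_average_le_one[OF E] elim by (intro add_mono) auto
        then show ?case using C(2)[of s] elim C(1) by auto
      qed
    qed simp
    then have "L \<noteq> top" by (auto simp: top_unique)
    then show "(gauss_average E \<longlongrightarrow> L) (at_right 0)"
      using asymp_eq_tendsto[OF asymp_eq_sym[OF Lambda_asymp[OF E]] _ lim, of 1] by simp
  qed
qed

lemma Xi_exists_iff:
  assumes E: "E \<in> sets lebesgue"
  shows "Xi_exists R Rp \<kappa> E \<longleftrightarrow> (\<exists>L. (gauss_average E \<longlongrightarrow> L) (at_right 0))"
  unfolding Xi_exists_def Lambda_limit_iff(1)[OF E] using zero_less_one by blast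

lemma Xi_eq:
  assumes E: "E \<in> sets lebesgue" and L: "(gauss_average E \<longlongrightarrow> L) (at_right 0)"
  shows "Xi R Rp \<kappa> E = enn2real L"
proof -
  have "(SOME L. \<exists>x r. 0 < r \<and> ((\<lambda>s. ennreal s * Lambda R Rp \<kappa> E x r s) \<longlongrightarrow> L) (at_right 0)) = L"
  proof (rule some_equality)
    show "\<exists>x r. 0 < r \<and> ((\<lambda>s. ennreal s * Lambda R Rp \<kappa> E x r s) \<longlongrightarrow> L) (at_right 0)"
      unfolding Lambda_limit_iff(1)[OF E] using L zero_less_one by blast
    fix L' assume "\<exists>x r. 0 < r \<and> ((\<lambda>s. ennreal s * Lambda R Rp \<kappa> E x r s) \<longlongrightarrow> L') (at_right 0)"
    then have "(gauss_average E \<longlongrightarrow> L') (at_right 0)" unfolding Lambda_limit_iff(1)[OF E] by blast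
    then show "L' = L" using L tendsto_unique[of "at_right (0::real)"] by (simp add: tendsto_unique)
  qed
  then show ?thesis by (simp add: Xi_def)
qed

end

section \<open>The limit of the perimeter\<close>

theorem theorem1p6:
  fixes R Rp :: "'a::euclidean_space set" and \<kappa> :: "'a \<Rightarrow> real"
    and \<Omega> E :: "'a set" and s0 :: real
  assumes "root_system R" and "positive_subsystem R Rp" and "multiplicity R \<kappa>"
    and "open \<Omega>" and "bounded \<Omega>"
    and "E \<in> sets lebesgue"
    and "0 < s0" and "s0 < 1/2"
    and "Per_s Rp \<kappa> s0 E \<Omega> < \<infinity>"
    and "Xi_exists R Rp \<kappa> E"
  shows "Xi_exists R Rp \<kappa> (- E)
    \<and> ((\<lambda>s. ennreal s * Per_s Rp \<kappa> s E \<Omega>) \<longlongrightarrow>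
          ennreal (2 * Xi R Rp \<kappa> (- E) * measure (dunkl_measure Rp \<kappa>) (E \<inter> \<Omega>)
                 + 2 * Xi R Rp \<kappa> E * measure (dunkl_measure Rp \<kappa>) (- E \<inter> \<Omega>))) (at_right 0)
    \<and> ((\<lambda>s. ennreal s * Per_s Rp \<kappa> s E \<Omega>) \<longlongrightarrow>
          ennreal (2 * ((1 - Xi R Rp \<kappa> E) * measure (dunkl_measure Rp \<kappa>) (E \<inter> \<Omega>)
                 + Xi R Rp \<kappa> E * measure (dunkl_measure Rp \<kappa>) (- E \<inter> \<Omega>)))) (at_right 0)"
proof -
  interpret dunkl_setting R Rp \<kappa>
    using assms(1-3) by unfold_locales
  note E = assms(6)
  have \<Omega>: "\<Omega> \<in> sets lebesgue" using assms(4) by simp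
  have E': "- E \<in> sets lebesgue" and \<Omega>': "- \<Omega> \<in> sets lebesgue"
    using E \<Omega> by (auto simp: Compl_in_sets_lebesgue)
  have sets: "E \<inter> \<Omega> \<in> sets lebesgue" "- E \<inter> \<Omega> \<in> sets lebesgue" "E \<inter> - \<Omega> \<in> sets lebesgue"
    "- E \<inter> - \<Omega> \<in> sets lebesgue"
    using E E' \<Omega> \<Omega>' by auto
  have bdd: "bounded (E \<inter> \<Omega>)" "bounded (- E \<inter> \<Omega>)"
    using assms(5) by (auto intro: bounded_subset)
  define a where "a = measure (dunkl_measure Rp \<kappa>) (E \<inter> \<Omega>)"
  define b where "b = measure (dunkl_measure Rp \<kappa>) (- E \<inter> \<Omega>)"
  have ab: "0 \<le> a" "0 \<le> b" by (auto simp: a_def b_def)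
  have fin: "L_s Rp \<kappa> s0 (E \<inter> \<Omega>) (- E \<inter> \<Omega>) < \<infinity>" "L_s Rp \<kappa> s0 (E \<inter> \<Omega>) (- E \<inter> - \<Omega>) < \<infinity>"
    "L_s Rp \<kappa> s0 (E \<inter> - \<Omega>) (- E \<inter> \<Omega>) < \<infinity>"
    using assms(9) by (auto simp: Per_s_def ennreal_mult_less_top)
  \<comment> \<open>Each of the three interactions has a bounded set in one slot. In the first one
    both sets are bounded; taking \<open>a\<close> as its factor lets it merge with the
    second.\<close>
  have "asymp_eq s0 (\<lambda>s. ennreal 2 * (ennreal s * L_s Rp \<kappa> s (E \<inter> \<Omega>) (- E \<inter> \<Omega>)
        + ennreal s * L_s Rp \<kappa> s (E \<inter> \<Omega>) (- E \<inter> - \<Omega>) + ennreal s * L_s Rp \<kappa> s (E \<inter> - \<Omega>) (- E \<inter> \<Omega>)))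
      (\<lambda>s. ennreal 2 * (ennreal a * gauss_average (- E \<inter> \<Omega>) s + ennreal a * gauss_average (- E \<inter> - \<Omega>) s
        + ennreal b * gauss_average (E \<inter> - \<Omega>) s))"
    unfolding a_def b_def
    by (intro asymp_eq_cmult asymp_eq_add L_s_asymp_gauss_average sets bdd fin) simp
  \<comment> \<open>The two averages with factor \<open>a\<close> add up to that of the complement
    of E, while E outside \<Omega> differs from E by a bounded set only.\<close>
  also have "asymp_eq s0 \<dots> (\<lambda>s. ennreal 2 * (ennreal a * gauss_average (- E) s + ennreal b * gauss_average E s))"
  proof (intro asymp_eq_cmult asymp_eq_add)
    have "(- E \<inter> \<Omega>) \<union> (- E \<inter> - \<Omega>) = - E" "(- E \<inter> \<Omega>) \<inter> (- E \<inter> - \<Omega>) = {}" by auto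
    then show "asymp_eq s0 (\<lambda>s. ennreal a * gauss_average (- E \<inter> \<Omega>) s + ennreal a * gauss_average (- E \<inter> - \<Omega>) s)
        (\<lambda>s. ennreal a * gauss_average (- E) s)"
      using gauss_average_Un[OF sets(2,4)] by (intro asymp_eq_refl) (simp add: distrib_left[symmetric])
    have "asymp_eq s0 (\<lambda>s. gauss_average (E \<inter> - \<Omega>) s + 0) (\<lambda>s. gauss_average (E \<inter> - \<Omega>) s + gauss_average (E \<inter> \<Omega>) s)"
      by (intro asymp_eq_add asymp_eq_refl asymp_eq_sym[OF gauss_average_bounded] sets bdd) simp
    moreover have "gauss_average E = (\<lambda>s. gauss_average (E \<inter> - \<Omega>) s + gauss_average (E \<inter> \<Omega>) s)"
    proof -
      have "(E \<inter> - \<Omega>) \<union> (E \<inter> \<Omega>) = E" "(E \<inter> - \<Omega>) \<inter> (E \<inter> \<Omega>) = {}" by auto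
      then show ?thesis using gauss_average_Un[OF sets(3,1)] by (intro ext) simp
    qed
    ultimately show "asymp_eq s0 (gauss_average (E \<inter> - \<Omega>)) (gauss_average E)" by simp
  qed (use ab in auto)
  finally have Per: "asymp_eq s0 (\<lambda>s. ennreal s * Per_s Rp \<kappa> s E \<Omega>)
      (\<lambda>s. ennreal 2 * (ennreal a * gauss_average (- E) s + ennreal b * gauss_average E s))"
    by (simp add: Per_s_def distrib_left mult_ac)
  obtain L where L: "(gauss_average E \<longlongrightarrow> L) (at_right 0)"
    using assms(10) Xi_exists_iff[OF E] by blast
  have L1: "L \<le> 1" by (rule Lambda_limit_iff(2)[OF E L])
  define \<xi> where "\<xi> = enn2real L"
  have L\<xi>: "L = ennreal \<xi>" using L1 by (auto simp: \<xi>_def top_unique intro!: ennreal_enn2real[symmetric] le_less_trans[of L 1])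
  have \<xi>: "0 \<le> \<xi>" "\<xi> \<le> 1" using L1 by (auto simp: L\<xi>) (simp add: \<xi>_def)
  have XiE: "Xi R Rp \<kappa> E = \<xi>" unfolding \<xi>_def by (rule Xi_eq[OF E L])
  \<comment> \<open>The truncated subtraction is exact here, because \<Phi>_E(s) is finite and the
    two averages add up to 1.\<close>
  have ev: "\<forall>\<^sub>F s in at_right (0::real). 1 - gauss_average E s = gauss_average (- E) s"
    using eventually_at_right_real[OF zero_less_one]
  proof eventually_elim
    case (elim s)
    then have "gauss_average E s \<noteq> top" using gauss_average_le_one[OF E, of s] by (auto simp: top_unique)
    then show ?case
      using gauss_average_compl[OF E, of s] elim by (metis ennreal_add_diff_cancel_left greaterThanLessThan_iff)
  qed
  have "((\<lambda>s. 1 - gauss_average E s) \<longlongrightarrow> 1 - L) (at_right 0)"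
    by (intro tendsto_diff_ennreal L tendsto_const) (simp_all add: L\<xi>)
  moreover have "1 - L = ennreal (1 - \<xi>)"
    using \<xi> by (simp add: L\<xi> ennreal_minus ennreal_1[symmetric] del: ennreal_1)
  ultimately have L': "(gauss_average (- E) \<longlongrightarrow> ennreal (1 - \<xi>)) (at_right 0)"
    using tendsto_cong[OF ev] by metis
  have XiE': "Xi R Rp \<kappa> (- E) = 1 - \<xi>" using Xi_eq[OF E' L'] \<xi> by simp
  have "((\<lambda>s. ennreal 2 * (ennreal a * gauss_average (- E) s + ennreal b * gauss_average E s)) \<longlongrightarrow>
      ennreal 2 * (ennreal a * ennreal (1 - \<xi>) + ennreal b * ennreal \<xi>)) (at_right 0)"
    using L by (intro ennreal_tendsto_cmult tendsto_add L') (auto simp: L\<xi>)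
  also have "ennreal 2 * (ennreal a * ennreal (1 - \<xi>) + ennreal b * ennreal \<xi>)
      = ennreal (2 * (a * (1 - \<xi>) + b * \<xi>))"
    using ab \<xi> by (simp add: ennreal_mult' ennreal_plus)
  finally have lim: "((\<lambda>s. ennreal s * Per_s Rp \<kappa> s E \<Omega>) \<longlongrightarrow> ennreal (2 * (a * (1 - \<xi>) + b * \<xi>))) (at_right 0)"
    by (rule asymp_eq_tendsto[OF Per assms(7)]) simp
  moreover have "Xi_exists R Rp \<kappa> (- E)"
    using Xi_exists_iff[OF E'] L' by blast
  ultimately show ?thesis
    unfolding XiE XiE' a_def[symmetric] b_def[symmetric] by (simp add: algebra_simps)
qed

end
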